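(* Let $K$ be a regular compact set with $K\subset[-1,1]$ and $\pm1\in K$, and let $n\in\mathbb N$. (i) Let $d\mu(x)=(1-x^2)\,d\mu_K(x)$ and $w(x)=\sqrt{1-x^2}$. Then $[W_{2,n}(\mu)]^2=2S(\mu)$ if and only if $K=\{z\in\mathbb C:(1-z^2)S_n^2(z)\in[0,1]\}$ for some polynomial $S_n$ of degree $n$. (ii) Let $d\mu(x)=(1+x)\,d\mu_K(x)$ and $w(x)=\sqrt{1+x}$. Then $[W_{2,n}(\mu)]^2=2S(\mu)$ if and only if $K=\{z\in\mathbb C:(1+z)S_n^2(z)\in[0,1]\}$ for some polynomial $S_n$ of degree $n$. (iii) Let $d\mu(x)=(1-x)\,d\mu_K(x)$ and $w(x)=\sqrt{1-x}$. Then $[W_{2,n}(\mu)]^2=2S(\mu)$ if and only if $K=\{z\in\mathbb C:(1-z)S_n^2(z)\in[0,1]\}$ for some polynomial $S_n$ of degree $n$. Moreover, in each of the three cases, if $[W_{2,n}(\mu)]^2=2S(\mu)$ and $S_n$ is the corresponding polynomial with leading coefficient $c$, then $$P_n(x;\mu)=\frac{S_n(x)}{c}=T^{(K)}_{n,w}(x).$$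
   Context: $\mu_K$ is the equilibrium measure and $\mathrm{Cap}(K)$ the logarithmic capacity of $K$; regular means regular for the Dirichlet problem. For a finite positive Borel measure $\mu$ with support $K$, write $d\mu=f\,d\mu_K+d\mu_s$ (Lebesgue decomposition) and $S(\mu)=\exp\big[\int\log f\,d\mu_K\big]$. $P_n(\cdot;\mu)$ is the monic polynomial of degree $n$ minimizing $\|P_n\|_{L_2(\mu)}$ and $W_{2,n}(\mu)=\|P_n(\cdot;\mu)\|_{L_2(\mu)}/\mathrm{Cap}(K)^n$. For a weight $w$ on $K$, $T^{(K)}_{n,w}$ is the monic polynomial of degree $n$ minimizing the sup-norm $\|wP_n\|_K$ over monic polynomials $P_n$ of degree $n$. *)

theory Defs
  imports "HOL-Probability.Probability" "HOL-Complex_Analysis.Complex_Analysis"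
    "HOL-Computational_Algebra.Polynomial"
begin

definition log_kernel_pos :: "real \<Rightarrow> real \<Rightarrow> ennreal" where
  "log_kernel_pos x y = (if x = y then \<infinity> else ennreal (max 0 (- ln \<bar>x - y\<bar>)))"

definition log_kernel_neg :: "real \<Rightarrow> real \<Rightarrow> ennreal" where
  "log_kernel_neg x y = (if x = y then 0 else ennreal (max 0 (ln \<bar>x - y\<bar>)))"

definition log_energy :: "real measure \<Rightarrow> ereal" where
  "log_energy M =
     enn2ereal (\<integral>\<^sup>+ x. \<integral>\<^sup>+ y. log_kernel_pos x y \<partial>M \<partial>M)
   - enn2ereal (\<integral>\<^sup>+ x. \<integral>\<^sup>+ y. log_kernel_neg x y \<partial>M \<partial>M)"

definition prob_on :: "real set \<Rightarrow> real measure \<Rightarrow> bool" where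
  "prob_on K M \<longleftrightarrow> sets M = sets borel \<and> emeasure M UNIV = 1 \<and> emeasure M (UNIV - K) = 0"

definition min_energy :: "real set \<Rightarrow> ereal" where
  "min_energy K = (INF M \<in> {M. prob_on K M}. log_energy M)"

definition log_capacity :: "real set \<Rightarrow> real" where
  "log_capacity K = (if min_energy K = \<infinity> then 0 else exp (- real_of_ereal (min_energy K)))"

definition equilibrium_measure :: "real set \<Rightarrow> real measure" where
  "equilibrium_measure K = (THE M. prob_on K M \<and> log_energy M = min_energy K)"

definition harmonic_on :: "(complex \<Rightarrow> real) \<Rightarrow> complex set \<Rightarrow> bool" where
  "harmonic_on u U \<longleftrightarrow>
     (\<forall>z\<in>U. \<exists>r>0. ball z r \<subseteq> U \<and>
        (\<exists>g. g holomorphic_on ball z r \<and> (\<forall>w\<in>ball z r. u w = Re (g w))))"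

definition harmonic_at_infinity :: "(complex \<Rightarrow> real) \<Rightarrow> bool" where
  "harmonic_at_infinity u \<longleftrightarrow>
     (\<exists>L r. r > 0 \<and> harmonic_on (\<lambda>w. if w = 0 then L else u (1 / w)) (ball 0 r))"

text \<open>K compact is regular: for every continuous boundary datum f on the boundary of
  the domain (Riemann sphere minus K), there is a function continuous on the closure
  of the domain (including infinity), harmonic in the domain (including infinity),
  with boundary values f.\<close>
definition dirichlet_regular :: "complex set \<Rightarrow> bool" where
  "dirichlet_regular K \<longleftrightarrow> compact K \<and> K \<noteq> {} \<and>
     (\<forall>f. continuous_on (frontier K) f \<longrightarrow>
        (\<exists>u. continuous_on (closure (- K)) u \<and> harmonic_on u (- K) \<and>
             harmonic_at_infinity u \<and> (\<forall>z\<in>frontier K. u z = f z)))"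

definition monic_polys :: "nat \<Rightarrow> real poly set" where
  "monic_polys n = {p. degree p = n \<and> lead_coeff p = 1}"

definition L2_norm :: "real measure \<Rightarrow> real poly \<Rightarrow> real" where
  "L2_norm M p = sqrt (enn2real (\<integral>\<^sup>+ x. ennreal ((poly p x)\<^sup>2) \<partial>M))"

definition orth_monic :: "real measure \<Rightarrow> nat \<Rightarrow> real poly" where
  "orth_monic M n = (THE p. p \<in> monic_polys n \<and>
      (\<forall>q\<in>monic_polys n. L2_norm M p \<le> L2_norm M q))"

definition widom_factor2 :: "real set \<Rightarrow> real measure \<Rightarrow> nat \<Rightarrow> real" where
  "widom_factor2 K M n = L2_norm M (orth_monic M n) / log_capacity K ^ n"

definition wsup_norm :: "real set \<Rightarrow> (real \<Rightarrow> real) \<Rightarrow> real poly \<Rightarrow> real" where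
  "wsup_norm K w p = (SUP x\<in>K. \<bar>w x * poly p x\<bar>)"

definition weighted_chebyshev :: "real set \<Rightarrow> (real \<Rightarrow> real) \<Rightarrow> nat \<Rightarrow> real poly" where
  "weighted_chebyshev K w n = (THE p. p \<in> monic_polys n \<and>
      (\<forall>q\<in>monic_polys n. wsup_norm K w p \<le> wsup_norm K w q))"

text \<open>S(mu) = exp(integral of log f d mu_K), for mu with absolutely continuous part
  f d mu_K; the integral of log f is taken in [-infinity, infinity), exp(-infinity) = 0.\<close>
definition szego :: "real measure \<Rightarrow> (real \<Rightarrow> real) \<Rightarrow> real" where
  "szego MK f =
    (let I = enn2ereal (\<integral>\<^sup>+ x. (if f x \<le> 0 then 0 else ennreal (max 0 (ln (f x)))) \<partial>MK)
           - enn2ereal (\<integral>\<^sup>+ x. (if f x \<le> 0 then \<infinity> else ennreal (max 0 (- ln (f x)))) \<partial>MK)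
     in if I = - \<infinity> then 0 else exp (real_of_ereal I))"

end

theory Submission
  imports Defs "HOL-Computational_Algebra.Fundamental_Theorem_Algebra"
begin

text \<open>
  On \<open>[-1,1]\<close> the logarithmic kernel has the expansion
  \<open>-ln (2|x-y|) = 2 \<Sum> T\<^sub>k(x) T\<^sub>k(y) / k\<close> in Chebyshev polynomials, so that the energy of a measure is
  a weighted sum of squares of its Chebyshev moments; Abel summation gives an increasing family of
  continuous kernels. Minimisers of the regularised energies satisfy \<open>U \<le> V\<^sub>n\<close> everywhere on \<open>K\<close>, so
  a Dirichlet barrier and the maximum principle yield \<open>U \<le> V\<close> on \<open>K\<close> for the potential
  \<open>U(z) = \<integral> ln |z-x| d\<mu>\<^sub>K(x)\<close> of the limit \<open>\<mu>\<^sub>K\<close>. Concavity of \<open>ln\<close> on the gaps of the support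
  then shows that the support is \<open>K\<close>, that \<open>U = V = ln (Cap K)\<close> on \<open>K\<close> and \<open>U > V\<close> off \<open>K\<close>.

  For a polynomial \<open>p = Q q\<^sup>2 \<ge> 0\<close> of degree \<open>N\<close> with leading coefficient of modulus 1 put \<open>c = Cap(K)\<^sup>N\<close>.
  Summing \<open>U\<close> over the zeros of \<open>p - t\<close> gives \<open>\<integral> ln |p - t| d\<mu>\<^sub>K \<ge> ln c\<close> for all \<open>t\<close>, with
  equality iff all these zeros lie in \<open>K\<close>. Integrating over \<open>t \<in> [0,4c]\<close> against the Marchenko-Pastur law,
  whose logarithmic potential is linear there and below that linear function to the right of it, gives
  \<open>\<integral> p d\<mu>\<^sub>K \<ge> 2c\<close>, with equality iff \<open>K\<close> is the preimage of \<open>[0,4c]\<close> under \<open>p\<close>. If only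
  \<open>p \<le> 4c\<close> on \<open>K\<close> is known, the arcsine law gives equality, which yields the statement on
  weighted Chebyshev polynomials.
\<close>

section \<open>Chebyshev expansion of the regularised logarithmic kernel\<close>

text \<open>With p = Q P_n^2 of degree N, W^2 is the integral of p against mu_K divided by Cap^(2n),
  and S(mu) = Cap^(deg Q) because the zeros of Q lie in K. So the theorem is about equality in
  "integral of p >= 2 Cap^N". An interval of length 4 Cap^N has capacity Cap^N, and the arcsine law
  of [0, 4 Cap^N] has mean 2 Cap^N. The obstacle: every statement must hold at each point of K,
  without exceptional sets of capacity zero, while regularity is available only as solvability of
  the Dirichlet problem. A minimiser of the true energy cannot be perturbed towards a point mass,
  whose energy is infinite; a regularised one can. Potentials are merely semicontinuous under weak
  limits, so the resulting pointwise bounds need a barrier that does not depend on n. The series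
  also makes the energy strictly convex, and this resolves the definite description in
  \<open>equilibrium_measure\<close>. The factor 2 in 2|x-y| is the reciprocal of the capacity of
  [-1,1].\<close>

lemma prob_on_sets: "prob_on K M \<Longrightarrow> sets M = sets borel"
  by (simp add: prob_on_def)

lemma prob_on_space: "prob_on K M \<Longrightarrow> space M = UNIV"
  using sets_eq_imp_space_eq[OF prob_on_sets[of K M]] by simp

lemma prob_on_prob_space: "prob_on K M \<Longrightarrow> prob_space M"
  using prob_on_space by (intro prob_spaceI) (auto simp: prob_on_def)

lemma prob_on_AE:
  assumes "prob_on K M" "closed K"
  shows "AE x in M. x \<in> K"
proof (rule AE_I[of _ _ "UNIV - K"])
  show "UNIV - K \<in> sets M"
    using assms by (simp add: prob_on_sets borel_closed sets.Diff)
qed (use assms in \<open>auto simp: prob_on_def\<close>)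

lemma prob_on_mono:
  assumes "prob_on K M" "K \<subseteq> L" "closed K" "closed L"
  shows "prob_on L M"
proof -
  have "emeasure M (UNIV - L) \<le> emeasure M (UNIV - K)"
    using assms by (intro emeasure_mono) (auto simp: prob_on_sets borel_closed sets.Diff)
  then show ?thesis using assms by (auto simp: prob_on_def)
qed

lemma prob_on_measurable:
  "prob_on K M \<Longrightarrow> f \<in> borel_measurable borel \<Longrightarrow> f \<in> borel_measurable M"
  by (subst measurable_cong_sets[OF prob_on_sets refl])

lemma prob_on_integrable:
  fixes f :: "real \<Rightarrow> 'a :: {banach, second_countable_topology}"
  assumes "prob_on K M" "closed K" "f \<in> borel_measurable borel" "\<And>x. x \<in> K \<Longrightarrow> norm (f x) \<le> B"
  shows "integrable M f"
proof -
  interpret prob_space M using assms(1) by (rule prob_on_prob_space)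
  show ?thesis
    using prob_on_AE[OF assms(1,2)] assms(4) prob_on_measurable[OF assms(1,3)]
    by (intro integrable_const_bound[where B=B]) (auto elim: eventually_mono)
qed

lemma prob_on_integral_const:
  fixes c :: "'a :: {banach, second_countable_topology}"
  assumes "prob_on K M" shows "(\<integral>x. c \<partial>M) = c"
proof -
  interpret prob_space M using assms(1) by (rule prob_on_prob_space)
  show ?thesis by (simp add: prob_space)
qed

lemma prob_on_norm_integral_le:
  fixes f :: "real \<Rightarrow> 'a :: {banach, second_countable_topology}"
  assumes "prob_on K M" "closed K" "f \<in> borel_measurable borel" "\<And>x. x \<in> K \<Longrightarrow> norm (f x) \<le> B"
  shows "norm (integral\<^sup>L M f) \<le> B"
proof -
  interpret prob_space M using assms(1) by (rule prob_on_prob_space)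
  have "norm (integral\<^sup>L M f) \<le> (\<integral>x. norm (f x) \<partial>M)" by (rule integral_norm_bound)
  also have "\<dots> \<le> (\<integral>x. B \<partial>M)"
    using prob_on_AE[OF assms(1,2)] assms prob_on_integrable[OF assms]
    by (intro integral_mono_AE) (auto elim: eventually_mono)
  finally show ?thesis by (simp add: prob_space)
qed

text \<open>Clamping the argument makes this continuous and bounded by 1 on the whole line, hence a
  test function for weak convergence; on [-1,1] it is the Chebyshev polynomial T_k.\<close>

definition cheb :: "nat \<Rightarrow> real \<Rightarrow> real" where
  "cheb k x = cos (real k * arccos (max (-1) (min 1 x)))"

lemma continuous_cheb: "continuous_on UNIV (cheb k)"
  unfolding cheb_def by (intro continuous_intros) auto

lemma borel_cheb [measurable]: "cheb k \<in> borel_measurable borel"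
  using continuous_cheb by (rule borel_measurable_continuous_onI)

lemma abs_cheb_le: "\<bar>cheb k x\<bar> \<le> 1"
  by (simp add: cheb_def)

lemma cheb_cos: "0 \<le> t \<Longrightarrow> t \<le> pi \<Longrightarrow> cheb k (cos t) = cos (real k * t)"
  by (simp add: cheb_def arccos_cos min_absorb2 max_absorb2)

lemma cheb_0 [simp]: "cheb 0 x = 1"
  by (simp add: cheb_def)

lemma cheb_1: "x \<in> {-1..1} \<Longrightarrow> cheb 1 x = x"
  by (simp add: cheb_def min_absorb2 max_absorb2)

text \<open>Abel summation with radius \<open>rad n\<close> regularises the kernel; \<open>reg_eps n\<close> is
  \<open>r + 1/r - 2\<close> for \<open>r = rad n\<close>.\<close>

definition rad :: "nat \<Rightarrow> real" where "rad n = real (n + 1) / real (n + 2)"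

definition reg_eps :: "nat \<Rightarrow> real" where "reg_eps n = 1 / (real (n + 1) * real (n + 2))"

lemma rad_bounds: "0 < rad n" "rad n < 1"
  by (auto simp: rad_def)

lemma rad_ge_half: "1/2 \<le> rad n"
  by (simp add: rad_def field_simps)

lemma rad_LIMSEQ: "rad \<longlonglongrightarrow> 1"
proof -
  have "(\<lambda>n. 1 - inverse (real (Suc (Suc n)))) \<longlonglongrightarrow> 1 - 0"
    by (intro tendsto_diff tendsto_const LIMSEQ_Suc[OF LIMSEQ_inverse_real_of_nat])
  moreover have "(\<lambda>n. 1 - inverse (real (Suc (Suc n)))) = rad"
    by (rule ext) (simp add: rad_def field_simps)
  ultimately show ?thesis by simp
qed

lemma ln_rad_LIMSEQ: "(\<lambda>n. ln (rad n)) \<longlonglongrightarrow> 0"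
  using tendsto_ln[OF rad_LIMSEQ] by simp

lemma reg_eps_eq: "reg_eps n = inverse (real (Suc n)) * inverse (real (Suc (Suc n)))"
  by (simp add: reg_eps_def field_simps)

lemma reg_eps_bounds: "0 < reg_eps n" "reg_eps n \<le> 1/2"
proof -
  show "0 < reg_eps n" by (simp add: reg_eps_eq)
  have "inverse (real (Suc n)) * inverse (real (Suc (Suc n))) \<le> 1 * (1/2)"
    by (intro mult_mono) (auto simp: field_simps)
  then show "reg_eps n \<le> 1/2" by (simp add: reg_eps_eq)
qed

lemma reg_eps_rad: "rad n * reg_eps n = (1 - rad n)\<^sup>2"
proof -
  have "1 - rad n = 1 / real (n + 2)" by (simp add: rad_def field_simps)
  moreover have "rad n * reg_eps n = (1 / real (n + 2)) * (1 / real (n + 2))"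
    by (simp add: rad_def reg_eps_def)
  ultimately show ?thesis by (simp add: power2_eq_square)
qed

lemma reg_eps_decseq: "m \<le> n \<Longrightarrow> reg_eps n \<le> reg_eps m"
  unfolding reg_eps_def by (intro divide_left_mono mult_mono) auto

lemma reg_eps_LIMSEQ: "reg_eps \<longlonglongrightarrow> 0"
proof (rule tendsto_sandwich)
  show "\<forall>\<^sub>F n in sequentially. 0 \<le> reg_eps n" using reg_eps_bounds by (auto simp: less_imp_le)
  show "\<forall>\<^sub>F n in sequentially. reg_eps n \<le> inverse (real (Suc n))"
    unfolding reg_eps_eq by (intro always_eventually allI mult_left_le) (auto simp: field_simps)
qed (use LIMSEQ_inverse_real_of_nat in auto)

text \<open>With x = cos a, y = cos b, r = \<open>rad n\<close> this is |1 - r e^(i(a+b))|^2 |1 - r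
  e^(i(a-b))|^2 / r^2, as verified in \<open>reg_kernel_sums\<close>. Dividing by r^2 leaves an
  expression that visibly decreases with \<open>reg_eps n\<close> to 4(x-y)^2.\<close>

definition reg_arg :: "nat \<Rightarrow> real \<Rightarrow> real \<Rightarrow> real" where
  "reg_arg n x y = 4 * (x - y)\<^sup>2 + reg_eps n * (reg_eps n + 4 - 4 * x * y)"

definition reg_kernel :: "nat \<Rightarrow> real \<Rightarrow> real \<Rightarrow> real" where
  "reg_kernel n x y = 4 - ln (reg_arg n x y) / 2"

text \<open>The offset 4 makes both kernels nonnegative on the square.\<close>

definition kernel :: "real \<Rightarrow> real \<Rightarrow> ennreal" where
  "kernel x y = (if x = y then \<infinity> else ennreal (4 - ln (2 * \<bar>x - y\<bar>)))"

lemma prod_le_1: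
  fixes x y :: real assumes "x \<in> {-1..1}" "y \<in> {-1..1}" shows "x * y \<le> 1" "-1 \<le> x * y"
proof -
  have "\<bar>x\<bar> * \<bar>y\<bar> \<le> 1 * 1" using assms by (intro mult_mono) auto
  then have "\<bar>x * y\<bar> \<le> 1" by (simp add: abs_mult)
  then show "x * y \<le> 1" "-1 \<le> x * y" by (auto simp: abs_le_iff)
qed

lemma reg_arg_pos:
  assumes "x \<in> {-1..1}" "y \<in> {-1..1}" shows "0 < reg_arg n x y"
proof -
  have "0 < reg_eps n * (reg_eps n + 4 - 4 * x * y)"
    using prod_le_1[OF assms] reg_eps_bounds[of n] by (intro mult_pos_pos) auto
  then show ?thesis unfolding reg_arg_def by (simp add: add_nonneg_pos)
qed

lemma reg_arg_antimono:
  assumes "x \<in> {-1..1}" "y \<in> {-1..1}" "m \<le> n" shows "reg_arg n x y \<le> reg_arg m x y"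
proof -
  have "reg_eps n * (reg_eps n + 4 - 4 * x * y) \<le> reg_eps m * (reg_eps m + 4 - 4 * x * y)"
    using prod_le_1[OF assms(1,2)] reg_eps_bounds[of n] reg_eps_bounds[of m] reg_eps_decseq[OF assms(3)]
    by (intro mult_mono) auto
  then show ?thesis unfolding reg_arg_def by simp
qed

lemma reg_kernel_mono:
  assumes "x \<in> {-1..1}" "y \<in> {-1..1}" "m \<le> n" shows "reg_kernel m x y \<le> reg_kernel n x y"
  using reg_arg_antimono[OF assms] reg_arg_pos[OF assms(1,2), of n] unfolding reg_kernel_def
  by (simp add: ln_mono)

lemma square_diff_le_4:
  fixes x y :: real assumes "x \<in> {-1..1}" "y \<in> {-1..1}" shows "(x - y)\<^sup>2 \<le> 4"
proof -
  have "\<bar>x - y\<bar>\<^sup>2 \<le> 2\<^sup>2" using assms by (intro power_mono) auto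
  then show ?thesis by simp
qed

lemma reg_kernel_nonneg:
  assumes "x \<in> {-1..1}" "y \<in> {-1..1}" shows "0 \<le> reg_kernel n x y"
proof -
  have "reg_eps n * (reg_eps n + 4 - 4 * x * y) \<le> (1/2) * (1/2 + 8)"
    using prod_le_1[OF assms] reg_eps_bounds[of n] by (intro mult_mono) auto
  \<comment> \<open>16 + 17/4 < 25, and 25 is a square: half its logarithm is ln 5, well below
    4.\<close>
  then have "reg_arg n x y \<le> 25"
    using square_diff_le_4[OF assms] unfolding reg_arg_def by simp
  then have "ln (reg_arg n x y) \<le> ln 25"
    using reg_arg_pos[OF assms] by (simp add: ln_mono)
  also have "ln (25::real) = 2 * ln 5"
    using ln_realpow[of 5 2] by simp
  also have "ln (5::real) \<le> 4" using ln_le_minus_one[of 5] by simp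
  finally show ?thesis by (simp add: reg_kernel_def)
qed

lemma kernel_nonneg:
  fixes x y :: real
  assumes "x \<in> {-1..1}" "y \<in> {-1..1}" shows "0 \<le> 4 - ln (2 * \<bar>x - y\<bar>)"
proof (cases "x = y")
  case False
  have "ln (2 * \<bar>x - y\<bar>) \<le> 2 * \<bar>x - y\<bar> - 1" using False by (intro ln_le_minus_one) auto
  also have "\<dots> \<le> 2 * 2 - 1" using assms by auto
  finally show ?thesis by simp
qed simp

lemma reg_kernel_SUP:
  assumes "x \<in> {-1..1}" "y \<in> {-1..1}"
  shows "(SUP n. ennreal (reg_kernel n x y)) = kernel x y"
proof (rule LIMSEQ_unique)
  have "incseq (\<lambda>n. ennreal (reg_kernel n x y))"
    using reg_kernel_mono[OF assms] by (intro monoI ennreal_leI) auto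
  then show "(\<lambda>n. ennreal (reg_kernel n x y)) \<longlonglongrightarrow> (SUP n. ennreal (reg_kernel n x y))"
    by (rule LIMSEQ_SUP)
  have "(\<lambda>n. reg_arg n x y) \<longlonglongrightarrow> 4 * (x - y)\<^sup>2 + 0 * (0 + 4 - 4 * x * y)"
    unfolding reg_arg_def by (intro tendsto_intros reg_eps_LIMSEQ)
  then have arg: "(\<lambda>n. reg_arg n x y) \<longlonglongrightarrow> 4 * (x - y)\<^sup>2" by simp
  show "(\<lambda>n. ennreal (reg_kernel n x y)) \<longlonglongrightarrow> kernel x y"
  proof (cases "x = y")
    case False
    have "(\<lambda>n. 4 - ln (reg_arg n x y) / 2) \<longlonglongrightarrow> 4 - ln (4 * (x - y)\<^sup>2) / 2"
      by (rule tendsto_diff[OF tendsto_const tendsto_divide[OF tendsto_ln[OF arg] tendsto_const]])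
         (use False in auto)
    moreover have "ln (4 * (x - y)\<^sup>2) = 2 * ln (2 * \<bar>x - y\<bar>)"
      using ln_realpow[of "2 * \<bar>x - y\<bar>" 2] False by (simp add: power_mult_distrib)
    ultimately have "(\<lambda>n. reg_kernel n x y) \<longlonglongrightarrow> 4 - ln (2 * \<bar>x - y\<bar>)"
      by (simp add: reg_kernel_def)
    then have "(\<lambda>n. ennreal (reg_kernel n x y)) \<longlonglongrightarrow> ennreal (4 - ln (2 * \<bar>x - y\<bar>))"
      by (rule tendsto_ennrealI)
    then show ?thesis using False by (simp add: kernel_def)
  next
    case True
    then have "(\<lambda>n. reg_arg n x y) \<longlonglongrightarrow> 0" using arg by simp
    then have "filterlim (\<lambda>n. reg_arg n x y) (at_right 0) sequentially"
      unfolding filterlim_at using reg_arg_pos[OF assms] by (auto intro!: always_eventually simp: less_le)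
    then have "filterlim (\<lambda>n. ln (reg_arg n x y)) at_bot sequentially"
      by (rule filterlim_compose[OF ln_at_0])
    then have "filterlim (\<lambda>n. - ln (reg_arg n x y)) at_top sequentially"
      by (simp add: filterlim_uminus_at_top)
    then have "filterlim (\<lambda>n. 4 + (1/2) * - ln (reg_arg n x y)) at_top sequentially"
      by (intro filterlim_tendsto_add_at_top[OF tendsto_const]
          filterlim_tendsto_pos_mult_at_top[OF tendsto_const]) auto
    then have "filterlim (\<lambda>n. reg_kernel n x y) at_top sequentially"
      unfolding reg_kernel_def by simp
    then have "((\<lambda>n. ennreal (reg_kernel n x y)) \<longlongrightarrow> \<infinity>) sequentially"
      by (simp add: ennreal_tendsto_top_eq_at_top)
    then show ?thesis using True by (simp add: kernel_def)
  qed
qed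

text \<open>Real part of the series of -Ln(1 - z) at z = r e^(it). The term k = 0 vanishes because
  division by 0 gives 0; all later series over k use this convention instead of starting at
  1.\<close>

lemma cos_series_sums:
  assumes "0 < r" "r < 1"
  shows "(\<lambda>k. r ^ k * cos (real k * t) / real k) sums - (ln (1 - 2 * r * cos t + r\<^sup>2) / 2)"
proof -
  define z where "z = of_real r * cis t"
  have nz: "cmod z < 1" using assms by (simp add: z_def norm_mult)
  then have ne: "1 - z \<noteq> 0" by auto
  have "(\<lambda>k. - (z ^ k) / of_nat k) sums ln (1 - z)"
    using Ln_series'[of "-z"] nz by simp
  then have "(\<lambda>k. Re (- (z ^ k) / of_nat k)) sums Re (ln (1 - z))"
    by (rule sums_Re)
  then have 1: "(\<lambda>k. - Re (- (z ^ k) / of_nat k)) sums - Re (ln (1 - z))"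
    by (rule sums_minus)
  have "(cmod (1 - z))\<^sup>2 = 1 - 2 * r * cos t + r\<^sup>2"
  proof -
    have "(cmod (1 - z))\<^sup>2 = (1 - r * cos t)\<^sup>2 + (r * sin t)\<^sup>2"
      by (simp add: cmod_power2 z_def)
    also have "\<dots> = 1 - 2 * r * cos t + r\<^sup>2"
      unfolding power_mult_distrib sin_squared_eq by (simp add: algebra_simps power2_eq_square)
    finally show ?thesis .
  qed
  then have 2: "Re (ln (1 - z)) = ln (1 - 2 * r * cos t + r\<^sup>2) / 2"
    using ln_realpow[of "cmod (1 - z)" 2] ne by simp
  have 3: "- Re (- (z ^ k) / of_nat k) = r ^ k * cos (real k * t) / real k" for k
    by (simp add: z_def power_mult_distrib Complex.DeMoivre Re_divide_of_nat
        flip: of_real_power)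
  show ?thesis using 1 unfolding 2 3 .
qed

text \<open>2 cos(ka) cos(kb) = cos(k(a+b)) + cos(k(a-b)) splits the sum into two series of the
  previous kind, so the kernel is the logarithm of a product of two moduli.\<close>

lemma reg_kernel_sums:
  assumes "x \<in> {-1..1}" "y \<in> {-1..1}"
  shows "(\<lambda>k. rad n ^ k * (cheb k x * cheb k y) / real k) sums
    ((reg_kernel n x y - 4 - ln (rad n)) / 2)"
proof -
  define r where "r = rad n"
  define a where "a = arccos x"
  define b where "b = arccos y"
  have x: "x = cos a" "cheb k x = cos (real k * a)" for k
    using assms by (auto simp: a_def cheb_def min_absorb2 max_absorb2)
  have y: "y = cos b" "cheb k y = cos (real k * b)" for k
    using assms by (auto simp: b_def cheb_def min_absorb2 max_absorb2)
  have r: "0 < r" "r < 1" using rad_bounds by (auto simp: r_def)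
  let ?p = "1 - 2 * r * cos (a + b) + r\<^sup>2" and ?q = "1 - 2 * r * cos (a - b) + r\<^sup>2"
  have pos: "0 < 1 - 2 * r * cos t + r\<^sup>2" for t
  proof -
    have "0 < (1 - r)\<^sup>2" using r by simp
    also have "\<dots> = 1 - 2 * r * 1 + r\<^sup>2" by (simp add: algebra_simps power2_eq_square)
    also have "\<dots> \<le> 1 - 2 * r * cos t + r\<^sup>2"
      using r by (intro add_right_mono diff_left_mono mult_left_mono) auto
    finally show ?thesis .
  qed
  have "(\<lambda>k. (r ^ k * cos (real k * (a + b)) / real k + r ^ k * cos (real k * (a - b)) / real k) / 2)
      sums ((- (ln ?p / 2) + - (ln ?q / 2)) / 2)"
    by (intro sums_divide sums_add cos_series_sums r)
  also have "(\<lambda>k. (r ^ k * cos (real k * (a + b)) / real k + r ^ k * cos (real k * (a - b)) / real k) / 2)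
      = (\<lambda>k. r ^ k * (cheb k x * cheb k y) / real k)"
    by (rule ext) (simp add: x(2) y(2) distrib_left right_diff_distrib cos_add cos_diff add_divide_distrib diff_divide_distrib)
  also have "(- (ln ?p / 2) + - (ln ?q / 2)) / 2 = - ln (?p * ?q) / 4"
    using pos[of "a + b"] pos[of "a - b"] by (simp add: ln_mult)
  \<comment> \<open>Difference of squares: with A = 1 + r^2 - 2rxy the factors are A + 2r sin a sin
    b and A - 2r sin a sin b.\<close>
  also have "?p * ?q = r\<^sup>2 * reg_arg n x y"
  proof -
    have e: "r * reg_eps n = (1 - r)\<^sup>2" using reg_eps_rad by (simp add: r_def)
    have "r\<^sup>2 * reg_arg n x y = 4 * r\<^sup>2 * (x - y)\<^sup>2 + (r * reg_eps n) * (r * reg_eps n + r * (4 - 4 * x * y))"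
      unfolding reg_arg_def by algebra
    also have "\<dots> = 4 * r\<^sup>2 * (x - y)\<^sup>2 + (1 - r)\<^sup>2 * ((1 - r)\<^sup>2 + r * (4 - 4 * x * y))"
      by (simp only: e)
    also have "\<dots> = (1 + r\<^sup>2 - 2 * r * (x * y))\<^sup>2 - 4 * r\<^sup>2 * ((1 - x\<^sup>2) * (1 - y\<^sup>2))"
      by algebra
    also have "(1 - x\<^sup>2) * (1 - y\<^sup>2) = (sin a * sin b)\<^sup>2"
      by (simp only: x(1) y(1) power_mult_distrib sin_squared_eq)
    also have "(1 + r\<^sup>2 - 2 * r * (x * y))\<^sup>2 - 4 * r\<^sup>2 * (sin a * sin b)\<^sup>2 = ?p * ?q"
      unfolding x(1) y(1) cos_add cos_diff by algebra
    finally show ?thesis ..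
  qed
  also have "- ln (r\<^sup>2 * reg_arg n x y) / 4 = (reg_kernel n x y - 4 - ln (rad n)) / 2"
    using reg_arg_pos[OF assms, of n] r ln_realpow[of r 2]
    by (simp add: ln_mult reg_kernel_def r_def add_divide_distrib diff_divide_distrib)
  finally show ?thesis by (simp add: r_def)
qed

section \<open>Potentials and energies\<close>

abbreviation cheb_moment :: "real measure \<Rightarrow> nat \<Rightarrow> real" where
  "cheb_moment M k \<equiv> integral\<^sup>L M (cheb k)"

text \<open>Given by moments and not by an integral of \<open>reg_kernel\<close>, so that
  bilinearity and weak limits can be read off term by term; \<open>nn_integral_reg_kernel\<close> is
  the bridge. The summand \<open>ln (rad n)\<close> accounts for the factor r^2 divided out in
  \<open>reg_arg\<close>.\<close>

definition reg_potential :: "nat \<Rightarrow> real measure \<Rightarrow> real \<Rightarrow> real" where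
  "reg_potential n M x = 4 + ln (rad n) + 2 * (\<Sum>k. rad n ^ k * (cheb k x * cheb_moment M k) / real k)"

definition reg_energy :: "nat \<Rightarrow> real measure \<Rightarrow> real measure \<Rightarrow> real" where
  "reg_energy n M N = 4 + ln (rad n) + 2 * (\<Sum>k. rad n ^ k * (cheb_moment M k * cheb_moment N k) / real k)"

definition potential :: "real measure \<Rightarrow> real \<Rightarrow> ennreal" where
  "potential M x = (\<integral>\<^sup>+ y. kernel x y \<partial>M)"

definition energy :: "real measure \<Rightarrow> real measure \<Rightarrow> ennreal" where
  "energy M N = (\<integral>\<^sup>+ x. potential N x \<partial>M)"

lemma summable_rad: "summable (\<lambda>k. rad n ^ k)"
  using rad_bounds[of n] by (intro summable_geometric) auto

lemma summable_rad_mult: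
  assumes "\<And>k. \<bar>c k\<bar> \<le> C"
  shows "summable (\<lambda>k. norm (rad n ^ k * c k / real k))"
proof (rule summable_comparison_test')
  show "summable (\<lambda>k. C * rad n ^ k)" by (intro summable_mult summable_rad)
  have C: "0 \<le> C" using assms[of 0] by (meson abs_ge_zero order_trans)
  show "norm (norm (rad n ^ k * c k / real k)) \<le> C * rad n ^ k" if "k \<ge> 0" for k
  proof (cases "k = 0")
    case False
    have "\<bar>rad n ^ k * c k\<bar> / real k \<le> \<bar>rad n ^ k * c k\<bar> / 1"
      using False by (intro divide_left_mono) auto
    also have "\<dots> = rad n ^ k * \<bar>c k\<bar>" using rad_bounds[of n] by (simp add: abs_mult)
    also have "\<dots> \<le> rad n ^ k * C" using assms rad_bounds[of n] by (intro mult_left_mono) auto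
    finally show ?thesis by (simp add: abs_mult mult.commute)
  qed (simp add: C)
qed

lemma abs_cheb_moment_le:
  assumes "prob_on K M" "closed K" shows "\<bar>cheb_moment M k\<bar> \<le> 1"
  using prob_on_norm_integral_le[OF assms, of "cheb k" 1] abs_cheb_le by auto

lemma abs_mult_le_1: "\<bar>a\<bar> \<le> 1 \<Longrightarrow> \<bar>b\<bar> \<le> 1 \<Longrightarrow> \<bar>a * b\<bar> \<le> (1::real)"
  unfolding abs_mult using mult_mono[of "\<bar>a\<bar>" 1 "\<bar>b\<bar>" 1] by simp

text \<open>Termwise integration under a geometric majorant. The coefficients c stay arbitrary
  because two cases occur: values \<open>cheb k x\<close> for potentials and moments of a second
  measure for energies.\<close>

lemma integral_cheb_series:
  assumes M: "prob_on K M" "closed K" and c: "\<And>k. \<bar>c k\<bar> \<le> 1"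
  shows "integrable M (\<lambda>x. \<Sum>k. rad n ^ k * (cheb k x * c k) / real k)"
    and "(\<integral>x. (\<Sum>k. rad n ^ k * (cheb k x * c k) / real k) \<partial>M)
       = (\<Sum>k. rad n ^ k * (cheb_moment M k * c k) / real k)"
proof -
  let ?f = "\<lambda>k x. rad n ^ k * (cheb k x * c k) / real k"
  have int: "integrable M (cheb k)" for k
    using abs_cheb_le by (intro prob_on_integrable[OF M, where B=1]) auto
  have 1: "integrable M (?f k)" for k
    using int by (auto intro!: integrable_mult_right integrable_mult_left integrable_divide)
  have b: "\<bar>cheb k x * c k\<bar> \<le> 1" for k x by (intro abs_mult_le_1 abs_cheb_le c)
  have 2: "AE x in M. summable (\<lambda>k. norm (?f k x))"
    by (intro AE_I2 summable_rad_mult[where C=1] b)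
  have 3: "summable (\<lambda>k. \<integral>x. norm (?f k x) \<partial>M)"
  proof (rule summable_comparison_test')
    show "summable (\<lambda>k. norm (rad n ^ k * 1 / real k))" by (rule summable_rad_mult[where C=1]) simp
    fix k :: nat
    have "norm (\<integral>x. norm (?f k x) \<partial>M) \<le> norm (rad n ^ k * 1 / real k)"
    proof (rule prob_on_norm_integral_le[OF M])
      show "(\<lambda>x. norm (?f k x)) \<in> borel_measurable borel" by measurable
      fix x assume "x \<in> K"
      have "norm (rad n ^ k / real k) * norm (cheb k x * c k) \<le> norm (rad n ^ k / real k) * 1"
        using b[of k x] by (intro mult_left_mono) auto
      then show "norm (norm (?f k x)) \<le> norm (rad n ^ k * 1 / real k)" by (simp add: abs_mult)
    qed
    then show "norm (\<integral>x. norm (?f k x) \<partial>M) \<le> norm (rad n ^ k * 1 / real k)" .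
  qed
  show "integrable M (\<lambda>x. \<Sum>k. ?f k x)" using integrable_suminf[OF 1 2 3] .
  have "(\<integral>x. (\<Sum>k. ?f k x) \<partial>M) = (\<Sum>k. \<integral>x. ?f k x \<partial>M)"
    using integral_suminf[OF 1 2 3] .
  then show "(\<integral>x. (\<Sum>k. ?f k x) \<partial>M) = (\<Sum>k. rad n ^ k * (cheb_moment M k * c k) / real k)"
    by simp
qed

lemma reg_kernel_eq:
  assumes "x \<in> {-1..1}" "y \<in> {-1..1}"
  shows "reg_kernel n x y = 4 + ln (rad n) + 2 * (\<Sum>k. rad n ^ k * (cheb k x * cheb k y) / real k)"
  using sums_unique[OF reg_kernel_sums[OF assms, of n]] by (simp add: field_simps)

lemma borel_reg_kernel [measurable]: "reg_kernel n x \<in> borel_measurable borel"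
  unfolding reg_kernel_def reg_arg_def by measurable

lemma borel_kernel [measurable]: "(\<lambda>(x, y). kernel x y) \<in> borel_measurable (borel \<Otimes>\<^sub>M borel)"
  unfolding kernel_def by measurable

lemma borel_kernel1 [measurable]: "kernel x \<in> borel_measurable borel"
  unfolding kernel_def by measurable

lemma nn_integral_reg_kernel:
  assumes M: "prob_on {-1..1} M" and x: "x \<in> {-1..1}"
  shows "(\<integral>\<^sup>+ y. ennreal (reg_kernel n x y) \<partial>M) = ennreal (reg_potential n M x)"
    and "0 \<le> reg_potential n M x"
proof -
  interpret prob_space M using M by (rule prob_on_prob_space)
  have AE: "AE y in M. y \<in> {-1..1}" using M by (rule prob_on_AE) simp
  let ?s = "\<lambda>y. 4 + ln (rad n) + 2 * (\<Sum>k. rad n ^ k * (cheb k y * cheb k x) / real k)"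
  note cs = integral_cheb_series[OF M, of "\<lambda>k. cheb k x" n, simplified abs_cheb_le, simplified]
  have int: "integrable M ?s"
    using cs(1) by auto
  have "(\<integral>y. ?s y \<partial>M) = reg_potential n M x"
    using cs by (simp add: reg_potential_def prob_space mult.commute)
  moreover have eq: "AE y in M. ?s y = reg_kernel n x y"
    using AE by eventually_elim (simp add: reg_kernel_eq[OF x] mult.commute)
  ultimately have *: "(\<integral>y. reg_kernel n x y \<partial>M) = reg_potential n M x"
    using prob_on_measurable[OF M borel_reg_kernel] borel_measurable_integrable[OF int] integral_cong_AE[of ?s M "reg_kernel n x"]
    by simp
  have intk: "integrable M (reg_kernel n x)"
    using prob_on_measurable[OF M borel_reg_kernel] eq by (intro integrable_cong_AE_imp[OF int]) auto
  have nn: "AE y in M. 0 \<le> reg_kernel n x y"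
    using AE by eventually_elim (rule reg_kernel_nonneg[OF x])
  show "(\<integral>\<^sup>+ y. ennreal (reg_kernel n x y) \<partial>M) = ennreal (reg_potential n M x)"
    using nn_integral_eq_integral[OF intk nn] * by simp
  show "0 \<le> reg_potential n M x" using integral_nonneg_AE[OF nn] * by simp
qed

lemma potential_SUP:
  assumes M: "prob_on {-1..1} M" and x: "x \<in> {-1..1}"
  shows "potential M x = (SUP n. ennreal (reg_potential n M x))"
    and "incseq (\<lambda>n. ennreal (reg_potential n M x))"
proof -
  have AE: "AE y in M. y \<in> {-1..1}" using M by (rule prob_on_AE) simp
  have mono: "AE y in M. ennreal (reg_kernel n x y) \<le> ennreal (reg_kernel (Suc n) x y)" for n
    using AE by eventually_elim (intro ennreal_leI reg_kernel_mono[OF x], auto)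
  have meas: "(\<lambda>y. ennreal (reg_kernel n x y)) \<in> borel_measurable M" for n
    by (intro prob_on_measurable[OF M]) measurable
  have "potential M x = (\<integral>\<^sup>+ y. (SUP n. ennreal (reg_kernel n x y)) \<partial>M)"
    unfolding potential_def
    by (rule nn_integral_cong_AE, use AE in eventually_elim, simp add: reg_kernel_SUP[OF x])
  also have "\<dots> = (SUP n. \<integral>\<^sup>+ y. ennreal (reg_kernel n x y) \<partial>M)"
    by (intro nn_integral_monotone_convergence_SUP_AE meas mono)
  finally show "potential M x = (SUP n. ennreal (reg_potential n M x))"
    by (simp add: nn_integral_reg_kernel[OF M x])
  show "incseq (\<lambda>n. ennreal (reg_potential n M x))"
  proof (rule incseq_SucI)
    fix n show "ennreal (reg_potential n M x) \<le> ennreal (reg_potential (Suc n) M x)"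
      using nn_integral_mono_AE[OF mono, of n] nn_integral_reg_kernel(1)[OF M x] by simp
  qed
qed

lemma energy_SUP:
  assumes M: "prob_on {-1..1} M" and N: "prob_on {-1..1} N"
  shows "energy M N = (SUP n. ennreal (reg_energy n M N))"
    and "incseq (\<lambda>n. ennreal (reg_energy n M N))"
    and "0 \<le> reg_energy n M N"
proof -
  interpret prob_space M using M by (rule prob_on_prob_space)
  have AE: "AE x in M. x \<in> {-1..1}" using M by (rule prob_on_AE) simp
  note cs = integral_cheb_series[OF M, of "cheb_moment N", OF _ abs_cheb_moment_le[OF N], simplified]
  have int: "integrable M (reg_potential n N)" for n
    unfolding reg_potential_def using cs(1)[of n] by auto
  have eq: "(\<integral>x. reg_potential n N x \<partial>M) = reg_energy n M N" for n
    using cs[of n] by (simp add: reg_potential_def reg_energy_def prob_space)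
  have nn: "AE x in M. 0 \<le> reg_potential n N x" for n
    using AE by eventually_elim (rule nn_integral_reg_kernel(2)[OF N])
  show "0 \<le> reg_energy n M N" using integral_nonneg_AE[OF nn, of n] by (simp add: eq)
  have e: "(\<integral>\<^sup>+ x. ennreal (reg_potential n N x) \<partial>M) = ennreal (reg_energy n M N)" for n
    using nn_integral_eq_integral[OF int nn] eq by simp
  have mono: "AE x in M. ennreal (reg_potential n N x) \<le> ennreal (reg_potential (Suc n) N x)" for n
    using AE by eventually_elim (use potential_SUP(2)[OF N] in \<open>auto simp: incseq_Suc_iff\<close>)
  have "energy M N = (\<integral>\<^sup>+ x. (SUP n. ennreal (reg_potential n N x)) \<partial>M)"
    unfolding energy_def
    by (rule nn_integral_cong_AE, use AE in eventually_elim, simp add: potential_SUP(1)[OF N])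
  also have "\<dots> = (SUP n. \<integral>\<^sup>+ x. ennreal (reg_potential n N x) \<partial>M)"
    using int by (intro nn_integral_monotone_convergence_SUP_AE mono) auto
  finally show "energy M N = (SUP n. ennreal (reg_energy n M N))" by (simp add: e)
  show "incseq (\<lambda>n. ennreal (reg_energy n M N))"
    using nn_integral_mono_AE[OF mono] e by (intro incseq_SucI) simp
qed

section \<open>Compactness and minimisers of the regularised energy\<close>

lemma prob_on_real_distribution: "prob_on K M \<Longrightarrow> real_distribution M"
  unfolding real_distribution_def real_distribution_axioms_def
  using prob_on_prob_space prob_on_sets prob_on_space by auto

definition weak_lim :: "(nat \<Rightarrow> real measure) \<Rightarrow> real measure \<Rightarrow> bool" where
  "weak_lim \<mu> M \<longleftrightarrow> (\<forall>f B. continuous_on UNIV f \<longrightarrow> (\<forall>x. \<bar>f x :: real\<bar> \<le> B) \<longrightarrow>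
     (\<lambda>n. integral\<^sup>L (\<mu> n) f) \<longlonglongrightarrow> integral\<^sup>L M f)"

lemma weak_limD:
  "weak_lim \<mu> M \<Longrightarrow> continuous_on UNIV f \<Longrightarrow> (\<And>x. \<bar>f x :: real\<bar> \<le> B) \<Longrightarrow>
     (\<lambda>n. integral\<^sup>L (\<mu> n) f) \<longlonglongrightarrow> integral\<^sup>L M f"
  unfolding weak_lim_def by blast

lemma weak_lim_cheb: "weak_lim \<mu> M \<Longrightarrow> (\<lambda>n. cheb_moment (\<mu> n) k) \<longlonglongrightarrow> cheb_moment M k"
  by (rule weak_limD[OF _ continuous_cheb abs_cheb_le])

text \<open>Measures on a bounded set are tight. The weak limit does not leave K, because the
  bounded continuous function \<open>min 1 (infdist x K)\<close> has integral 0 along the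
  sequence.\<close>

lemma prob_on_compactness:
  assumes K: "compact K" and \<mu>: "\<And>n. prob_on K (\<mu> n)"
  obtains s M where "strict_mono (s :: nat \<Rightarrow> nat)" "prob_on K M"
    "weak_lim (\<lambda>n. \<mu> (s n)) M"
proof -
  have cl: "closed K" using K by (rule compact_imp_closed)
  obtain C where C: "\<And>x. x \<in> K \<Longrightarrow> \<bar>x\<bar> \<le> C" 
    using compact_imp_bounded[OF K] unfolding bounded_iff by auto
  have "tight \<mu>" unfolding tight_def
  proof (intro conjI allI impI)
    show "real_distribution (\<mu> n)" for n using \<mu> by (rule prob_on_real_distribution)
    fix e :: real assume e: "0 < e"
    have "measure (\<mu> n) {- \<bar>C\<bar> - 1<..\<bar>C\<bar>} = 1" for n
    proof -
      interpret prob_space "\<mu> n" using \<mu> by (rule prob_on_prob_space)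
      have "AE x in \<mu> n. x \<in> {- \<bar>C\<bar> - 1<..\<bar>C\<bar>}"
        using prob_on_AE[OF \<mu> cl, of n] by eventually_elim (use C in fastforce)
      then show ?thesis
        using prob_on_sets[OF \<mu>, of n] by (subst prob_eq_1) auto
    qed
    then show "\<exists>a b. a < b \<and> (\<forall>n. 1 - e < measure (\<mu> n) {a<..b})"
      using e by (intro exI[of _ "- \<bar>C\<bar> - 1"] exI[of _ "\<bar>C\<bar>"]) auto
  qed
  from tight_imp_convergent_subsubsequence[OF this strict_mono_id]
  obtain s M where s: "strict_mono (s :: nat \<Rightarrow> nat)" and M: "real_distribution M"
    and conv: "weak_conv_m (\<mu> \<circ> id \<circ> s) M" by blast
  interpret M: real_distribution M by fact
  have rd: "real_distribution (\<mu> n)" for n using \<mu> by (rule prob_on_real_distribution)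
  have conv': "weak_conv_m (\<lambda>n. \<mu> (s n)) M" using conv by (simp add: o_def)
  have lim: "(\<lambda>n. integral\<^sup>L (\<mu> (s n)) f) \<longlonglongrightarrow> integral\<^sup>L M f"
    if "continuous_on UNIV f" "\<And>x. \<bar>f x :: real\<bar> \<le> B" for f B
    using that by (intro weak_conv_imp_integral_bdd_continuous_conv[OF rd M conv', where B=B])
      (auto simp: continuous_on_eq_continuous_at)
  have "prob_on K M"
  \<comment> \<open>The distance to the empty set is 0 everywhere and would test nothing.\<close>
  proof (cases "K = {}")
    case True
    then show ?thesis using \<mu>[of 0] by (auto simp: prob_on_def)
  next
    case False
    let ?g = "\<lambda>x. min 1 (infdist x K)"
    have g: "continuous_on UNIV ?g" by (intro continuous_intros)
    have gb: "\<bar>?g x\<bar> \<le> 1" for x by (simp add: infdist_nonneg)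
    have "integral\<^sup>L (\<mu> n) ?g = 0" for n
    proof -
      have "AE x in \<mu> n. ?g x = 0"
        using prob_on_AE[OF \<mu> cl, of n] by eventually_elim simp
      then show ?thesis by (rule integral_eq_zero_AE)
    qed
    then have "(\<lambda>n. integral\<^sup>L (\<mu> (s n)) ?g) = (\<lambda>n. 0)" by auto
    then have 0: "integral\<^sup>L M ?g = 0"
      using LIMSEQ_unique[OF lim[OF g gb]] by simp
    have int: "integrable M ?g"
      using borel_measurable_continuous_onI[OF g] gb
      by (intro M.integrable_const_bound[where B=1]) auto
    have "AE x in M. ?g x = 0"
      using 0 integral_nonneg_eq_0_iff_AE[OF int] by (auto simp: infdist_nonneg)
    then have "AE x in M. x \<in> K"
      by eventually_elim (use in_closed_iff_infdist_zero[OF cl False] in \<open>auto simp: min_def split: if_splits\<close>)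
    then have "emeasure M (UNIV - K) = 0"
      using M.events_eq_borel M.space_eq_univ cl
      by (subst (asm) AE_iff_measurable[of "UNIV - K"]) (auto simp: borel_closed sets.Diff)
    then show ?thesis
      using M.events_eq_borel M.space_eq_univ M.emeasure_space_1 by (simp add: prob_on_def)
  qed
  moreover have "weak_lim (\<lambda>n. \<mu> (s n)) M" unfolding weak_lim_def using lim by blast
  ultimately show thesis using s by (intro that)
qed

section \<open>Point masses, mixtures and the first variation of the regularised energy\<close>

lemma prob_on_return:
  assumes "x \<in> K" "closed K" shows "prob_on K (return borel x)"
  using assms by (auto simp: prob_on_def emeasure_return borel_closed sets.Diff)

lemma cheb_moment_return: "cheb_moment (return borel x) k = cheb k x"
  by (simp add: integral_return)

lemma reg_energy_return: "reg_energy n (return borel x) M = reg_potential n M x"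
  by (simp add: reg_energy_def reg_potential_def cheb_moment_return)

text \<open>The convex combination (1-t)M + tN as a Bernoulli bind. Only its Chebyshev moments are
  exported, since the regularised energies depend on nothing else.\<close>

lemma prob_on_mixture:
  assumes M: "prob_on K M" and N: "prob_on K N" and K: "closed K" and t: "0 \<le> t" "t \<le> 1"
  obtains L where "prob_on K L"
    "\<And>k. cheb_moment L k = (1 - t) * cheb_moment M k + t * cheb_moment N k"
proof -
  define L where "L = measure_pmf (bernoulli_pmf t) \<bind> (\<lambda>b. if b then N else M)"
  have MN: "M \<in> space (subprob_algebra borel)" "N \<in> space (subprob_algebra borel)"
    using prob_on_prob_space[OF M] prob_on_prob_space[OF N] prob_on_sets[OF M] prob_on_sets[OF N]
    by (auto simp: space_subprob_algebra prob_space_imp_subprob_space)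
  have meas: "(\<lambda>b. if b then N else M) \<in> measurable (measure_pmf (bernoulli_pmf t)) (subprob_algebra borel)"
    using MN by (auto simp: measurable_def)
  have nn: "(\<integral>\<^sup>+ x. f x \<partial>L) = (\<integral>\<^sup>+ x. f x \<partial>N) * ennreal t + (\<integral>\<^sup>+ x. f x \<partial>M) * ennreal (1 - t)"
    if "f \<in> borel_measurable borel" for f
    unfolding L_def using t by (subst nn_integral_bind[OF that meas]) simp
  have sets: "sets L = sets borel"
    unfolding L_def using prob_on_sets[OF M] prob_on_sets[OF N] by (intro sets_bind) auto
  have em: "emeasure L X = emeasure N X * ennreal t + emeasure M X * ennreal (1 - t)"
    if "X \<in> sets borel" for X
    using nn[of "indicator X"] that sets prob_on_sets[OF M] prob_on_sets[OF N] by simp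
  have L: "prob_on K L"
    unfolding prob_on_def using sets em[of UNIV] em[of "UNIV - K"] M N K t
    by (auto simp: prob_on_def borel_closed sets.Diff simp flip: ennreal_plus)
  have "cheb_moment L k = (1 - t) * cheb_moment M k + t * cheb_moment N k" for k
  proof -
    \<comment> \<open>The shift by 1 makes the integrand nonnegative, so that the formula for
      nonnegative integrals over the bind applies.\<close>
    have e: "(\<integral>\<^sup>+ x. ennreal (cheb k x + 1) \<partial>P) = ennreal (cheb_moment P k + 1)"
      and p: "0 \<le> cheb_moment P k + 1" if P: "prob_on K P" for P
    proof -
      interpret prob_space P using P by (rule prob_on_prob_space)
      have int: "integrable P (cheb k)"
        using abs_cheb_le by (intro prob_on_integrable[OF P K, where B=1]) auto
      have nonneg: "0 \<le> cheb k x + 1" for x using abs_cheb_le[of k x] by linarith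
      show "(\<integral>\<^sup>+ x. ennreal (cheb k x + 1) \<partial>P) = ennreal (cheb_moment P k + 1)"
        using int nonneg by (subst nn_integral_eq_integral) (auto simp: prob_space)
      show "0 \<le> cheb_moment P k + 1" using abs_cheb_moment_le[OF P K, of k] by linarith
    qed
    have "ennreal (cheb_moment L k + 1) = ennreal (cheb_moment N k + 1) * ennreal t + ennreal (cheb_moment M k + 1) * ennreal (1 - t)"
      using nn[of "\<lambda>x. ennreal (cheb k x + 1)"] by (simp add: e[OF L] e[OF M] e[OF N])
    also have "\<dots> = ennreal ((cheb_moment N k + 1) * t + (cheb_moment M k + 1) * (1 - t))"
      using t p[OF M] p[OF N] by (simp add: ennreal_mult ennreal_plus)
    finally have "cheb_moment L k + 1 = (cheb_moment N k + 1) * t + (cheb_moment M k + 1) * (1 - t)"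
      using t p[OF M] p[OF N] p[OF L] by (subst (asm) ennreal_inj) auto
    then show ?thesis by (simp add: algebra_simps)
  qed
  with L show thesis by (rule that)
qed

lemma reg_series_summable:
  assumes "prob_on K M" "prob_on K' N" "closed K" "closed K'"
  shows "summable (\<lambda>k. rad n ^ k * (cheb_moment M k * cheb_moment N k) / real k)"
  using assms by (intro summable_norm_cancel[OF summable_rad_mult[where C=1]] abs_mult_le_1 abs_cheb_moment_le)

lemma reg_energy_mixture:
  assumes M: "prob_on K M" and N: "prob_on K N" and K: "closed K"
    and L: "\<And>k. cheb_moment L k = (1 - t) * cheb_moment M k + t * cheb_moment N k"
  shows "reg_energy n L L = (1 - t)\<^sup>2 * reg_energy n M M + 2 * t * (1 - t) * reg_energy n M N + t\<^sup>2 * reg_energy n N N"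
proof -
  let ?c = "cheb_moment M" and ?d = "cheb_moment N" and ?a = "\<lambda>k. rad n ^ k"
  have s: "summable (\<lambda>k. ?a k * (?c k * ?c k) / real k)" "summable (\<lambda>k. ?a k * (?c k * ?d k) / real k)"
    "summable (\<lambda>k. ?a k * (?d k * ?d k) / real k)"
    using reg_series_summable[OF M M K K] reg_series_summable[OF M N K K] reg_series_summable[OF N N K K] by auto
  have "(\<Sum>k. ?a k * (cheb_moment L k * cheb_moment L k) / real k) =
    (\<Sum>k. (1 - t)\<^sup>2 * (?a k * (?c k * ?c k) / real k) + 2 * t * (1 - t) * (?a k * (?c k * ?d k) / real k)
      + t\<^sup>2 * (?a k * (?d k * ?d k) / real k))"
    by (intro arg_cong[where f=suminf] ext) (simp add: L power2_eq_square add_divide_distrib diff_divide_distrib algebra_simps)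
  also have "\<dots> = (1 - t)\<^sup>2 * (\<Sum>k. ?a k * (?c k * ?c k) / real k) + 2 * t * (1 - t) * (\<Sum>k. ?a k * (?c k * ?d k) / real k)
      + t\<^sup>2 * (\<Sum>k. ?a k * (?d k * ?d k) / real k)"
    by (rule sums_unique[symmetric]) (intro sums_add sums_mult summable_sums s)
  finally show ?thesis
    unfolding reg_energy_def by (simp add: algebra_simps power2_eq_square)
qed

text \<open>Fatou's lemma for series: each partial sum passes to the limit, and the bound on partial
  sums then yields convergence too.\<close>

lemma suminf_le_lim:
  fixes f :: "nat \<Rightarrow> nat \<Rightarrow> real"
  assumes "\<And>j k. 0 \<le> f j k" "\<And>j. summable (f j)" "\<And>k. (\<lambda>j. f j k) \<longlonglongrightarrow> g k"
    and "\<And>j. suminf (f j) \<le> B j" "B \<longlonglongrightarrow> b"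
  shows "summable g" "suminf g \<le> b"
proof -
  have g: "0 \<le> g k" for k using assms(1,3) by (intro LIMSEQ_le_const[of "\<lambda>j. f j k"]) auto
  have p: "(\<Sum>k<m. g k) \<le> b" for m
  proof (rule LIMSEQ_le)
    show "(\<lambda>j. \<Sum>k<m. f j k) \<longlonglongrightarrow> (\<Sum>k<m. g k)" by (intro tendsto_sum assms)
    show "B \<longlonglongrightarrow> b" by fact
    have "(\<Sum>k<m. f j k) \<le> B j" for j
      using sum_le_suminf[OF assms(2), of "{..<m}" j] assms(1,4)[of j] by fastforce
    then show "\<exists>N. \<forall>n\<ge>N. (\<Sum>k<m. f n k) \<le> B n" by auto
  qed
  show s: "summable g"
    using g p by (intro summableI_nonneg_bounded[where x=b])
  show "suminf g \<le> b" using s p by (intro suminf_le_const) auto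
qed

text \<open>Direct method: the energy is a series of nonnegative terms, each continuous under weak
  convergence, hence lower semicontinuous along a minimising sequence.\<close>

lemma reg_energy_minimizer:
  assumes K: "compact K" "K \<noteq> {}" "K \<subseteq> {-1..1}"
  obtains M where "prob_on K M" "\<And>N. prob_on K N \<Longrightarrow> reg_energy n M M \<le> reg_energy n N N"
proof -
  have cl: "closed K" using K by (simp add: compact_imp_closed)
  have mono: "prob_on {-1..1} N" if "prob_on K N" for N
    using prob_on_mono[OF that K(3) cl] by simp
  define S where "S = {reg_energy n N N | N. prob_on K N}"
  have ne: "S \<noteq> {}" using K(2) prob_on_return[OF _ cl] by (auto simp: S_def)
  have bdd: "bdd_below S"
  proof (rule bdd_belowI)
    fix e assume "e \<in> S"
    then obtain N where "prob_on K N" "e = reg_energy n N N" by (auto simp: S_def)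
    then show "0 \<le> e" using energy_SUP(3)[OF mono mono] by blast
  qed
  have "\<exists>N. prob_on K N \<and> reg_energy n N N < Inf S + inverse (real (Suc j))" for j
    using cInf_lessD[OF ne, of "Inf S + inverse (real (Suc j))"] by (auto simp: S_def)
  then have "\<exists>N. \<forall>j. prob_on K (N j) \<and> reg_energy n (N j) (N j) < Inf S + inverse (real (Suc j))"
    by (intro choice allI)
  then obtain N where N: "\<And>j. prob_on K (N j)"
    "\<And>j. reg_energy n (N j) (N j) < Inf S + inverse (real (Suc j))" by blast
  obtain s M where s: "strict_mono (s :: nat \<Rightarrow> nat)"
    and M: "prob_on K M" and lim: "weak_lim (\<lambda>j. N (s j)) M"
    using prob_on_compactness[OF K(1), of N, OF N(1)] by blast
  note c = weak_lim_cheb[OF lim]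
  have "(\<Sum>k. rad n ^ k * (cheb_moment M k * cheb_moment M k) / real k) \<le> (Inf S + 0 - 4 - ln (rad n)) / 2"
  proof (rule suminf_le_lim(2))
    show "(\<lambda>j. rad n ^ k * (cheb_moment (N (s j)) k * cheb_moment (N (s j)) k) / real k)
      \<longlonglongrightarrow> rad n ^ k * (cheb_moment M k * cheb_moment M k) / real k" for k
      unfolding divide_inverse by (intro tendsto_mult tendsto_const c)
    show "summable (\<lambda>k. rad n ^ k * (cheb_moment (N (s j)) k * cheb_moment (N (s j)) k) / real k)" for j
      by (rule reg_series_summable[OF N(1) N(1) cl cl])
    show "(\<Sum>k. rad n ^ k * (cheb_moment (N (s j)) k * cheb_moment (N (s j)) k) / real k)
      \<le> (Inf S + inverse (real (Suc (s j))) - 4 - ln (rad n)) / 2" for j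
      using N(2)[of "s j"] unfolding reg_energy_def by simp
    have "(\<lambda>j. inverse (real (Suc (s j)))) \<longlonglongrightarrow> 0"
      using LIMSEQ_subseq_LIMSEQ[OF LIMSEQ_inverse_real_of_nat s] by (simp add: o_def)
    then show "(\<lambda>j. (Inf S + inverse (real (Suc (s j))) - 4 - ln (rad n)) / 2) \<longlonglongrightarrow> (Inf S + 0 - 4 - ln (rad n)) / 2"
      by (intro tendsto_intros) auto
    show "0 \<le> rad n ^ k * (cheb_moment (N (s j)) k * cheb_moment (N (s j)) k) / real k" for j k
      using rad_bounds[of n] by simp
  qed
  then have "reg_energy n M M \<le> Inf S" unfolding reg_energy_def by simp
  also have "Inf S \<le> reg_energy n N' N'" if "prob_on K N'" for N'
    using bdd that by (intro cInf_lower) (auto simp: S_def)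
  finally show thesis using M by (intro that)
qed

text \<open>First-order condition at a minimum. If a < 0, a step t of size at most -a/(|b|+1) leaves
  2a + bt < 0; the +1 covers b = 0.\<close>

lemma nonneg_slopeI:
  fixes a b :: real
  assumes "\<And>t. 0 < t \<Longrightarrow> t \<le> 1 \<Longrightarrow> 0 \<le> 2 * a * t + b * t\<^sup>2"
  shows "0 \<le> a"
proof (rule ccontr)
  assume "\<not> 0 \<le> a"
  then have a: "a < 0" by simp
  define t where "t = min 1 (- a / (\<bar>b\<bar> + 1))"
  have t: "0 < t" "t \<le> 1" using a by (auto simp: t_def intro!: divide_neg_pos)
  have "t * (\<bar>b\<bar> + 1) \<le> - a" 
    using mult_right_mono[of t "- a / (\<bar>b\<bar> + 1)" "\<bar>b\<bar> + 1"] by (simp add: t_def)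
  moreover have "b * t \<le> t * (\<bar>b\<bar> + 1)"
    using t mult_right_mono[of b "\<bar>b\<bar> + 1" t] by (simp add: mult.commute)
  ultimately have "2 * a + b * t < 0" using a by linarith
  then have "t * (2 * a + b * t) < 0" using t by (simp add: mult_pos_neg)
  then show False using assms[OF t] by (simp add: algebra_simps power2_eq_square)
qed

text \<open>Perturbation towards the point mass at x, which has finite regularised energy. This
  gives the Frostman inequality at every single point of K; with the singular kernel it would hold
  only outside a set of capacity zero.\<close>

lemma reg_minimizer_potential_ge:
  assumes K: "compact K" "K \<subseteq> {-1..1}" and M: "prob_on K M"
    and min: "\<And>N. prob_on K N \<Longrightarrow> reg_energy n M M \<le> reg_energy n N N" and x: "x \<in> K"
  shows "reg_energy n M M \<le> reg_potential n M x"
proof -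
  have cl: "closed K" using K by (simp add: compact_imp_closed)
  let ?N = "return borel x"
  have N: "prob_on K ?N" by (rule prob_on_return[OF x cl])
  have "0 \<le> reg_energy n M ?N - reg_energy n M M"
  proof (rule nonneg_slopeI)
    fix t :: real assume t: "0 < t" "t \<le> 1"
    from prob_on_mixture[OF M N cl, of t] t obtain L where L: "prob_on K L"
      "\<And>k. cheb_moment L k = (1 - t) * cheb_moment M k + t * cheb_moment ?N k" by auto
    show "0 \<le> 2 * (reg_energy n M ?N - reg_energy n M M) * t
       + (reg_energy n M M - 2 * reg_energy n M ?N + reg_energy n ?N ?N) * t\<^sup>2"
      using min[OF L(1)] unfolding reg_energy_mixture[OF M N cl L(2)]
      by (simp add: algebra_simps power2_eq_square)
  qed
  moreover have "reg_energy n M ?N = reg_potential n M x"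
    by (simp add: reg_energy_return[symmetric] reg_energy_def mult.commute)
  ultimately show ?thesis by simp
qed

section \<open>Chebyshev moments determine the measure\<close>

lemma cheb_times: 
  assumes "x \<in> {-1..1}" shows "x * cheb k x = (cheb (k + 1) x + cheb (if k = 0 then 1 else k - 1) x) / 2"
proof (cases k)
  case 0
  then show ?thesis using cheb_1[OF assms] by simp
next
  case (Suc m)
  define a where "a = arccos x"
  have x: "x = cos a" "cheb k x = cos (real k * a)" for k
    using assms by (auto simp: a_def cheb_def min_absorb2 max_absorb2)
  have e: "real (k + 1) * a = real k * a + a" "real m * a = real k * a - a"
    by (simp_all add: Suc algebra_simps)
  have "cos (real (k + 1) * a) + cos (real m * a) = 2 * (cos (real k * a) * cos a)"
    unfolding e cos_add cos_diff by simp
  then show ?thesis unfolding x(2) using Suc x(1) by simp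
qed

text \<open>All mixed moments of x^m T_k agree by induction on m: the recurrence absorbs one factor
  x into T_k, which is why k is generalised. The case k = 0 gives the power moments, then polynomial
  approximation and characteristic functions finish. Equality is assumed for k > 0 only, as the
  energy series does not see k = 0.\<close>

lemma cheb_moments_determine:
  assumes M: "prob_on {-1..1} M" and N: "prob_on {-1..1} N"
    and eq: "\<And>k. k > 0 \<Longrightarrow> cheb_moment M k = cheb_moment N k"
  shows "M = N"
proof -
  have AE: "AE x in P. x \<in> {-1..1}" if "prob_on {-1..1} P" for P using that by (rule prob_on_AE) simp
  have int: "integrable P (\<lambda>x. x ^ m * cheb k x)" if P: "prob_on {-1..1} P" for P m k
  proof (rule prob_on_integrable[OF P, where B=1])
    fix x :: real assume "x \<in> {-1..1}"
    then have "\<bar>x ^ m\<bar> \<le> 1" unfolding power_abs by (intro power_le_one) auto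
    then show "norm (x ^ m * cheb k x) \<le> 1" using abs_mult_le_1[OF _ abs_cheb_le] by simp
  qed auto
  have mom: "(\<integral>x. x ^ m * cheb k x \<partial>M) = (\<integral>x. x ^ m * cheb k x \<partial>N)" for m k
  proof (induction m arbitrary: k)
    case 0
    show ?case
    proof (cases "k = 0")
      case True
      then show ?thesis using prob_on_integral_const[OF M, of "1::real"] prob_on_integral_const[OF N, of "1::real"] by simp
    qed (use eq in simp)
  next
    case (Suc m)
    let ?j = "if k = 0 then 1 else k - 1"
    have "(\<integral>x. x ^ Suc m * cheb k x \<partial>P) = ((\<integral>x. x ^ m * cheb (k + 1) x \<partial>P) + (\<integral>x. x ^ m * cheb ?j x \<partial>P)) / 2"
      if P: "prob_on {-1..1} P" for P
    proof -
      have "(\<integral>x. x ^ Suc m * cheb k x \<partial>P) = (\<integral>x. (x ^ m * cheb (k + 1) x + x ^ m * cheb ?j x) / 2 \<partial>P)"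
      proof (rule integral_cong_AE)
        show "AE x in P. x ^ Suc m * cheb k x = (x ^ m * cheb (k + 1) x + x ^ m * cheb ?j x) / 2"
          using AE[OF P]
        proof eventually_elim
          fix x :: real assume "x \<in> {-1..1}"
          have "x ^ Suc m * cheb k x = x ^ m * (x * cheb k x)" by simp
          also have "\<dots> = x ^ m * ((cheb (k + 1) x + cheb ?j x) / 2)"
            using cheb_times[OF \<open>x \<in> {-1..1}\<close>, of k] by simp
          finally show "x ^ Suc m * cheb k x = (x ^ m * cheb (k + 1) x + x ^ m * cheb ?j x) / 2"
            by (simp add: distrib_left)
        qed
      qed (intro prob_on_measurable[OF P]; measurable)+
      then show ?thesis using int[OF P] by simp
    qed
    from this[OF M] this[OF N] show ?case using Suc.IH by metis
  qed
  have poly: "integral\<^sup>L M g = integral\<^sup>L N g" if g: "real_polynomial_function g" for g :: "real \<Rightarrow> real"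
  proof -
    obtain a n where g: "g = (\<lambda>x. \<Sum>i\<le>n. a i * x ^ i)"
      using g unfolding real_polynomial_function_iff_sum by auto
    have i: "integrable P (\<lambda>x. x ^ i)" if "prob_on {-1..1} P" for P i using int[OF that, of i 0] by simp
    have m: "(\<integral>x. x ^ i \<partial>M) = (\<integral>x. x ^ i \<partial>N)" for i using mom[of i 0] by simp
    show ?thesis unfolding g using i[OF M] i[OF N] m by simp
  qed
  have cont: "integral\<^sup>L M f = integral\<^sup>L N f" if f: "continuous_on UNIV f" for f :: "real \<Rightarrow> real"
  proof (rule ccontr)
    assume ne: "integral\<^sup>L M f \<noteq> integral\<^sup>L N f"
    define e where "e = \<bar>integral\<^sup>L M f - integral\<^sup>L N f\<bar> / 3"
    have e: "e > 0" using ne by (simp add: e_def)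
    have f1: "continuous_on {-1..1} f" using f continuous_on_subset by blast
    obtain g where g: "real_polynomial_function g" "\<And>x. x \<in> {-1..1} \<Longrightarrow> \<bar>f x - g x\<bar> < e"
      using Stone_Weierstrass_real_polynomial_function[OF _ f1 e] by auto
    have cg: "continuous_on UNIV g" using g(1) by (simp add: continuous_on_polymonial_function real_polynomial_function_eq)
    have bounded_int: "integrable P h" if P: "prob_on {-1..1} P" and h: "continuous_on UNIV h" for P and h :: "real \<Rightarrow> real"
    proof -
      have "compact (h ` {-1..1})" 
        by (intro compact_continuous_image continuous_on_subset[OF h]) auto
      then obtain B where "\<And>x. x \<in> {-1..1} \<Longrightarrow> norm (h x) \<le> B"
        by (metis imageI compact_imp_bounded bounded_iff)
      then show ?thesis using P h by (intro prob_on_integrable[OF P, where B=B]) (auto intro: borel_measurable_continuous_onI)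
    qed
    have d: "\<bar>integral\<^sup>L P f - integral\<^sup>L P g\<bar> \<le> e" if P: "prob_on {-1..1} P" for P
    proof -
      have "norm (\<integral>x. f x - g x \<partial>P) \<le> e"
        using f cg g(2) by (intro prob_on_norm_integral_le[OF P])
          (auto intro!: borel_measurable_continuous_onI continuous_on_diff less_imp_le)
      then show ?thesis using bounded_int[OF P f] bounded_int[OF P cg] by simp
    qed
    have "\<bar>integral\<^sup>L M f - integral\<^sup>L N f\<bar> \<le> 2 * e"
      using d[OF M] d[OF N] poly[OF g(1)] by linarith
    moreover have "\<bar>integral\<^sup>L M f - integral\<^sup>L N f\<bar> = 3 * e" by (simp add: e_def)
    ultimately show False using e by linarith
  qed
  have "char M t = char N t" for t
  proof (rule complex_eqI)
    have i: "integrable P (\<lambda>x. iexp (t * x))" if P: "prob_on {-1..1} P" for P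
      by (intro prob_on_integrable[OF P, where B=1]) auto
    have Re: "Re (char P t) = (\<integral>x. cos (t * x) \<partial>P)" and Im: "Im (char P t) = (\<integral>x. sin (t * x) \<partial>P)"
      if P: "prob_on {-1..1} P" for P
    proof -
      show "Re (char P t) = (\<integral>x. cos (t * x) \<partial>P)"
        unfolding char_def by (subst integral_Re[OF i[OF P], symmetric]) (simp add: Re_exp)
      show "Im (char P t) = (\<integral>x. sin (t * x) \<partial>P)"
        unfolding char_def by (subst integral_Im[OF i[OF P], symmetric]) (simp add: Im_exp)
    qed
    show "Re (char M t) = Re (char N t)" unfolding Re[OF M] Re[OF N] by (intro cont continuous_intros)
    show "Im (char M t) = Im (char N t)" unfolding Im[OF M] Im[OF N] by (intro cont continuous_intros)
  qed
  then show ?thesis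
    using prob_on_real_distribution[OF M] prob_on_real_distribution[OF N] by (intro Levy_uniqueness) auto
qed

section \<open>The energy minimiser\<close>

lemma energy_le_iff:
  assumes "prob_on {-1..1} M" "prob_on {-1..1} N" "0 \<le> E"
  shows "energy M N \<le> ennreal E \<longleftrightarrow> (\<forall>n. reg_energy n M N \<le> E)"
  unfolding energy_SUP(1)[OF assms(1,2)] SUP_le_iff using assms(3) by (auto simp: ennreal_le_iff)

lemma reg_energy_mono:
  assumes "prob_on {-1..1} M" "prob_on {-1..1} N" "m \<le> n"
  shows "reg_energy m M N \<le> reg_energy n M N"
  using incseqD[OF energy_SUP(2)[OF assms(1,2)] assms(3)] energy_SUP(3)[OF assms(1,2)]
  by (simp add: ennreal_le_iff)

lemma reg_energy_le_energy:
  assumes "prob_on {-1..1} M" "prob_on {-1..1} N"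
  shows "ennreal (reg_energy n M N) \<le> energy M N"
  unfolding energy_SUP(1)[OF assms] by (rule SUP_upper) simp

lemma reg_potential_le_potential:
  assumes "prob_on {-1..1} M" "x \<in> {-1..1}"
  shows "ennreal (reg_potential n M x) \<le> potential M x"
  unfolding potential_SUP(1)[OF assms] by (rule SUP_upper) simp

text \<open>Measure and radius vary together here. Fatou with radii tending to 1 bounds the
  unregularised series of the limit, which in turn dominates every regularised one.\<close>

lemma energy_limit_le:
  assumes \<mu>: "\<And>n. prob_on {-1..1} (\<mu> n)" and M: "prob_on {-1..1} M" and s: "strict_mono (s :: nat \<Rightarrow> nat)"
    and c: "\<And>k. (\<lambda>j. cheb_moment (\<mu> (s j)) k) \<longlonglongrightarrow> cheb_moment M k"
    and H: "\<And>n. reg_energy n (\<mu> n) (\<mu> n) \<le> H"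
  shows "energy M M \<le> ennreal H"
proof -
  have H0: "0 \<le> H" using energy_SUP(3)[OF \<mu>[of 0] \<mu>[of 0], of 0] H[of 0] by linarith
  have lim: "(\<lambda>j. rad (s j)) \<longlonglongrightarrow> 1"
    using LIMSEQ_subseq_LIMSEQ[OF rad_LIMSEQ s] by (simp add: o_def)
  have limln: "(\<lambda>j. ln (rad (s j))) \<longlonglongrightarrow> 0"
    using LIMSEQ_subseq_LIMSEQ[OF ln_rad_LIMSEQ s] by (simp add: o_def)
  have *: "summable (\<lambda>k. (cheb_moment M k * cheb_moment M k) / real k)"
    "(\<Sum>k. (cheb_moment M k * cheb_moment M k) / real k) \<le> (H - 4 - 0) / 2"
  proof -
    let ?f = "\<lambda>j k. rad (s j) ^ k * (cheb_moment (\<mu> (s j)) k * cheb_moment (\<mu> (s j)) k) / real k"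
    have 1: "0 \<le> ?f j k" for j k using rad_bounds[of "s j"] by simp
    have 2: "summable (?f j)" for j by (rule reg_series_summable[OF \<mu> \<mu>]) auto
    have "(\<lambda>j. ?f j k) \<longlonglongrightarrow> 1 ^ k * (cheb_moment M k * cheb_moment M k) / real k" for k
      unfolding divide_inverse by (intro tendsto_mult tendsto_const c tendsto_power lim)
    then have 3: "(\<lambda>j. ?f j k) \<longlonglongrightarrow> (cheb_moment M k * cheb_moment M k) / real k" for k by simp
    have 4: "suminf (?f j) \<le> (H - 4 - ln (rad (s j))) / 2" for j
      using H[of "s j"] unfolding reg_energy_def by simp
    have 5: "(\<lambda>j. (H - 4 - ln (rad (s j))) / 2) \<longlonglongrightarrow> (H - 4 - 0) / 2"
      by (intro tendsto_divide tendsto_diff tendsto_const limln) simp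
    show "summable (\<lambda>k. (cheb_moment M k * cheb_moment M k) / real k)"
      "(\<Sum>k. (cheb_moment M k * cheb_moment M k) / real k) \<le> (H - 4 - 0) / 2"
      using suminf_le_lim[OF 1 2 3 4 5] by auto
  qed
  have "reg_energy n M M \<le> H" for n
  proof -
    have "(\<Sum>k. rad n ^ k * (cheb_moment M k * cheb_moment M k) / real k) \<le>
       (\<Sum>k. (cheb_moment M k * cheb_moment M k) / real k)"
    proof (rule suminf_le)
      fix k
      have "rad n ^ k * (cheb_moment M k * cheb_moment M k) \<le> 1 * (cheb_moment M k * cheb_moment M k)"
        using rad_bounds[of n] by (intro mult_right_mono power_le_one) auto
      then show "rad n ^ k * (cheb_moment M k * cheb_moment M k) / real k \<le> cheb_moment M k * cheb_moment M k / real k"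
        by (simp add: divide_right_mono)
      show "summable (\<lambda>k. rad n ^ k * (cheb_moment M k * cheb_moment M k) / real k)"
        by (rule reg_series_summable[OF M M]) auto
    qed (rule *)
    moreover have "ln (rad n) \<le> 0" using rad_bounds[of n] by simp
    ultimately show ?thesis using *(2) unfolding reg_energy_def by simp
  qed
  then show ?thesis using energy_le_iff[OF M M H0] by simp
qed

text \<open>Parallelogram law: the energy of the midpoint falls below the common minimum by a
  quarter of the quadratic form of the difference, a sum of weighted squares with a positive term
  for every differing moment.\<close>

lemma energy_minimizer_unique:
  assumes K: "closed K" "K \<subseteq> {-1..1}" and M: "prob_on K M" and N: "prob_on K N"
    and E: "energy M M = ennreal E" "energy N N = ennreal E" "0 \<le> E"
    and min: "\<And>L. prob_on K L \<Longrightarrow> ennreal E \<le> energy L L"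
  shows "M = N"
proof -
  have up: "prob_on {-1..1} P" if "prob_on K P" for P using prob_on_mono[OF that K(2,1)] by simp
  from prob_on_mixture[OF M N K(1), of "1/2"] obtain L where L: "prob_on K L"
    and Lc: "\<And>k. cheb_moment L k = (1 - 1/2) * cheb_moment M k + 1/2 * cheb_moment N k" by auto
  have "cheb_moment M k = cheb_moment N k" if k: "k > 0" for k
  proof (rule ccontr)
    assume ne: "cheb_moment M k \<noteq> cheb_moment N k"
    \<comment> \<open>One term of the form is 2 (difference)^2 / k up to the radius factor; a
      quarter of it is d.\<close>
    define d where "d = (cheb_moment M k - cheb_moment N k)\<^sup>2 / (2 * real k)"
    have d: "d > 0" using ne k by (simp add: d_def)
    have "reg_energy n L L \<le> E - rad n ^ k * d" for n
    proof -
      let ?u = "\<lambda>k. rad n ^ k * (cheb_moment M k * cheb_moment M k) / real k" 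
      let ?v = "\<lambda>k. rad n ^ k * (cheb_moment M k * cheb_moment N k) / real k"
      let ?w = "\<lambda>k. rad n ^ k * (cheb_moment N k * cheb_moment N k) / real k"
      let ?s = "\<lambda>k. rad n ^ k * (cheb_moment M k - cheb_moment N k)\<^sup>2 / real k"
      have s: "?s sums (suminf ?u - 2 * suminf ?v + suminf ?w)"
      proof -
        have "(\<lambda>k. ?u k - 2 * ?v k + ?w k) sums (suminf ?u - 2 * suminf ?v + suminf ?w)"
          by (intro sums_add sums_diff sums_mult summable_sums reg_series_summable[OF M M K(1) K(1)]
            reg_series_summable[OF M N K(1) K(1)] reg_series_summable[OF N N K(1) K(1)])
        moreover have "(\<lambda>k. ?u k - 2 * ?v k + ?w k) = ?s"
          by (rule ext) (simp add: power2_eq_square algebra_simps add_divide_distrib diff_divide_distrib)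
        ultimately show ?thesis by simp
      qed
      have "?s k \<le> suminf ?s"
        using sum_le_suminf[OF sums_summable[OF s], of "{k}"] rad_bounds[of n] by simp
      then have "2 * ?s k \<le> reg_energy n M M - 2 * reg_energy n M N + reg_energy n N N"
        using sums_unique[OF s] unfolding reg_energy_def by simp
      moreover have "reg_energy n M M \<le> E" "reg_energy n N N \<le> E"
        using energy_le_iff[OF up[OF M] up[OF M] E(3)] energy_le_iff[OF up[OF N] up[OF N] E(3)] E by auto
      moreover have "2 * ?s k = 4 * (rad n ^ k * d)" using k by (simp add: d_def field_simps)
      ultimately show ?thesis
        unfolding reg_energy_mixture[OF M N K(1) Lc] by (simp add: power2_eq_square)
    qed
    \<comment> \<open>The gain must be uniform in n to survive the supremum; \<open>rad n\<close> is
      at least 1/2 for all n.\<close>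
    moreover have "(1/2) ^ k * d \<le> rad n ^ k * d" for n
      using d rad_ge_half[of n] by (intro mult_right_mono power_mono) auto
    ultimately have *: "reg_energy n L L \<le> E - (1/2) ^ k * d" for n
      by (meson diff_left_mono order_trans)
    then have "0 \<le> E - (1/2) ^ k * d"
      using energy_SUP(3)[OF up[OF L] up[OF L], of 0] order_trans by blast
    then have "energy L L \<le> ennreal (E - (1/2) ^ k * d)"
      using energy_le_iff[OF up[OF L] up[OF L]] * by blast
    also have "\<dots> < ennreal E"
      using d \<open>0 \<le> E - (1/2) ^ k * d\<close> by (intro ennreal_lessI) (auto intro: less_le_trans[of 0 "(1/2) ^ k * d"])
    finally show False using min[OF L] by simp
  qed
  then show ?thesis by (intro cheb_moments_determine up M N)
qed

definition reg_min :: "real set \<Rightarrow> nat \<Rightarrow> real measure" where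
  "reg_min K n = (SOME M. prob_on K M \<and> (\<forall>N. prob_on K N \<longrightarrow> reg_energy n M M \<le> reg_energy n N N))"

definition reg_val :: "real set \<Rightarrow> nat \<Rightarrow> real" where
  "reg_val K n = reg_energy n (reg_min K n) (reg_min K n)"

lemma prob_on_sub_interval: "prob_on K M \<Longrightarrow> compact K \<Longrightarrow> K \<subseteq> {-1..1} \<Longrightarrow> prob_on {-1..1::real} M"
  by (rule prob_on_mono) (auto simp: compact_imp_closed)

context
  fixes K :: "real set"
  assumes K: "compact K" "K \<noteq> {}" "K \<subseteq> {-1..1}"
begin

lemma reg_min:
  shows "prob_on K (reg_min K n)"
    and "prob_on K N \<Longrightarrow> reg_val K n \<le> reg_energy n N N"
proof -
  obtain M where "prob_on K M" "\<And>N. prob_on K N \<Longrightarrow> reg_energy n M M \<le> reg_energy n N N"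
    using reg_energy_minimizer[OF K, where n=n] by blast
  then have "\<exists>M. prob_on K M \<and> (\<forall>N. prob_on K N \<longrightarrow> reg_energy n M M \<le> reg_energy n N N)" by blast
  from someI_ex[OF this, folded reg_min_def]
  show "prob_on K (reg_min K n)" "prob_on K N \<Longrightarrow> reg_val K n \<le> reg_energy n N N"
    by (auto simp: reg_val_def)
qed

lemma reg_min_interval: "prob_on {-1..1} (reg_min K n)"
  by (rule prob_on_sub_interval[OF reg_min(1) K(1,3)])

lemma reg_val_nonneg: "0 \<le> reg_val K n"
  unfolding reg_val_def by (intro energy_SUP reg_min_interval)

text \<open>The regularised kernels increase to the true one, so the bound for the regularised
  potential carries over to the true potential of the same measure.\<close>

lemma reg_val_le_potential:
  assumes "x \<in> K" shows "ennreal (reg_val K n) \<le> potential (reg_min K n) x"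
proof -
  have "reg_val K n \<le> reg_potential n (reg_min K n) x"
    using reg_minimizer_potential_ge[OF K(1,3) reg_min(1) reg_min(2)[unfolded reg_val_def] assms]
    by (simp add: reg_val_def)
  then have "ennreal (reg_val K n) \<le> ennreal (reg_potential n (reg_min K n) x)" by (rule ennreal_leI)
  also have "\<dots> \<le> potential (reg_min K n) x"
    using assms K(3) by (intro reg_potential_le_potential reg_min_interval) auto
  finally show ?thesis .
qed

lemma reg_val_mono: "m \<le> n \<Longrightarrow> reg_val K m \<le> reg_val K n"
proof -
  assume "m \<le> n"
  have "reg_val K m \<le> reg_energy m (reg_min K n) (reg_min K n)" by (rule reg_min(2)[OF reg_min(1)])
  also have "\<dots> \<le> reg_val K n" unfolding reg_val_def by (intro reg_energy_mono reg_min_interval \<open>m \<le> n\<close>)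
  finally show ?thesis .
qed

lemma reg_val_le_energy: "prob_on K N \<Longrightarrow> ennreal (reg_val K n) \<le> energy N N"
  by (rule order_trans[OF ennreal_leI[OF reg_min(2)] reg_energy_le_energy])
     (auto intro: prob_on_sub_interval[OF _ K(1,3)])

text \<open>The bound B is positivity of the capacity in disguise; it is supplied later by
  solvability of the Dirichlet problem.\<close>

lemma energy_minimizer_exists:
  assumes B: "\<And>n. reg_val K n \<le> B"
  obtains s M H where "strict_mono (s :: nat \<Rightarrow> nat)" "prob_on K M" "weak_lim (\<lambda>j. reg_min K (s j)) M"
    "0 \<le> H" "reg_val K \<longlonglongrightarrow> H" "\<And>n. reg_val K n \<le> H" "energy M M = ennreal H"
    "\<And>N. prob_on K N \<Longrightarrow> ennreal H \<le> energy N N"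
proof -
  obtain H where H: "reg_val K \<longlonglongrightarrow> H" "\<And>n. reg_val K n \<le> H"
    using incseq_convergent[of "reg_val K" B] reg_val_mono B by (auto simp: incseq_def)
  have H0: "0 \<le> H" using reg_val_nonneg[of 0] H(2)[of 0] by linarith
  obtain s M where s: "strict_mono (s :: nat \<Rightarrow> nat)" and M: "prob_on K M"
    and lim: "weak_lim (\<lambda>j. reg_min K (s j)) M"
    using prob_on_compactness[OF K(1), of "reg_min K", OF reg_min(1)] by blast
  have le: "energy M M \<le> ennreal H"
    by (rule energy_limit_le[OF reg_min_interval prob_on_sub_interval[OF M K(1,3)] s weak_lim_cheb[OF lim]])
       (use H(2) in \<open>simp add: reg_val_def\<close>)
  have ge: "ennreal H \<le> energy N N" if "prob_on K N" for N
  proof (rule LIMSEQ_le_const2)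
    show "(\<lambda>n. ennreal (reg_val K n)) \<longlonglongrightarrow> ennreal H" by (intro tendsto_ennrealI H)
  qed (use reg_val_le_energy[OF that] in blast)
  show thesis by (rule that[OF s M lim H0 H antisym[OF le ge[OF M]] ge])
qed

end

section \<open>Comparison with the extended-real energy and the capacity\<close>

lemma ennreal_add_cong:
  "0 \<le> a \<Longrightarrow> 0 \<le> b \<Longrightarrow> 0 \<le> c \<Longrightarrow> 0 \<le> d \<Longrightarrow> a + b = c + d \<Longrightarrow>
    ennreal a + ennreal b = ennreal c + ennreal d"
  by (simp flip: ennreal_plus)

text \<open>This is kernel = 4 - ln 2 + positive part - negative part, rearranged so that no
  subtraction of extended nonnegative reals occurs; on the diagonal both sides are infinite.\<close>

lemma log_kernel_add:
  assumes "x \<in> {-1..1}" "y \<in> {-1..1}"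
  shows "log_kernel_pos x y + ennreal (4 - ln 2) = kernel x y + log_kernel_neg x y"
proof (cases "x = y")
  case False
  have l2: "ln (2::real) \<le> 1" using ln_le_minus_one[of 2] by simp
  have "ln (2 * \<bar>x - y\<bar>) = ln 2 + ln \<bar>x - y\<bar>" using False by (simp add: ln_mult)
  then have "max 0 (- ln \<bar>x - y\<bar>) + (4 - ln 2) = (4 - ln (2 * \<bar>x - y\<bar>)) + max 0 (ln \<bar>x - y\<bar>)" by simp
  then have "ennreal (max 0 (- ln \<bar>x - y\<bar>)) + ennreal (4 - ln 2)
      = ennreal (4 - ln (2 * \<bar>x - y\<bar>)) + ennreal (max 0 (ln \<bar>x - y\<bar>))"
    using kernel_nonneg[OF assms] l2 by (intro ennreal_add_cong) auto
  then show ?thesis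
    using False by (simp only: log_kernel_pos_def kernel_def log_kernel_neg_def if_False)
qed (simp add: log_kernel_pos_def kernel_def log_kernel_neg_def)

text \<open>The negative part is finite: on [-1,1] one has ln|x-y| <= |x-y| - 1 <= 1. Hence it
  cancels after integration of the previous identity, even if the energy is infinite.\<close>

lemma log_energy_eq:
  assumes M: "prob_on {-1..1} M"
  shows "log_energy M = enn2ereal (energy M M) - ereal (4 - ln 2)"
proof -
  interpret prob_space M using M by (rule prob_on_prob_space)
  note [measurable_cong] = prob_on_sets[OF M]
  have AE: "AE x in M. x \<in> {-1..1}" using M by (rule prob_on_AE) simp
  have l2: "ln (2::real) \<le> 1" using ln_le_minus_one[of 2] by simp
  have [measurable]: "(\<lambda>(x, y). log_kernel_pos x y) \<in> borel_measurable (borel \<Otimes>\<^sub>M borel)"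
    "(\<lambda>(x, y). log_kernel_neg x y) \<in> borel_measurable (borel \<Otimes>\<^sub>M borel)"
    unfolding log_kernel_pos_def log_kernel_neg_def by measurable
  let ?P = "\<integral>\<^sup>+ x. \<integral>\<^sup>+ y. log_kernel_pos x y \<partial>M \<partial>M" and ?N = "\<integral>\<^sup>+ x. \<integral>\<^sup>+ y. log_kernel_neg x y \<partial>M \<partial>M"
  have "?P + ennreal (4 - ln 2) = (\<integral>\<^sup>+ x. (\<integral>\<^sup>+ y. log_kernel_pos x y \<partial>M) + ennreal (4 - ln 2) \<partial>M)"
    by (subst nn_integral_add) (auto simp: emeasure_space_1)
  also have "\<dots> = (\<integral>\<^sup>+ x. \<integral>\<^sup>+ y. log_kernel_pos x y + ennreal (4 - ln 2) \<partial>M \<partial>M)"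
    by (intro nn_integral_cong, subst nn_integral_add) (auto simp: emeasure_space_1)
  also have "\<dots> = (\<integral>\<^sup>+ x. \<integral>\<^sup>+ y. kernel x y + log_kernel_neg x y \<partial>M \<partial>M)"
  proof (rule nn_integral_cong_AE)
    show "AE x in M. (\<integral>\<^sup>+ y. log_kernel_pos x y + ennreal (4 - ln 2) \<partial>M) = (\<integral>\<^sup>+ y. kernel x y + log_kernel_neg x y \<partial>M)"
      using AE
    proof eventually_elim
      fix x :: real assume x: "x \<in> {-1..1}"
      show "(\<integral>\<^sup>+ y. log_kernel_pos x y + ennreal (4 - ln 2) \<partial>M) = (\<integral>\<^sup>+ y. kernel x y + log_kernel_neg x y \<partial>M)"
        by (rule nn_integral_cong_AE, use AE in eventually_elim, rule log_kernel_add[OF x])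
    qed
  qed
  also have "\<dots> = (\<integral>\<^sup>+ x. (\<integral>\<^sup>+ y. kernel x y \<partial>M) + (\<integral>\<^sup>+ y. log_kernel_neg x y \<partial>M) \<partial>M)"
    by (intro nn_integral_cong nn_integral_add) measurable
  also have "\<dots> = energy M M + ?N"
    unfolding energy_def potential_def by (intro nn_integral_add) measurable
  finally have eq: "?P + ennreal (4 - ln 2) = energy M M + ?N" .
  have "?N \<le> (\<integral>\<^sup>+ x. \<integral>\<^sup>+ y. 1 \<partial>M \<partial>M)"
  proof (rule nn_integral_mono_AE)
    show "AE x in M. (\<integral>\<^sup>+ y. log_kernel_neg x y \<partial>M) \<le> (\<integral>\<^sup>+ y. 1 \<partial>M)"
      using AE
    proof eventually_elim
      fix x :: real assume x: "x \<in> {-1..1}"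
      show "(\<integral>\<^sup>+ y. log_kernel_neg x y \<partial>M) \<le> (\<integral>\<^sup>+ y. 1 \<partial>M)"
      proof (rule nn_integral_mono_AE, use AE in eventually_elim)
        fix y :: real assume y: "y \<in> {-1..1}"
        have "ln \<bar>x - y\<bar> \<le> 1" if "x \<noteq> y"
          using ln_le_minus_one[of "\<bar>x - y\<bar>"] that x y by auto
        then show "log_kernel_neg x y \<le> 1" by (auto simp: log_kernel_neg_def ennreal_le_1)
      qed
    qed
  qed
  then have "?N \<le> 1" by (simp add: emeasure_space_1)
  then have "?N < \<infinity>" by (rule order.strict_trans1) simp
  then obtain c where c: "?N = ennreal c" "0 \<le> c" by (cases ?N) auto
  have "enn2ereal ?P + ereal (4 - ln 2) = enn2ereal (energy M M) + enn2ereal ?N"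
    using arg_cong[OF eq, of enn2ereal] l2 by (simp add: plus_ennreal.rep_eq enn2ereal_ennreal)
  then show ?thesis
    unfolding log_energy_def c using c(2)
    by (cases "enn2ereal ?P"; cases "enn2ereal (energy M M)") (auto simp: enn2ereal_ennreal)
qed

lemma equilibrium_facts:
  assumes K: "compact K" "K \<subseteq> {-1..1}" and M: "prob_on K M" and H: "energy M M = ennreal H" "0 \<le> H"
    and min: "\<And>N. prob_on K N \<Longrightarrow> ennreal H \<le> energy N N"
  shows "equilibrium_measure K = M" "log_capacity K = exp (4 - ln 2 - H)"
proof -
  have le: "log_energy N = enn2ereal (energy N N) - ereal (4 - ln 2)" if "prob_on K N" for N
    by (rule log_energy_eq[OF prob_on_sub_interval[OF that K]])
  have LM: "log_energy M = ereal (H - (4 - ln 2))"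
    using le[OF M] H by (simp add: enn2ereal_ennreal)
  have ge: "ereal (H - (4 - ln 2)) \<le> log_energy N" if "prob_on K N" for N
  proof -
    have "ereal H \<le> enn2ereal (energy N N)"
      using min[OF that] H(2) by (simp add: less_eq_ennreal.rep_eq enn2ereal_ennreal)
    then show ?thesis unfolding le[OF that] by (cases "enn2ereal (energy N N)") auto
  qed
  have me: "min_energy K = ereal (H - (4 - ln 2))"
    unfolding min_energy_def using M LM ge by (intro antisym INF_greatest INF_lower2[of M]) auto
  then show "log_capacity K = exp (4 - ln 2 - H)" by (simp add: log_capacity_def)
  show "equilibrium_measure K = M" unfolding equilibrium_measure_def
  proof (rule the_equality)
    show "prob_on K M \<and> log_energy M = min_energy K" using M LM me by simp
    fix N assume N: "prob_on K N \<and> log_energy N = min_energy K"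
    then have "enn2ereal (energy N N) - ereal (4 - ln 2) = ereal (H - (4 - ln 2))" using le[of N] me by simp
    then have "enn2ereal (energy N N) = ereal H" by (cases "enn2ereal (energy N N)") auto
    then have "energy N N = ennreal H" using H(2) by (metis e2ennreal_enn2ereal e2ennreal_ereal)
    then show "N = M" using N M H min K by (intro energy_minimizer_unique[of K N M H]) (auto simp: compact_imp_closed)
  qed
qed

section \<open>Harmonic functions and logarithmic potentials\<close>

abbreviation cset :: "real set \<Rightarrow> complex set" where
  "cset K \<equiv> complex_of_real ` K"

definition logpot :: "real measure \<Rightarrow> complex \<Rightarrow> real" where
  "logpot M z = (\<integral>t. ln (cmod (z - of_real t)) \<partial>M)"

lemma harmonic_on_subset:
  assumes "harmonic_on u U" "open V" "V \<subseteq> U" shows "harmonic_on u V"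
  unfolding harmonic_on_def
proof
  fix z assume z: "z \<in> V"
  then obtain r g where r: "r > 0" and g: "g holomorphic_on ball z r" "\<forall>w\<in>ball z r. u w = Re (g w)"
    using assms unfolding harmonic_on_def by blast
  obtain e where e: "e > 0" "ball z e \<subseteq> V" using assms(2) z openE by blast
  have sub: "ball z (min r e) \<subseteq> ball z r" "ball z (min r e) \<subseteq> V" using e by auto
  show "\<exists>r>0. ball z r \<subseteq> V \<and> (\<exists>g. g holomorphic_on ball z r \<and> (\<forall>w\<in>ball z r. u w = Re (g w)))"
    by (intro exI[of _ "min r e"] conjI exI[of _ g]) (use r e g sub in \<open>auto intro: holomorphic_on_subset\<close>)
qed

lemma harmonic_on_lincomb:
  assumes "harmonic_on u U" "harmonic_on v U"
  shows "harmonic_on (\<lambda>z. a * u z + b * v z + c) U"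
  unfolding harmonic_on_def
proof
  fix z assume z: "z \<in> U"
  obtain r g where r: "r > 0" "ball z r \<subseteq> U" and g: "g holomorphic_on ball z r" "\<forall>w\<in>ball z r. u w = Re (g w)"
    using assms(1) z unfolding harmonic_on_def by blast
  obtain s h where s: "s > 0" "ball z s \<subseteq> U" and h: "h holomorphic_on ball z s" "\<forall>w\<in>ball z s. v w = Re (h w)"
    using assms(2) z unfolding harmonic_on_def by blast
  have sub: "ball z (min r s) \<subseteq> ball z r" "ball z (min r s) \<subseteq> ball z s" by auto
  have "(\<lambda>w. of_real a * g w + of_real b * h w + of_real c) holomorphic_on ball z (min r s)"
    by (intro holomorphic_intros holomorphic_on_subset[OF g(1) sub(1)] holomorphic_on_subset[OF h(1) sub(2)])
  moreover have "\<forall>w\<in>ball z (min r s). a * u w + b * v w + c = Re (of_real a * g w + of_real b * h w + of_real c)"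
    using g(2) h(2) by auto
  ultimately show "\<exists>r>0. ball z r \<subseteq> U \<and> (\<exists>g. g holomorphic_on ball z r \<and> (\<forall>w\<in>ball z r. a * u w + b * v w + c = Re (g w)))"
    using r s by (intro exI[of _ "min r s"]) auto
qed

lemma harmonic_on_continuous:
  assumes "harmonic_on u U" shows "continuous_on U u"
proof (rule continuous_at_imp_continuous_on, rule ballI)
  fix z assume "z \<in> U"
  then obtain r g where r: "r > 0" and g: "g holomorphic_on ball z r" "\<forall>w\<in>ball z r. u w = Re (g w)"
    using assms unfolding harmonic_on_def by blast
  have "continuous_on (ball z r) (\<lambda>w. Re (g w))"
    by (intro continuous_intros holomorphic_on_imp_continuous_on g)
  then have "continuous_on (ball z r) u" using g(2) by (subst continuous_on_cong) auto
  then show "isCont u z" using r by (simp add: continuous_on_eq_continuous_at)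
qed

text \<open>Open mapping theorem: if g were not constant, its image would contain g z + e/2, a value
  with larger real part.\<close>

lemma harmonic_local_max:
  assumes "harmonic_on u U" "z \<in> U" "\<And>w. w \<in> U \<Longrightarrow> u w \<le> u z"
  shows "\<exists>r>0. ball z r \<subseteq> U \<and> (\<forall>w\<in>ball z r. u w = u z)"
proof -
  obtain r g where r: "r > 0" "ball z r \<subseteq> U" and g: "g holomorphic_on ball z r" "\<forall>w\<in>ball z r. u w = Re (g w)"
    using assms(1,2) unfolding harmonic_on_def by blast
  have "g constant_on ball z r"
  proof (rule ccontr)
    assume nc: "\<not> g constant_on ball z r"
    have "open (g ` ball z r)"
      using nc by (intro open_mapping_thm[OF g(1) open_ball connected_ball open_ball]) auto
    moreover have "g z \<in> g ` ball z r" using r(1) by simp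
    ultimately obtain e where e: "e > 0" "ball (g z) e \<subseteq> g ` ball z r"
      by (rule openE)
    have "g z + of_real (e/2) \<in> ball (g z) e" using e by (simp add: dist_norm)
    with e(2) have "g z + of_real (e/2) \<in> g ` ball z r" by (rule subsetD)
    then obtain w where w: "w \<in> ball z r" "g w = g z + of_real (e/2)" by (elim imageE) simp
    have "u w = Re (g w)" "u z = Re (g z)" using g(2) w(1) r(1) by auto
    then have "u w = u z + e / 2" using w(2) by simp
    then show False using assms(3)[OF subsetD[OF r(2) w(1)]] e by linarith
  qed
  then obtain c where c: "\<And>w. w \<in> ball z r \<Longrightarrow> g w = c" unfolding constant_on_def by blast
  have "u w = u z" if "w \<in> ball z r" for w
    using that g(2) r(1) c[OF that] c[of z] by simp
  then show ?thesis using r by blast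
qed

text \<open>The boundary hypothesis is an upper limit, because potentials will have no continuous
  boundary values on K. A positive value of v makes a superlevel set compact; the set where the
  maximum is attained is then open, closed, bounded and nonempty.\<close>

lemma harmonic_max_principle:
  assumes D: "open D" "bounded D" and v: "harmonic_on v D"
    and bd: "\<And>x e. x \<in> frontier D \<Longrightarrow> e > 0 \<Longrightarrow> \<exists>d>0. \<forall>z\<in>D. dist z x < d \<longrightarrow> v z < e"
    and z0: "z0 \<in> D"
  shows "v z0 \<le> 0"
proof (rule ccontr)
  assume "\<not> v z0 \<le> 0"
  then have pos: "0 < v z0" by simp
  have cont: "continuous_on D v" by (rule harmonic_on_continuous[OF v])
  have lev: "compact {z \<in> D. c \<le> v z}" if c: "0 < c" for c
  proof -
    have "closed {z \<in> D. c \<le> v z}" unfolding closed_sequential_limits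
    proof (intro allI impI, elim conjE)
      fix f l assume f: "\<forall>n. f n \<in> {z \<in> D. c \<le> v z}" and l: "f \<longlonglongrightarrow> l"
      have "l \<in> closure D" using f l by (auto simp: closure_sequential)
      moreover have "l \<notin> frontier D"
      proof
        assume "l \<in> frontier D"
        from bd[OF this c] obtain d where d: "d > 0" "\<forall>z\<in>D. dist z l < d \<longrightarrow> v z < c" by blast
        obtain n where "dist (f n) l < d" using l d(1) unfolding lim_sequentially by blast
        moreover have "f n \<in> D" "c \<le> v (f n)" using f by auto
        ultimately show False using d(2) by force
      qed
      ultimately have lD: "l \<in> D" using D(1) by (simp add: frontier_def interior_open)
      have "(\<lambda>n. v (f n)) \<longlonglongrightarrow> v l"
        using continuous_on_tendsto_compose[OF cont l lD] f by auto
      then have "c \<le> v l" using f by (intro LIMSEQ_le_const) auto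
      then show "l \<in> {z \<in> D. c \<le> v z}" using lD by simp
    qed
    moreover have "bounded {z \<in> D. c \<le> v z}" using D(2) by (rule bounded_subset) auto
    ultimately show ?thesis by (simp add: compact_eq_bounded_closed)
  qed
  have "continuous_on {z \<in> D. v z0 \<le> v z} v" using cont by (rule continuous_on_subset) auto
  then obtain z1 where z1: "z1 \<in> D" "v z0 \<le> v z1" "\<And>z. z \<in> D \<Longrightarrow> v z0 \<le> v z \<Longrightarrow> v z \<le> v z1"
    using continuous_attains_sup[OF lev[OF pos], of v] z0 by auto
  have max: "v z \<le> v z1" if "z \<in> D" for z
    using z1(2) z1(3)[OF that] by linarith
  let ?B = "{z \<in> D. v z1 \<le> v z}"
  have "closed ?B" "bounded ?B" using lev[of "v z1"] pos z1(2) by (auto simp: compact_eq_bounded_closed)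
  moreover have "open ?B" unfolding open_contains_ball
  proof
    fix z assume z: "z \<in> ?B"
    then have zD: "z \<in> D" and vz: "v z1 \<le> v z" by auto
    have "v w \<le> v z" if "w \<in> D" for w using max[OF that] vz by linarith
    from harmonic_local_max[OF v zD this]
    obtain r where r: "r > 0" "ball z r \<subseteq> D" "\<And>w. w \<in> ball z r \<Longrightarrow> v w = v z" by blast
    have "ball z r \<subseteq> ?B" using r(2,3) vz by auto
    then show "\<exists>e>0. ball z e \<subseteq> ?B" using r(1) by blast
  qed
  moreover have "?B \<noteq> {}" using z1(1) by blast
  ultimately have "?B = UNIV" using clopen[of ?B] by blast
  then show False using \<open>bounded ?B\<close> not_bounded_UNIV[where 'a=complex] by auto
qed

lemma cset_dist:
  assumes "closed K" "z \<notin> cset K"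
  obtains d where "d > 0" "\<And>t. t \<in> K \<Longrightarrow> d \<le> cmod (z - of_real t)"
proof -
  have "closed (cset K)"
    using assms(1) by (intro closed_injective_linear_image) (auto simp: linear_conv_bounded_linear bounded_linear_of_real inj_on_def)
  from separate_point_closed[OF this assms(2)] obtain d where "d > 0" "\<forall>x\<in>cset K. d \<le> dist z x" by blast
  then show thesis by (intro that[of d]) (auto simp: dist_norm)
qed

lemma borel_ln_cmod [measurable]: "(\<lambda>t. ln (cmod (z - of_real t))) \<in> borel_measurable borel"
  by measurable

lemma logpot_bounds:
  assumes M: "prob_on K M" and K: "closed K" "K \<subseteq> {-1..1}"
    and d: "d > 0" "\<And>t. t \<in> K \<Longrightarrow> d \<le> cmod (z - of_real t)"
  shows "integrable M (\<lambda>t. ln (cmod (z - of_real t)))" "ln d \<le> logpot M z" "logpot M z \<le> ln (cmod z + 1)"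
proof -
  have up: "cmod (z - of_real t) \<le> cmod z + 1" if "t \<in> K" for t
  proof -
    have "\<bar>t\<bar> \<le> 1" using subsetD[OF K(2) that] by auto
    then show ?thesis using norm_triangle_ineq4[of z "of_real t"] by simp
  qed
  have b: "ln d \<le> ln (cmod (z - of_real t))" "ln (cmod (z - of_real t)) \<le> ln (cmod z + 1)" if "t \<in> K" for t
    using d(1) d(2)[OF that] up[OF that] by (auto intro!: ln_mono)
  show int: "integrable M (\<lambda>t. ln (cmod (z - of_real t)))"
  proof (rule prob_on_integrable[OF M K(1)])
    show "norm (ln (cmod (z - of_real t))) \<le> \<bar>ln d\<bar> + \<bar>ln (cmod z + 1)\<bar>" if "t \<in> K" for t
      using b[OF that] unfolding real_norm_def by linarith
  qed measurable
  interpret prob_space M using M by (rule prob_on_prob_space)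
  have "(\<integral>t. ln d \<partial>M) \<le> logpot M z" unfolding logpot_def
    by (rule integral_mono_AE[OF _ int]) (use prob_on_AE[OF M K(1)] b in \<open>auto elim: eventually_mono\<close>)
  then show "ln d \<le> logpot M z" by (simp add: prob_space)
  have "logpot M z \<le> (\<integral>t. ln (cmod z + 1) \<partial>M)" unfolding logpot_def
    by (rule integral_mono_AE[OF int]) (use prob_on_AE[OF M K(1)] b in \<open>auto elim: eventually_mono\<close>)
  then show "logpot M z \<le> ln (cmod z + 1)" by (simp add: prob_space)
qed

text \<open>U(w) - U(z) is the real part of the integral of Ln(1 - (w-z)/(t-z)). On the disc whose
  radius d bounds the distance to K from below, the logarithmic series may be integrated termwise
  and becomes a power series in w - z.\<close>

lemma logpot_harmonic:
  assumes M: "prob_on K M" and K: "closed K" "K \<subseteq> {-1..1}"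
  shows "harmonic_on (logpot M) (- cset K)"
  unfolding harmonic_on_def
proof
  fix z assume z: "z \<in> - cset K"
  then obtain d where d: "d > 0" "\<And>t. t \<in> K \<Longrightarrow> d \<le> cmod (z - of_real t)"
    using cset_dist[OF K(1)] by blast
  have sub: "ball z d \<subseteq> - cset K"
  proof
    fix w assume "w \<in> ball z d"
    then have "cmod (z - w) < d" by (simp add: dist_norm)
    then show "w \<in> - cset K" using d(2) by fastforce
  qed
  define g where "g w = (\<integral>t. Ln (1 - (w - z) / (of_real t - z)) \<partial>M)" for w
  define a where "a k = (\<integral>t. - (inverse (of_real t - z) ^ k) / of_nat k \<partial>M)" for k
  have small: "cmod ((w - z) / (of_real t - z)) \<le> cmod (w - z) / d" if "t \<in> K" for w t
    using d(1) d(2)[OF that] 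
    by (simp add: norm_divide norm_minus_commute[of "of_real t"]) (intro divide_left_mono mult_pos_pos, auto)
  have sums: "(\<lambda>k. a k * (w - z) ^ k) sums g w" and int: "integrable M (\<lambda>t. Ln (1 - (w - z) / (of_real t - z)))"
    if w: "w \<in> ball z d" for w
  proof -
    define q where "q = cmod (w - z) / d"
    have q: "0 \<le> q" "q < 1" using w d(1) by (auto simp: q_def dist_norm norm_minus_commute)
    let ?f = "\<lambda>k t. - (((w - z) / (of_real t - z)) ^ k) / of_nat k"
    have nf: "cmod (?f k t) \<le> q ^ k" if t: "t \<in> K" for k t
    proof -
      have "cmod (?f k t) \<le> cmod ((w - z) / (of_real t - z)) ^ k"
      proof (cases "k = 0")
        case False
        then have "cmod (((w - z) / (of_real t - z)) ^ k) / real k \<le> cmod (((w - z) / (of_real t - z)) ^ k) / 1"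
          by (intro divide_left_mono) auto
        then show ?thesis by (simp add: norm_divide norm_power)
      qed simp
      also have "\<dots> \<le> q ^ k" unfolding q_def using small[OF t] by (intro power_mono) auto
      finally show ?thesis .
    qed
    have i: "integrable M (?f k)" for k
      by (rule prob_on_integrable[OF M K(1) _ nf]) measurable
    have sq: "summable (\<lambda>k. q ^ k)" using q by (intro summable_geometric) auto
    have AE1: "AE t in M. summable (\<lambda>k. norm (?f k t))"
      using prob_on_AE[OF M K(1)]
      by eventually_elim (rule summable_comparison_test'[OF sq], simp only: real_norm_def abs_norm_cancel nf)
    have s1: "summable (\<lambda>k. \<integral>t. norm (?f k t) \<partial>M)"
    proof (rule summable_comparison_test'[OF sq])
      fix k :: nat
      show "norm (\<integral>t. norm (?f k t) \<partial>M) \<le> q ^ k"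
        by (rule prob_on_norm_integral_le[OF M K(1)]) (measurable, simp only: real_norm_def abs_norm_cancel nf)
    qed
    have Ln: "(\<Sum>k. ?f k t) = Ln (1 - (w - z) / (of_real t - z))" if t: "t \<in> K" for t
    proof -
      have "cmod (- ((w - z) / (of_real t - z))) < 1" using small[OF t, of w] q by (simp add: q_def)
      from Ln_series'[OF this] show ?thesis by (simp add: sums_iff)
    qed
    have meas: "(\<lambda>t. Ln (1 - (w - z) / (of_real t - z))) \<in> borel_measurable borel" by measurable
    have eqAE: "AE t in M. (\<Sum>k. ?f k t) = Ln (1 - (w - z) / (of_real t - z))"
      using prob_on_AE[OF M K(1)] by eventually_elim (rule Ln)
    have int1: "integrable M (\<lambda>t. \<Sum>k. ?f k t)" by (rule integrable_suminf[OF i AE1 s1])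
    show int2: "integrable M (\<lambda>t. Ln (1 - (w - z) / (of_real t - z)))"
      by (rule integrable_cong_AE_imp[OF int1 prob_on_measurable[OF M meas]], use eqAE in eventually_elim, simp only:)
    have "(\<lambda>k. \<integral>t. ?f k t \<partial>M) sums (\<integral>t. (\<Sum>k. ?f k t) \<partial>M)" by (rule sums_integral[OF i AE1 s1])
    also have "(\<integral>t. (\<Sum>k. ?f k t) \<partial>M) = g w" unfolding g_def
      by (rule integral_cong_AE[OF borel_measurable_integrable[OF int1] borel_measurable_integrable[OF int2] eqAE])
    also have "(\<lambda>k. \<integral>t. ?f k t \<partial>M) = (\<lambda>k. a k * (w - z) ^ k)"
    proof
      fix k
      have "?f k t = (- (inverse (of_real t - z) ^ k) / of_nat k) * (w - z) ^ k" for t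
        by (simp add: divide_inverse power_mult_distrib mult_ac)
      then have "(\<integral>t. ?f k t \<partial>M) = (\<integral>t. (- (inverse (of_real t - z) ^ k) / of_nat k) * (w - z) ^ k \<partial>M)"
        by (simp only:)
      also have "\<dots> = a k * (w - z) ^ k" unfolding a_def by (rule integral_mult_left_zero)
      finally show "(\<integral>t. ?f k t \<partial>M) = a k * (w - z) ^ k" .
    qed
    finally show "(\<lambda>k. a k * (w - z) ^ k) sums g w" .
  qed
  have hol: "g holomorphic_on ball z d" by (rule power_series_holomorphic) (rule sums)
  have Re: "logpot M w = Re (of_real (logpot M z) + g w)" if w: "w \<in> ball z d" for w
  proof -
    have wK: "w \<notin> cset K" using sub w by auto
    then obtain e where e: "e > 0" "\<And>t. t \<in> K \<Longrightarrow> e \<le> cmod (w - of_real t)" using cset_dist[OF K(1)] by blast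
    note iw = logpot_bounds(1)[OF M K e] and iz = logpot_bounds(1)[OF M K d]
    have "Re (g w) = (\<integral>t. Re (Ln (1 - (w - z) / (of_real t - z))) \<partial>M)"
      unfolding g_def by (rule integral_Re[OF int[OF w], symmetric])
    also have "\<dots> = (\<integral>t. ln (cmod (w - of_real t)) - ln (cmod (z - of_real t)) \<partial>M)"
    proof (rule integral_cong_AE)
      show "AE t in M. Re (Ln (1 - (w - z) / (of_real t - z))) = ln (cmod (w - of_real t)) - ln (cmod (z - of_real t))"
        using prob_on_AE[OF M K(1)]
      proof eventually_elim
        fix t assume t: "t \<in> K"
        have ne: "of_real t - z \<noteq> 0" "of_real t - w \<noteq> 0" using t z wK by auto
        have eq: "1 - (w - z) / (of_real t - z) = (of_real t - w) / (of_real t - z)"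
          using ne(1) by (simp add: field_simps)
        show "Re (Ln (1 - (w - z) / (of_real t - z))) = ln (cmod (w - of_real t)) - ln (cmod (z - of_real t))"
          unfolding eq using ne by (simp add: norm_divide ln_div norm_minus_commute)
      qed
    qed (rule prob_on_measurable[OF M], measurable)+
    also have "\<dots> = logpot M w - logpot M z" unfolding logpot_def using iw iz by simp
    finally show ?thesis by simp
  qed
  show "\<exists>r>0. ball z r \<subseteq> - cset K \<and> (\<exists>g. g holomorphic_on ball z r \<and> (\<forall>w\<in>ball z r. logpot M w = Re (g w)))"
  proof (intro exI[of _ d] conjI)
    show "\<exists>g. g holomorphic_on ball z d \<and> (\<forall>w\<in>ball z d. logpot M w = Re (g w))"
    proof (rule exI[of _ "\<lambda>w. of_real (logpot M z) + g w"], rule conjI)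
      show "(\<lambda>w. of_real (logpot M z) + g w) holomorphic_on ball z d" by (intro holomorphic_intros hol)
      show "\<forall>w\<in>ball z d. logpot M w = Re (of_real (logpot M z) + g w)" using Re by blast
    qed
  qed (rule d(1) sub)+
qed

section \<open>Truncated kernels and semicontinuity of potentials\<close>

lemma ln_lipschitz:
  fixes a b c :: real assumes "0 < c" "c \<le> a" "c \<le> b" shows "\<bar>ln a - ln b\<bar> \<le> \<bar>a - b\<bar> / c"
proof -
  have *: "ln p - ln q \<le> \<bar>p - q\<bar> / c" if "c \<le> p" "c \<le> q" for p q
  proof -
    have pq: "0 < p" "0 < q" using that assms(1) by auto
    have "ln p - ln q = ln (p / q)" using pq by (simp add: ln_div)
    also have "\<dots> \<le> p / q - 1" using pq by (intro ln_le_minus_one) auto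
    also have "\<dots> = (p - q) / q" using pq by (simp add: field_simps)
    also have "\<dots> \<le> \<bar>p - q\<bar> / q" using pq by (intro divide_right_mono) auto
    also have "\<dots> \<le> \<bar>p - q\<bar> / c" using pq that assms(1) by (intro divide_left_mono) auto
    finally show ?thesis .
  qed
  show ?thesis using *[OF assms(2,3)] *[OF assms(3,2)] by (simp add: abs_le_iff abs_minus_commute)
qed

text \<open>A second regularisation: \<open>reg_kernel\<close> lives on the square [-1,1]^2, whereas
  semicontinuity is to be tested at complex points near K. Cutting the distance off at 1/(m+1) makes
  the potential Lipschitz in z with constant m+1.\<close>

definition trunc_kernel :: "nat \<Rightarrow> complex \<Rightarrow> real \<Rightarrow> real" where
  "trunc_kernel m z t = 4 - ln (2 * max (cmod (z - of_real t)) (1 / real (Suc m)))"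

definition trunc_pot :: "nat \<Rightarrow> real measure \<Rightarrow> complex \<Rightarrow> real" where
  "trunc_pot m M z = (\<integral>t. trunc_kernel m z t \<partial>M)"

lemma borel_trunc_kernel [measurable]: "trunc_kernel m z \<in> borel_measurable borel"
  unfolding trunc_kernel_def by measurable

lemma integrable_trunc_kernel:
  assumes M: "prob_on K M" and K: "closed K" "K \<subseteq> {-1..1}"
  shows "integrable M (trunc_kernel m z)"
proof (rule prob_on_integrable[OF M K(1)])
  fix t assume t: "t \<in> K"
  have "\<bar>t\<bar> \<le> 1" using subsetD[OF K(2) t] by auto
  then have "cmod (z - of_real t) \<le> cmod z + 1" using norm_triangle_ineq4[of z "of_real t"] by simp
  moreover have "1 / real (Suc m) \<le> 1" by (simp add: field_simps)
  ultimately have "max (cmod (z - of_real t)) (1 / real (Suc m)) \<le> cmod z + 1"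
    using norm_ge_zero[of z] by (smt (verit))
  then have "ln (2 * max (cmod (z - of_real t)) (1 / real (Suc m))) \<le> ln (2 * (cmod z + 1))"
    by (intro ln_mono) (auto simp: less_max_iff_disj)
  moreover have "ln (2 * (1 / real (Suc m))) \<le> ln (2 * max (cmod (z - of_real t)) (1 / real (Suc m)))"
    by (intro ln_mono) (auto simp: less_max_iff_disj)
  ultimately show "norm (trunc_kernel m z t) \<le> 4 + \<bar>ln (2 * (cmod z + 1))\<bar> + \<bar>ln (2 * (1 / real (Suc m)))\<bar>"
    unfolding trunc_kernel_def real_norm_def by linarith
qed measurable

lemma trunc_pot_lipschitz:
  assumes M: "prob_on K M" and K: "closed K" "K \<subseteq> {-1..1}"
  shows "\<bar>trunc_pot m M z - trunc_pot m M w\<bar> \<le> real (Suc m) * cmod (z - w)"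
proof -
  note int = integrable_trunc_kernel[OF M K]
  have "trunc_pot m M z - trunc_pot m M w = (\<integral>t. trunc_kernel m z t - trunc_kernel m w t \<partial>M)"
    unfolding trunc_pot_def using int by simp
  also have "norm \<dots> \<le> real (Suc m) * cmod (z - w)"
  proof (rule prob_on_norm_integral_le[OF M K(1)])
    fix t
    define a where "a = max (cmod (z - of_real t)) (1 / real (Suc m))"
    define b where "b = max (cmod (w - of_real t)) (1 / real (Suc m))"
    have ab: "1 / real (Suc m) \<le> a" "1 / real (Suc m) \<le> b" by (auto simp: a_def b_def)
    have pos: "0 < a" "0 < b" using ab by (smt (verit) of_nat_0_less_iff zero_less_Suc zero_less_divide_1_iff)+
    have "\<bar>a - b\<bar> \<le> \<bar>cmod (z - of_real t) - cmod (w - of_real t)\<bar>" by (auto simp: a_def b_def)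
    also have "\<dots> \<le> cmod ((z - of_real t) - (w - of_real t))" by (rule norm_triangle_ineq3)
    also have "\<dots> = cmod (z - w)" by simp
    finally have d: "\<bar>a - b\<bar> \<le> cmod (z - w)" .
    have "norm (trunc_kernel m z t - trunc_kernel m w t) = \<bar>ln a - ln b\<bar>"
      unfolding trunc_kernel_def a_def[symmetric] b_def[symmetric]
      using pos by (simp add: ln_mult abs_minus_commute)
    also have "\<dots> \<le> \<bar>a - b\<bar> / (1 / real (Suc m))" by (rule ln_lipschitz) (use ab in auto)
    also have "\<dots> = real (Suc m) * \<bar>a - b\<bar>" by simp
    also have "\<dots> \<le> real (Suc m) * cmod (z - w)" using d by (intro mult_left_mono) auto
    finally show "norm (trunc_kernel m z t - trunc_kernel m w t) \<le> real (Suc m) * cmod (z - w)" .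
  qed measurable
  finally show ?thesis by simp
qed

lemma trunc_kernel_mono: "m \<le> n \<Longrightarrow> trunc_kernel m z t \<le> trunc_kernel n z t"
  unfolding trunc_kernel_def
  by (intro diff_left_mono ln_mono mult_left_mono max.mono order_refl)
     (auto simp: less_max_iff_disj frac_le)

lemma trunc_kernel_nonneg:
  assumes "x \<in> {-1..1}" "t \<in> {-1..1}" shows "0 \<le> trunc_kernel m (of_real x) t"
proof -
  have eq: "cmod (of_real x - of_real t) = \<bar>x - t\<bar>" by (simp flip: of_real_diff)
  have "max \<bar>x - t\<bar> (1 / real (Suc m)) \<le> 2" using assms by (auto simp: field_simps)
  moreover have "ln (2 * max \<bar>x - t\<bar> (1 / real (Suc m))) \<le> 2 * max \<bar>x - t\<bar> (1 / real (Suc m)) - 1"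
    by (intro ln_le_minus_one) (auto simp: less_max_iff_disj)
  moreover have "2 * max \<bar>x - t\<bar> (1 / real (Suc m)) \<le> 2 * 2"
    by (intro mult_left_mono) (use calculation in auto)
  ultimately have "ln (2 * max \<bar>x - t\<bar> (1 / real (Suc m))) \<le> 4" by linarith
  then show ?thesis unfolding trunc_kernel_def eq by simp
qed

lemma trunc_kernel_SUP: "(SUP m. ennreal (trunc_kernel m (of_real x) t)) = kernel x t"
proof (rule LIMSEQ_unique)
  show "(\<lambda>m. ennreal (trunc_kernel m (of_real x) t)) \<longlonglongrightarrow> (SUP m. ennreal (trunc_kernel m (of_real x) t))"
    by (intro LIMSEQ_SUP monoI ennreal_leI trunc_kernel_mono)
  have eq: "cmod (of_real x - of_real t) = \<bar>x - t\<bar>" by (simp flip: of_real_diff)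
  have inv: "(\<lambda>m. 1 / real (Suc m)) \<longlonglongrightarrow> 0"
    using LIMSEQ_inverse_real_of_nat by (simp add: divide_inverse)
  show "(\<lambda>m. ennreal (trunc_kernel m (of_real x) t)) \<longlonglongrightarrow> kernel x t"
  proof (cases "x = t")
    case False
    have "(\<lambda>m. 4 - ln (2 * max \<bar>x - t\<bar> (1 / real (Suc m)))) \<longlonglongrightarrow> 4 - ln (2 * max \<bar>x - t\<bar> 0)"
      using False by (intro tendsto_diff tendsto_const tendsto_ln tendsto_mult tendsto_max inv) auto
    then have "(\<lambda>m. trunc_kernel m (of_real x) t) \<longlonglongrightarrow> 4 - ln (2 * \<bar>x - t\<bar>)"
      unfolding trunc_kernel_def eq by simp
    then have "(\<lambda>m. ennreal (trunc_kernel m (of_real x) t)) \<longlonglongrightarrow> ennreal (4 - ln (2 * \<bar>x - t\<bar>))"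
      by (rule tendsto_ennrealI)
    then show ?thesis using False by (simp add: kernel_def)
  next
    case True
    have "filterlim (\<lambda>m. ln (real (Suc m))) at_top sequentially"
      by (rule filterlim_compose[OF ln_at_top filterlim_compose[OF filterlim_real_sequentially filterlim_Suc]])
    then have "filterlim (\<lambda>m. (4 - ln 2) + ln (real (Suc m))) at_top sequentially"
      by (rule filterlim_tendsto_add_at_top[OF tendsto_const])
    moreover have "(\<lambda>m. (4 - ln 2) + ln (real (Suc m))) = (\<lambda>m. trunc_kernel m (of_real x) t)"
      unfolding trunc_kernel_def eq True by (rule ext) (simp add: ln_div)
    ultimately have "((\<lambda>m. ennreal (trunc_kernel m (of_real x) t)) \<longlongrightarrow> \<infinity>) sequentially"
      by (simp add: ennreal_tendsto_top_eq_at_top)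
    then show ?thesis using True by (simp add: kernel_def)
  qed
qed

lemma potential_trunc_SUP:
  assumes M: "prob_on K M" and K: "closed K" "K \<subseteq> {-1..1}" and x: "x \<in> {-1..1}"
  shows "potential M x = (SUP m. ennreal (trunc_pot m M (of_real x)))"
proof -
  have e: "(\<integral>\<^sup>+ t. ennreal (trunc_kernel m (of_real x) t) \<partial>M) = ennreal (trunc_pot m M (of_real x))" for m
    unfolding trunc_pot_def
  proof (rule nn_integral_eq_integral[OF integrable_trunc_kernel[OF M K]])
    show "AE t in M. 0 \<le> trunc_kernel m (of_real x) t"
      using prob_on_AE[OF M K(1)] by eventually_elim (use K(2) x trunc_kernel_nonneg in blast)
  qed
  have "potential M x = (\<integral>\<^sup>+ t. (SUP m. ennreal (trunc_kernel m (of_real x) t)) \<partial>M)"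
    unfolding potential_def trunc_kernel_SUP ..
  also have "\<dots> = (SUP m. \<integral>\<^sup>+ t. ennreal (trunc_kernel m (of_real x) t) \<partial>M)"
    by (intro nn_integral_monotone_convergence_SUP prob_on_measurable[OF M] measurable_compose[OF borel_trunc_kernel measurable_ennreal]
        incseq_SucI le_funI ennreal_leI trunc_kernel_mono) simp
  finally show ?thesis by (simp add: e)
qed

lemma trunc_pot_near:
  assumes M: "prob_on K M" and K: "closed K" "K \<subseteq> {-1..1}" and x: "x \<in> {-1..1}"
    and h: "ennreal h \<le> potential M x" and e: "0 < e"
  obtains m d where "d > 0" "\<And>z. cmod (z - of_real x) < d \<Longrightarrow> h - e < trunc_pot m M z"
proof -
  obtain m where m: "h - e / 2 < trunc_pot m M (of_real x)"
  \<comment> \<open>\<open>ennreal\<close> sends negative numbers to 0, so the comparison with the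
    supremum is faithful only for nonnegative thresholds.\<close>
  proof (cases "h - e / 2 < 0")
    case True
    have "0 \<le> trunc_pot 0 M (of_real x)" unfolding trunc_pot_def
    proof (rule integral_nonneg_AE)
      show "AE t in M. 0 \<le> trunc_kernel 0 (of_real x) t"
        using prob_on_AE[OF M K(1)] by eventually_elim (use K(2) x trunc_kernel_nonneg in blast)
    qed
    then show thesis using True by (intro that[of 0]) simp
  next
    case False
    have "ennreal (h - e / 2) < ennreal h" using False e by (intro ennreal_lessI) auto
    also note h
    finally obtain m where "ennreal (h - e / 2) < ennreal (trunc_pot m M (of_real x))"
      unfolding potential_trunc_SUP[OF M K x] less_SUP_iff by blast
    then have "h - e / 2 < trunc_pot m M (of_real x)" using False by (auto simp: ennreal_less_iff)
    then show thesis by (rule that)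
  qed
  show thesis
  proof (rule that)
    show "0 < e / (2 * real (Suc m))" using e by simp
    fix z assume "cmod (z - of_real x) < e / (2 * real (Suc m))"
    then have "real (Suc m) * cmod (z - of_real x) < e / 2" by (simp add: field_simps)
    then show "h - e < trunc_pot m M z"
      using m trunc_pot_lipschitz[OF M K, of m z "of_real x"] by linarith
  qed
qed

lemma logpot_le_trunc:
  assumes M: "prob_on K M" and K: "closed K" "K \<subseteq> {-1..1}"
    and int: "integrable M (\<lambda>t. ln (cmod (z - of_real t)))" and AE: "AE t in M. z \<noteq> of_real t"
  shows "logpot M z \<le> 4 - ln 2 - trunc_pot m M z"
proof -
  interpret prob_space M using M by (rule prob_on_prob_space)
  have "logpot M z \<le> (\<integral>t. 4 - ln 2 - trunc_kernel m z t \<partial>M)" unfolding logpot_def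
  proof (rule integral_mono_AE[OF int])
    show "integrable M (\<lambda>t. 4 - ln 2 - trunc_kernel m z t)" using integrable_trunc_kernel[OF M K] by simp
    show "AE t in M. ln (cmod (z - of_real t)) \<le> 4 - ln 2 - trunc_kernel m z t" using AE
    proof eventually_elim
      fix t assume "z \<noteq> of_real t"
      then have "ln 2 + ln (cmod (z - of_real t)) = ln (2 * cmod (z - of_real t))" by (subst ln_mult) auto
      also have "\<dots> \<le> ln (2 * max (cmod (z - of_real t)) (1 / real (Suc m)))"
        using \<open>z \<noteq> of_real t\<close> by (intro ln_mono) auto
      finally show "ln (cmod (z - of_real t)) \<le> 4 - ln 2 - trunc_kernel m z t"
        unfolding trunc_kernel_def by linarith
    qed
  qed
  also have "\<dots> = 4 - ln 2 - trunc_pot m M z"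
    unfolding trunc_pot_def using integrable_trunc_kernel[OF M K] by (simp add: prob_space)
  finally show ?thesis .
qed

lemma prob_on_AE_ne:
  assumes "prob_on K M" "closed K" "z \<notin> cset K" shows "AE t in M. z \<noteq> of_real t"
  using prob_on_AE[OF assms(1,2)] by eventually_elim (use assms(3) in auto)

text \<open>A lower bound for the potential at the single point x controls the logarithmic potential
  at all nearby points off K, since U = 4 - ln 2 - potential wherever both are finite. This is the
  form of boundary data that the maximum principle takes.\<close>

lemma logpot_usc:
  assumes M: "prob_on K M" and K: "closed K" "K \<subseteq> {-1..1}" and x: "x \<in> K"
    and h: "ennreal h \<le> potential M x" and e: "0 < e"
  obtains d where "d > 0" "\<And>z. z \<notin> cset K \<Longrightarrow> cmod (z - of_real x) < d \<Longrightarrow> logpot M z < 4 - ln 2 - h + e"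
proof -
  have x1: "x \<in> {-1..1}" using K(2) x by blast
  from trunc_pot_near[OF M K x1 h e] obtain m d where d: "d > 0"
    "\<And>z. cmod (z - of_real x) < d \<Longrightarrow> h - e < trunc_pot m M z" by blast
  show thesis
  proof (rule that[OF d(1)])
    fix z assume z: "z \<notin> cset K" "cmod (z - of_real x) < d"
    obtain c where c: "c > 0" "\<And>t. t \<in> K \<Longrightarrow> c \<le> cmod (z - of_real t)" using cset_dist[OF K(1) z(1)] by blast
    show "logpot M z < 4 - ln 2 - h + e"
      using logpot_le_trunc[OF M K logpot_bounds(1)[OF M K c] prob_on_AE_ne[OF M K(1) z(1)], of m] d(2)[OF z(2)]
      by linarith
  qed
qed

lemma potential_lsc:
  assumes M: "prob_on K M" and K: "closed K" "K \<subseteq> {-1..1}" and x: "x \<in> {-1..1}"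
    and h: "ennreal h < potential M x" "0 \<le> h"
  obtains d where "d > 0" "\<And>y. y \<in> {-1..1} \<Longrightarrow> \<bar>y - x\<bar> < d \<Longrightarrow> ennreal h < potential M y"
proof -
  obtain h' where h': "ennreal h < ennreal h'" "ennreal h' \<le> potential M x"
  proof (cases "potential M x")
    case (real r)
    then show thesis using h by (intro that[of r]) auto
  next
    case top
    then show thesis using h by (intro that[of "h + 1"]) (auto simp: ennreal_less_iff)
  qed
  then have hh: "h < h'" using h(2) by (simp add: ennreal_less_iff)
  then have "0 < h' - h" by simp
  from trunc_pot_near[OF M K x h'(2) this] obtain m d where d: "d > 0"
    "\<And>z. cmod (z - of_real x) < d \<Longrightarrow> h' - (h' - h) < trunc_pot m M z" by blast
  show thesis
  proof (rule that[OF d(1)])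
    fix y assume y: "y \<in> {-1..1}" "\<bar>y - x\<bar> < d"
    have "cmod (of_real y - of_real x) < d" using y(2) by (simp flip: of_real_diff)
    from d(2)[OF this] have "h < trunc_pot m M (of_real y)" by simp
    then have "ennreal h < ennreal (trunc_pot m M (of_real y))" using h(2) by (simp add: ennreal_less_iff)
    also have "\<dots> \<le> potential M y" unfolding potential_trunc_SUP[OF M K y(1)] by (rule SUP_upper) simp
    finally show "ennreal h < potential M y" .
  qed
qed

section \<open>The Dirichlet problem\<close>

lemma closed_cset: "closed K \<Longrightarrow> closed (cset K)"
  by (intro closed_injective_linear_image) (auto simp: linear_conv_bounded_linear bounded_linear_of_real inj_on_def)

lemma interior_cset: "interior (cset K) = {}"
proof (rule ccontr)
  assume "interior (cset K) \<noteq> {}"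
  then obtain z where "z \<in> interior (cset K)" by blast
  then obtain e where e: "e > 0" "ball z e \<subseteq> cset K" by (auto simp: mem_interior)
  have z: "z \<in> cset K" using e by auto
  have "z + \<i> * of_real (e/2) \<in> ball z e" using e(1) by (simp add: dist_norm norm_mult)
  then have "z + \<i> * of_real (e/2) \<in> cset K" using e(2) by blast
  then show False using z e(1) by (auto simp: complex_eq_iff)
qed

lemma closure_compl_cset: "closure (- cset K) = UNIV"
  using interior_cset[of K] by (simp add: closure_complement)

text \<open>A subset of the real line has no interior in the plane. So K is its own frontier, its
  complement is dense, and u is continuous on the whole plane; the boundary datum is transported by
  \<open>Re\<close>.\<close>

lemma dirichlet_solution:
  assumes reg: "dirichlet_regular (cset K)" and f: "continuous_on UNIV f"
  obtains u L where "continuous_on UNIV u" "harmonic_on u (- cset K)" "\<And>x. x \<in> K \<Longrightarrow> u (of_real x) = f x"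
    "\<And>e. e > 0 \<Longrightarrow> \<exists>R. \<forall>z. R \<le> cmod z \<longrightarrow> \<bar>u z - L\<bar> < e"
    "\<exists>r>0. harmonic_on (\<lambda>w. if w = 0 then L else u (1 / w)) (ball 0 r)"
proof -
  have comp: "compact (cset K)" using reg by (simp add: dirichlet_regular_def)
  then have fr: "frontier (cset K) = cset K"
    using interior_cset[of K] compact_imp_closed[OF comp] by (simp add: frontier_def)
  have "continuous_on (frontier (cset K)) (\<lambda>z. f (Re z))"
    by (rule continuous_on_compose2[OF f]) (auto intro: continuous_intros)
  then obtain u where u: "continuous_on (closure (- cset K)) u" "harmonic_on u (- cset K)"
    "harmonic_at_infinity u" "\<forall>z\<in>frontier (cset K). u z = f (Re z)"
    using reg unfolding dirichlet_regular_def by blast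
  obtain L r where r: "r > 0" "harmonic_on (\<lambda>w. if w = 0 then L else u (1 / w)) (ball 0 r)"
    using u(3) unfolding harmonic_at_infinity_def by blast
  have lim: "\<exists>R. \<forall>z. R \<le> cmod z \<longrightarrow> \<bar>u z - L\<bar> < e" if e: "e > 0" for e
  proof -
    have "continuous_on (ball 0 r) (\<lambda>w. if w = 0 then L else u (1 / w))" by (rule harmonic_on_continuous[OF r(2)])
    then have "isCont (\<lambda>w. if w = 0 then L else u (1 / w)) 0" using r(1) by (simp add: continuous_on_eq_continuous_at)
    then obtain d where d: "d > 0" "\<And>w. dist w 0 < d \<Longrightarrow> dist (if w = 0 then L else u (1 / w)) (if (0::complex) = 0 then L else u (1 / 0)) < e"
      using e unfolding continuous_at_eps_delta by blast
    have "\<bar>u z - L\<bar> < e" if z: "2 / d \<le> cmod z" for z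
    proof -
      have "0 < 2 / d" using d by simp
      then have z0: "z \<noteq> 0" "0 < cmod z" using z by auto
      have "2 \<le> cmod z * d" using z d(1) by (simp add: field_simps)
      then have "1 < cmod z * d" by linarith
      then have "cmod (1 / z) < d" using z0 by (simp add: norm_divide field_simps)
      then show ?thesis using d(2)[of "1 / z"] z0 by (simp add: dist_norm)
    qed
    then show ?thesis by blast
  qed
  show thesis
  proof (rule that[of u L])
    show "continuous_on UNIV u" using u(1) by (simp add: closure_compl_cset)
    show "u (of_real x) = f x" if "x \<in> K" for x using u(4) that by (simp add: fr)
  qed (use u(2) lim r in auto)
qed

lemma connected_compl_segment: "connected (- cset {-1..1})"
proof (rule connected_complement_bounded_convex)
  show "bounded (cset {-1..1})" by (intro compact_imp_bounded compact_continuous_image continuous_intros) auto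
  show "convex (cset {-1..1})"
    by (intro convex_linear_image) (auto simp: linear_conv_bounded_linear bounded_linear_of_real)
qed simp

text \<open>Strong minimum principle. The value is spread over the complement of the segment [-1,1],
  which is connected, and reaches all remaining points by density and continuity.\<close>

lemma harmonic_min_constant:
  assumes K: "closed K" "K \<subseteq> {-1..1}" and u: "continuous_on UNIV u" "harmonic_on u (- cset K)"
    and z: "z \<notin> cset K" and min: "\<And>w. u z \<le> u w"
  shows "u w = u z"
proof -
  have neg: "harmonic_on (\<lambda>w. - u w) (- cset K)"
    using harmonic_on_lincomb[OF u(2) u(2), of "-1" 0 0] by simp
  have loc: "\<exists>r>0. ball y r \<subseteq> - cset K \<and> (\<forall>w\<in>ball y r. u w = u z)" if y: "y \<notin> cset K" "u y = u z" for y
  proof -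
    have "- u w \<le> - u y" for w using min[of w] y(2) by simp
    then have "\<exists>r>0. ball y r \<subseteq> - cset K \<and> (\<forall>w\<in>ball y r. - u w = - u y)"
      using y(1) by (intro harmonic_local_max[OF neg]) auto
    then show ?thesis unfolding neg_equal_iff_equal y(2) .
  qed
  let ?S = "- cset {-1..1}"
  have sub: "?S \<subseteq> - cset K" using K(2) by auto
  have oS: "open ?S" using closed_cset[of "{-1..1}"] by auto
  let ?T = "{w \<in> ?S. u w = u z}"
  have "closedin (top_of_set ?S) ?T"
    by (rule continuous_closedin_preimage_constant[OF continuous_on_subset[OF u(1)]]) simp
  moreover have "open ?T" unfolding open_contains_ball
  proof
    fix y assume y: "y \<in> ?T"
    then obtain r where r: "r > 0" "\<forall>w\<in>ball y r. u w = u z" using loc[of y] sub by blast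
    obtain e where e: "e > 0" "ball y e \<subseteq> ?S" using oS y openE by blast
    have "ball y (min r e) \<subseteq> ?T" using r e by auto
    then show "\<exists>e>0. ball y e \<subseteq> ?T" using r e by (intro exI[of _ "min r e"]) auto
  qed
  then have "openin (top_of_set ?S) ?T" by (intro open_subset) auto
  moreover have "?T \<noteq> {}"
  proof -
    obtain r where r: "r > 0" "\<forall>w\<in>ball z r. u w = u z" using loc[OF z] by blast
    \<comment> \<open>z may lie in a gap of K inside [-1,1]; a vertical move away from the axis
      lands in the complement of the segment.\<close>
    define w where "w = z + \<i> * of_real (if Im z < 0 then - r / 2 else r / 2)"
    have "w \<in> ball z r" using r(1) by (simp add: w_def dist_norm norm_mult)
    moreover have "Im w \<noteq> 0" using r(1) by (auto simp: w_def)
    ultimately have "w \<in> ?T" using r(2) by auto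
    then show ?thesis by blast
  qed
  ultimately have T: "?T = ?S" using connected_compl_segment unfolding connected_clopen by blast
  have "closed {w. u w = u z}"
    using continuous_closed_preimage_constant[OF u(1), of "u z"] by simp
  moreover have "?S \<subseteq> {w. u w = u z}" using T by auto
  ultimately have "closure ?S \<subseteq> {w. u w = u z}" by (rule closure_minimal[rotated])
  then show ?thesis unfolding closure_compl_cset by auto
qed

text \<open>Minimum principle on the sphere: a value <= 0 off K yields a nonpositive minimum
  attained at a finite point or at infinity, and in both cases u would be constant although u is
  nonzero at a point of K.\<close>

lemma harmonic_positive:
  assumes K: "closed K" "K \<subseteq> {-1..1}" and u: "continuous_on UNIV u" "harmonic_on u (- cset K)"
    and lim: "\<And>e. e > 0 \<Longrightarrow> \<exists>R. \<forall>z. R \<le> cmod z \<longrightarrow> \<bar>u z - L\<bar> < e"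
    and inf: "\<exists>r>0. harmonic_on (\<lambda>w. if w = 0 then L else u (1 / w)) (ball 0 r)"
    and nonneg: "\<And>x. x \<in> K \<Longrightarrow> 0 \<le> u (of_real x)" and a: "a \<in> K" "u (of_real a) \<noteq> 0"
    and z: "z \<notin> cset K"
  shows "0 < u z"
proof (rule ccontr)
  assume "\<not> 0 < u z"
  then have uz: "u z \<le> 0" by simp
  have main: False if y: "y \<notin> cset K" "u y \<le> 0" "\<And>w. u y \<le> u w" for y
    using harmonic_min_constant[OF K u y(1,3), of "of_real a"] nonneg[OF a(1)] a(2) y(2) by simp
  have att: False if y: "u y < L" "u y \<le> u z" for y
  proof -
    obtain R where R: "\<And>w. R \<le> cmod w \<Longrightarrow> \<bar>u w - L\<bar> < L - u y" using lim[of "L - u y"] y by auto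
    have "compact (cball (0::complex) (max \<bar>R\<bar> (cmod y)))" "cball (0::complex) (max \<bar>R\<bar> (cmod y)) \<noteq> {}" by auto
    then obtain m where m: "\<And>w. w \<in> cball 0 (max \<bar>R\<bar> (cmod y)) \<Longrightarrow> u m \<le> u w"
      using continuous_attains_inf[of "cball (0::complex) (max \<bar>R\<bar> (cmod y))" u] continuous_on_subset[OF u(1)] by blast
    have my: "u m \<le> u y" by (rule m) simp
    have glob: "u m \<le> u w" for w
    proof (cases "w \<in> cball 0 (max \<bar>R\<bar> (cmod y))")
      case False
      then have "R \<le> cmod w" by (auto simp: max_def split: if_splits)
      then show ?thesis using R[of w] my by linarith
    qed (rule m)
    show False
    proof (cases "m \<in> cset K")
      case True
      then have "0 \<le> u m" using nonneg by auto
      then have "u z = u m" using glob[of z] uz by linarith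
      then show False using main[OF z uz] glob by simp
    next
      case False
      show False using main[OF False] my y(2) uz glob by fastforce
    qed
  qed
  \<comment> \<open>By \<open>att\<close>, u takes no value below both L and u z, so L is a lower
    bound for u and the minimum sits at infinity. The local principle in the coordinate 1/w brings
    it back to finite points.\<close>
  have Lz: "L \<le> u z" using att[of z] by fastforce
  have LL: "L \<le> u w" for w using att[of w] Lz by fastforce
  obtain r where r: "r > 0" "harmonic_on (\<lambda>w. if w = 0 then L else u (1 / w)) (ball 0 r)" using inf by blast
  define h where "h w = - (if w = 0 then L else u (1 / w))" for w
  have neg: "harmonic_on h (ball 0 r)"
    using harmonic_on_lincomb[OF r(2) r(2), of "-1" 0 0] by (simp add: h_def[abs_def])
  have le: "h w \<le> h 0" for w using LL by (simp add: h_def)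
  have "(0::complex) \<in> ball 0 r" using r(1) by simp
  then have "\<exists>r'>0. ball (0::complex) r' \<subseteq> ball 0 r \<and> (\<forall>w\<in>ball 0 r'. h w = h 0)"
    by (rule harmonic_local_max[OF neg]) (rule le)
  then obtain r' where r': "r' > 0" "\<forall>w\<in>ball 0 r'. h w = h 0" by blast
  \<comment> \<open>m <= 1/2 puts 1/w at a real point >= 2, off K.\<close>
  define m where "m = min (r' / 2) (1/2)"
  have m: "0 < m" "m < r'" "m \<le> 1/2" using r'(1) unfolding m_def by linarith+
  define w where "w = complex_of_real m"
  have w: "w \<noteq> 0" "w \<in> ball 0 r'" using m by (auto simp: w_def)
  have uw: "u (1 / w) = L" using bspec[OF r'(2) w(2)] w(1) by (simp add: h_def)
  have w1: "1 / w = of_real (1 / m)" by (simp add: w_def)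
  have "2 \<le> 1 / m" using m by (simp add: le_divide_eq)
  have "1 / w \<notin> cset K"
  proof (rule notI)
    assume "1 / w \<in> cset K"
    then obtain t where t: "t \<in> K" "1 / w = of_real t" by blast
    have "t = 1 / m" using t(2) unfolding w1 of_real_eq_iff by (rule sym)
    moreover have "t \<le> 1" using subsetD[OF K(2) t(1)] by simp
    ultimately show False using \<open>2 \<le> 1 / m\<close> by linarith
  qed
  then show False
  proof (rule main)
    show "u (1 / w) \<le> 0" unfolding uw using Lz uz by linarith
    show "u (1 / w) \<le> u y" for y unfolding uw by (rule LL)
  qed
qed

section \<open>Barriers for the potentials of the regularised minimisers\<close>

lemma frontier_ball_diff:
  assumes "closed C" shows "frontier (ball z R - C) \<subseteq> sphere z R \<union> C"
proof -
  have "frontier (ball z R - C) \<subseteq> frontier (ball z R) \<union> frontier C"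
    using frontier_Int_subset[of "ball z R" "- C"] by (auto simp: Diff_eq frontier_complement)
  moreover have "frontier (ball z R) \<subseteq> sphere z R"
    using closure_minimal[OF ball_subset_cball closed_cball, of z R]
    by (auto simp: frontier_def interior_open subset_iff mem_sphere)
  moreover have "frontier C \<subseteq> C" using assms by (simp add: frontier_subset_closed)
  ultimately show ?thesis by blast
qed

lemma continuous_near_less:
  fixes u :: "complex \<Rightarrow> real"
  assumes "continuous_on UNIV u" "u x < c"
  obtains d where "d > 0" "\<And>z. dist z x < d \<Longrightarrow> u z < c"
proof -
  have "isCont u x" using assms(1) by (simp add: continuous_on_eq_continuous_at)
  then obtain d where d: "d > 0" "\<And>z. dist z x < d \<Longrightarrow> dist (u z) (u x) < c - u x"
    using assms(2) unfolding continuous_at_eps_delta by (metis diff_gt_0_iff_gt)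
  show thesis
  proof (rule that[OF d(1)])
    fix z assume "dist z x < d"
    from d(2)[OF this] show "u z < c" by (auto simp: dist_real_def abs_less_iff)
  qed
qed

context
  fixes K :: "real set"
  assumes K: "compact K" "K \<noteq> {}" "K \<subseteq> {-1..1}"
begin

lemma clK: "closed K" using K(1) by (rule compact_imp_closed)

lemma logpot_le_ln:
  assumes "prob_on K M" "z \<notin> cset K" shows "logpot M z \<le> ln (cmod z + 1)"
proof -
  obtain c where c: "c > 0" "\<And>t. t \<in> K \<Longrightarrow> c \<le> cmod (z - of_real t)" using cset_dist[OF clK assms(2)] by blast
  show ?thesis by (rule logpot_bounds(3)[OF assms(1) clK K(3) c])
qed

text \<open>Unbounded regularised minima mean capacity zero. The potentials of the minimisers are
  then so negative near K that a tiny multiple of one of them outweighs the boundary values of u: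
  the maximum principle no longer sees K, only the value L at infinity.\<close>

lemma harmonic_le_limit:
  assumes unb: "\<And>B. \<exists>n. B < reg_val K n"
    and u: "continuous_on UNIV u" "harmonic_on u (- cset K)"
    and lim: "\<And>e. e > 0 \<Longrightarrow> \<exists>R. \<forall>z. R \<le> cmod z \<longrightarrow> \<bar>u z - L\<bar> < e"
    and z0: "z0 \<notin> cset K"
  shows "u z0 \<le> L"
proof (rule field_le_epsilon)
  fix e :: real assume e: "0 < e"
  obtain R0 where R0: "\<And>z. R0 \<le> cmod z \<Longrightarrow> \<bar>u z - L\<bar> < e" using lim[OF e] by blast
  define R where "R = max (max \<bar>R0\<bar> (cmod z0 + 1)) 2"
  have R: "R0 \<le> R" "cmod z0 < R" "2 \<le> R" by (auto simp: R_def)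
  obtain c where c: "c > 0" "\<And>t. t \<in> K \<Longrightarrow> c \<le> cmod (z0 - of_real t)" using cset_dist[OF clK z0] by blast
  have "compact (cset K)" by (intro compact_continuous_image continuous_intros K)
  then obtain Bu where Bu: "\<And>x. x \<in> cset K \<Longrightarrow> u x \<le> Bu"
    using continuous_attains_sup[of "cset K" u] continuous_on_subset[OF u(1)] K(2) by blast
  show "u z0 \<le> L + e"
  proof (rule field_le_epsilon)
    fix e1 :: real assume e1: "0 < e1"
    \<comment> \<open>D bounds ln(R+1) minus the potential at z0 for every n, so the error at z0 is
      at most e' D = e1. Only then is n taken large depending on e': C makes v negative near K, and
      5 - ln 2 contains the slack 1 from \<open>logpot_usc\<close>.\<close>
    define D where "D = \<bar>ln (R + 1) - ln c\<bar> + 1"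
    define e' where "e' = e1 / D"
    have D: "0 < D" "ln (R + 1) - ln c \<le> D" by (auto simp: D_def)
    have e': "0 < e'" using e1 D by (simp add: e'_def)
    define C where "C = (Bu + 1 - L - e - e' * ln (R + 1)) / e'"
    obtain n where n: "5 - ln 2 + C < reg_val K n" using unb by blast
    let ?M = "reg_min K n"
    note M = reg_min(1)[OF K, of n]
    define v where "v z = 1 * u z + e' * logpot ?M z + (- L - e - e' * ln (R + 1))" for z
    have "v z0 \<le> 0"
    proof (rule harmonic_max_principle)
      show "open (ball 0 R - cset K)" by (intro open_Diff closed_cset clK) auto
      show "bounded (ball 0 R - cset K)" by (rule bounded_subset[OF bounded_ball[of 0 R]]) auto
      show "harmonic_on v (ball 0 R - cset K)" unfolding v_def
        by (rule harmonic_on_subset[OF harmonic_on_lincomb[OF u(2) logpot_harmonic[OF M clK K(3)]]])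
           (auto intro!: open_Diff closed_cset clK)
      show "z0 \<in> ball 0 R - cset K" using R z0 by simp
      fix x :: complex and eps :: real assume x: "x \<in> frontier (ball 0 R - cset K)" and eps: "0 < eps"
      have "x \<in> sphere 0 R \<union> cset K" using frontier_ball_diff[OF closed_cset[OF clK]] x by blast
      then show "\<exists>d>0. \<forall>z\<in>ball 0 R - cset K. dist z x < d \<longrightarrow> v z < eps"
      proof
        assume xs: "x \<in> sphere 0 R"
        then have "u x < L + e" using R0[of x] R(1) by auto
        from continuous_near_less[OF u(1) this] obtain d where d: "d > 0" "\<And>z. dist z x < d \<Longrightarrow> u z < L + e" by blast
        have "v z < eps" if z: "z \<in> ball 0 R - cset K" "dist z x < d" for z
        proof -
          have "logpot ?M z \<le> ln (cmod z + 1)" using z by (intro logpot_le_ln M) auto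
          also have "\<dots> \<le> ln (R + 1)"
            using z by (intro ln_mono add_right_mono add_nonneg_pos) auto
          finally have "e' * logpot ?M z \<le> e' * ln (R + 1)" using e' by (intro mult_left_mono) auto
          then show ?thesis using d(2)[OF z(2)] eps unfolding v_def by linarith
        qed
        then show ?thesis using d(1) by blast
      next
        assume "x \<in> cset K"
        then obtain t where t: "t \<in> K" "x = of_real t" by blast
        have "u x < Bu + 1" using Bu[OF \<open>x \<in> cset K\<close>] by simp
        from continuous_near_less[OF u(1) this] obtain d where d: "d > 0" "\<And>z. dist z x < d \<Longrightarrow> u z < Bu + 1" by blast
        from logpot_usc[OF M clK K(3) t(1) reg_val_le_potential[OF K t(1)] zero_less_one]
        obtain d' where d': "d' > 0" "\<And>z. z \<notin> cset K \<Longrightarrow> cmod (z - of_real t) < d' \<Longrightarrow> logpot ?M z < 4 - ln 2 - reg_val K n + 1"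
          by blast
        have "v z < eps" if z: "z \<in> ball 0 R - cset K" "dist z x < min d d'" for z
        proof -
          have "logpot ?M z < 4 - ln 2 - reg_val K n + 1"
            using z by (intro d'(2)) (auto simp: t(2) dist_norm)
          then have "logpot ?M z < - C" using n by linarith
          then have "e' * logpot ?M z < e' * (- C)" using e' by (rule mult_strict_left_mono)
          also have "\<dots> = - (Bu + 1 - L - e - e' * ln (R + 1))" using e' by (simp add: C_def)
          finally show ?thesis using d(2)[of z] z(2) eps unfolding v_def by auto
        qed
        then show ?thesis using d(1) d'(1) by (intro exI[of _ "min d d'"]) auto
      qed
    qed
    then have "u z0 \<le> L + e + e' * (ln (R + 1) - logpot ?M z0)" unfolding v_def by (simp add: algebra_simps)
    also have "\<dots> \<le> L + e + e' * (ln (R + 1) - ln c)"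
      using logpot_bounds(2)[OF M clK K(3) c] e' by (intro add_left_mono mult_left_mono) auto
    also have "\<dots> \<le> L + e + e' * D" using D e' by (intro add_left_mono mult_left_mono) auto
    also have "\<dots> = L + e + e1" using D by (simp add: e'_def)
    finally show "u z0 \<le> L + e + e1" .
  qed
qed

text \<open>Positivity of the capacity. Otherwise the solution with boundary datum x, and its
  negative, would both be bounded by their values at infinity; so it would be constant, against its
  values at two distinct points of K.\<close>

lemma reg_val_bounded:
  assumes reg: "dirichlet_regular (cset K)" and ab: "a \<in> K" "b \<in> K" "a \<noteq> b"
  obtains B where "\<And>n. reg_val K n \<le> B"
proof (rule ccontr)
  assume "\<not> thesis"
  have unb: "\<exists>n. B < reg_val K n" for B
  proof (rule ccontr)
    assume "\<not> (\<exists>n. B < reg_val K n)"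
    then have "reg_val K n \<le> B" for n by (simp add: not_less)
    from that[OF this] show False using \<open>\<not> thesis\<close> by simp
  qed
  obtain u L where u: "continuous_on UNIV u" "harmonic_on u (- cset K)" "\<And>x. x \<in> K \<Longrightarrow> u (of_real x) = x"
    and lim: "\<And>e. e > 0 \<Longrightarrow> \<exists>R. \<forall>z. R \<le> cmod z \<longrightarrow> \<bar>u z - L\<bar> < e"
    by (rule dirichlet_solution[OF reg, of "\<lambda>x. x"]) (intro continuous_intros, blast)
  have le: "u z \<le> L" if "z \<notin> cset K" for z by (rule harmonic_le_limit[OF unb u(1,2) lim that])
  have ge: "- u z \<le> - L" if z: "z \<notin> cset K" for z
  proof (rule harmonic_le_limit[OF unb _ _ _ z])
    show "continuous_on UNIV (\<lambda>z. - u z)" using u(1) by (intro continuous_intros)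
    show "harmonic_on (\<lambda>z. - u z) (- cset K)" using harmonic_on_lincomb[OF u(2) u(2), of "-1" 0 0] by simp
    fix e :: real assume "0 < e"
    from lim[OF this] show "\<exists>R. \<forall>z. R \<le> cmod z \<longrightarrow> \<bar>- u z - - L\<bar> < e" by (simp add: abs_minus_commute)
  qed
  have "- cset K \<subseteq> {z. u z = L}" using le ge by force
  moreover have "closed {z. u z = L}" using continuous_closed_preimage_constant[OF u(1), of L] by simp
  ultimately have "closure (- cset K) \<subseteq> {z. u z = L}" by (intro closure_minimal)
  then have "u z = L" for z unfolding closure_compl_cset by auto
  then show False using u(3)[OF ab(1)] u(3)[OF ab(2)] ab(3) by simp
qed

text \<open>For z off K and t in K the distance |z-t| stays between c and |z|+1; clamping it there
  turns the logarithm into a bounded continuous test function.\<close>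

lemma weak_lim_logpot:
  assumes \<mu>: "\<And>n. prob_on K (\<mu> n)" and M: "prob_on K M" and lim: "weak_lim \<mu> M" and z: "z \<notin> cset K"
  shows "(\<lambda>n. logpot (\<mu> n) z) \<longlonglongrightarrow> logpot M z"
proof -
  obtain c where c: "c > 0" "\<And>t. t \<in> K \<Longrightarrow> c \<le> cmod (z - of_real t)" using cset_dist[OF clK z] by blast
  define f where "f t = ln (max c (min (cmod z + 1) (cmod (z - of_real t))))" for t
  have cf: "continuous_on UNIV f" unfolding f_def
    using c(1) by (intro continuous_intros) (auto simp: max_def)
  have bf: "\<bar>f t\<bar> \<le> \<bar>ln c\<bar> + \<bar>ln (max c (cmod z + 1))\<bar>" for t
  proof -
    have "ln c \<le> f t" unfolding f_def using c(1) by (intro ln_mono) auto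
    moreover have "f t \<le> ln (max c (cmod z + 1))" unfolding f_def using c(1) by (intro ln_mono) auto
    ultimately show ?thesis by linarith
  qed
  have eq: "logpot N z = integral\<^sup>L N f" if N: "prob_on K N" for N unfolding logpot_def
  proof (rule integral_cong_AE)
    show "AE t in N. ln (cmod (z - of_real t)) = f t" using prob_on_AE[OF N clK]
    proof eventually_elim
      fix t assume t: "t \<in> K"
      have "\<bar>t\<bar> \<le> 1" using subsetD[OF K(3) t] by auto
      then have "cmod (z - of_real t) \<le> cmod z + 1" using norm_triangle_ineq4[of z "of_real t"] by simp
      then show "ln (cmod (z - of_real t)) = f t" unfolding f_def using c(2)[OF t] by (simp add: min_absorb2 max_absorb2)
    qed
  qed (rule prob_on_measurable[OF N], use borel_measurable_continuous_onI[OF cf] in measurable)+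
  show ?thesis using weak_limD[OF lim cf bf] unfolding eq[OF \<mu>] eq[OF M] .
qed

text \<open>The solution u with boundary datum |x - x0| is a barrier: positive off K and 0 at x0.
  The estimate by C u has the same C and u for all n, hence survives the weak limit off K, and the
  error disappears on approach to x0.\<close>

lemma equilibrium_potential_ge:
  assumes reg: "dirichlet_regular (cset K)" and ab: "a \<in> K" "b \<in> K" "a \<noteq> b"
    and M: "prob_on K M" and s: "strict_mono (s :: nat \<Rightarrow> nat)" and lim: "weak_lim (\<lambda>j. reg_min K (s j)) M"
    and H: "reg_val K \<longlonglongrightarrow> H" "\<And>n. reg_val K n \<le> H" "0 \<le> H" and x0: "x0 \<in> K"
  shows "ennreal H \<le> potential M x0"
proof -
  obtain u L where u: "continuous_on UNIV u" "harmonic_on u (- cset K)" "\<And>x. x \<in> K \<Longrightarrow> u (of_real x) = \<bar>x - x0\<bar>"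
    and ulim: "\<And>e. e > 0 \<Longrightarrow> \<exists>R. \<forall>z. R \<le> cmod z \<longrightarrow> \<bar>u z - L\<bar> < e"
    and uinf: "\<exists>r>0. harmonic_on (\<lambda>w. if w = 0 then L else u (1 / w)) (ball 0 r)"
    by (rule dirichlet_solution[OF reg, of "\<lambda>x. \<bar>x - x0\<bar>"]) (intro continuous_intros, blast)
  obtain a' where a': "a' \<in> K" "u (of_real a') \<noteq> 0" using ab u(3) x0 by (metis abs_0_eq eq_iff_diff_eq_0)
  have pos: "0 < u z" if "z \<notin> cset K" for z
  proof (rule harmonic_positive[OF clK K(3) u(1,2) ulim uinf _ a' that])
    show "0 \<le> u (of_real x)" if "x \<in> K" for x using u(3)[OF that] by simp
  qed
  have sph: "z \<notin> cset K" if "cmod z > 1" for z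
  proof
    assume "z \<in> cset K"
    then obtain t where "t \<in> K" "z = of_real t" by blast
    then show False using that subsetD[OF K(3), of t] by auto
  qed
  have "sphere (0::complex) 3 \<noteq> {}" by auto
  moreover have "compact (sphere (0::complex) 3)" by simp
  ultimately obtain zm where zm: "zm \<in> sphere 0 3" "\<And>z. z \<in> sphere 0 3 \<Longrightarrow> u zm \<le> u z"
    using continuous_attains_inf[of "sphere (0::complex) 3" u] continuous_on_subset[OF u(1)] by blast
  have b: "0 < u zm" by (rule pos, rule sph) (use zm(1) in simp)
  \<comment> \<open>On the circle |z| = 3 the potential is at most ln 4. C is chosen so that C u
    exceeds ln 4 - (4 - ln 2 - H) there; H bounds every \<open>reg_val K n\<close>, so C serves all
    n.\<close>
  define C where "C = (\<bar>ln 4 - 4 + ln 2 + H\<bar> + 1) / u zm"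
  have C: "0 < C" using b by (simp add: C_def)
  have Cb: "ln 4 - 4 + ln 2 + H < C * u zm" using b by (simp add: C_def)
  have bound_n: "logpot (reg_min K n) z0 \<le> 4 - ln 2 - reg_val K n + C * u z0" if z0: "z0 \<in> ball 0 3 - cset K" for n z0
  proof -
    let ?M = "reg_min K n"
    note M = reg_min(1)[OF K, of n]
    define v where "v z = 1 * logpot ?M z + (- C) * u z + (reg_val K n - 4 + ln 2)" for z
    have "v z0 \<le> 0"
    proof (rule harmonic_max_principle)
      show "open (ball 0 3 - cset K)" by (intro open_Diff closed_cset clK) auto
      show "bounded (ball 0 3 - cset K)" by (rule bounded_subset[OF bounded_ball[of 0 3]]) auto
      show "harmonic_on v (ball 0 3 - cset K)" unfolding v_def
        by (rule harmonic_on_subset[OF harmonic_on_lincomb[OF logpot_harmonic[OF M clK K(3)] u(2)]])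
           (auto intro!: open_Diff closed_cset clK)
      show "z0 \<in> ball 0 3 - cset K" by fact
      fix x :: complex and eps :: real assume x: "x \<in> frontier (ball 0 3 - cset K)" and eps: "0 < eps"
      have "x \<in> sphere 0 3 \<union> cset K" using frontier_ball_diff[OF closed_cset[OF clK]] x by blast
      then show "\<exists>d>0. \<forall>z\<in>ball 0 3 - cset K. dist z x < d \<longrightarrow> v z < eps"
      proof
        assume xs: "x \<in> sphere 0 3"
        have "- C * u x < - (ln 4 - 4 + ln 2 + H)"
          using mult_left_mono[OF zm(2)[OF xs], of C] C Cb by (simp only: mult_minus_left) linarith
        then have "(\<lambda>z. - C * u z) x < - (ln 4 - 4 + ln 2 + H)" .
        moreover have "continuous_on UNIV (\<lambda>z. - C * u z)" using u(1) by (intro continuous_intros)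
        ultimately obtain d where d: "d > 0" "\<And>z. dist z x < d \<Longrightarrow> - C * u z < - (ln 4 - 4 + ln 2 + H)"
          using continuous_near_less[of "\<lambda>z. - C * u z" x] by blast
        have "v z < eps" if z: "z \<in> ball 0 3 - cset K" "dist z x < d" for z
        proof -
          have "logpot ?M z \<le> ln (cmod z + 1)" using z by (intro logpot_le_ln M) auto
          also have "\<dots> \<le> ln 4" using z by (intro ln_mono add_nonneg_pos) auto
          finally show ?thesis using d(2)[OF z(2)] eps H(2)[of n] unfolding v_def by linarith
        qed
        then show ?thesis using d(1) by blast
      next
        assume "x \<in> cset K"
        then obtain t where t: "t \<in> K" "x = of_real t" by blast
        have e2: "0 < eps" by fact
        from logpot_usc[OF M clK K(3) t(1) reg_val_le_potential[OF K t(1)] e2]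
        obtain d where d: "d > 0" "\<And>z. z \<notin> cset K \<Longrightarrow> cmod (z - of_real t) < d \<Longrightarrow> logpot ?M z < 4 - ln 2 - reg_val K n + eps"
          by blast
        have "v z < eps" if z: "z \<in> ball 0 3 - cset K" "dist z x < d" for z
        proof -
          have "logpot ?M z < 4 - ln 2 - reg_val K n + eps"
            using z by (intro d(2)) (auto simp: t(2) dist_norm)
          moreover have "0 \<le> C * u z" using pos[of z] C z(1) by (intro mult_nonneg_nonneg) auto
          ultimately show ?thesis unfolding v_def by linarith
        qed
        then show ?thesis using d(1) by blast
      qed
    qed
    then show ?thesis unfolding v_def by simp
  qed
  have bound: "logpot M z \<le> 4 - ln 2 - H + C * u z" if z: "z \<in> ball 0 3 - cset K" for z
  proof (rule LIMSEQ_le)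
    show "(\<lambda>j. logpot (reg_min K (s j)) z) \<longlonglongrightarrow> logpot M z"
      using z by (intro weak_lim_logpot reg_min K M lim) auto
    have "(\<lambda>j. reg_val K (s j)) \<longlonglongrightarrow> H" using LIMSEQ_subseq_LIMSEQ[OF H(1) s] by (simp add: o_def)
    then show "(\<lambda>j. 4 - ln 2 - reg_val K (s j) + C * u z) \<longlonglongrightarrow> 4 - ln 2 - H + C * u z" 
      by (intro tendsto_intros)
  qed (use bound_n[OF z] in blast)
  \<comment> \<open>A vertical approach to x0: then |x0 - t| <= |w j - t| for all real t, so the
    kernel at x0 dominates the kernel at \<open>w j\<close> and the bound passes to x0
    itself.\<close>
  define w where "w j = of_real x0 + \<i> * of_real (inverse (real (Suc j)))" for j
  have wK: "w j \<in> ball 0 3 - cset K" for j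
  proof -
    have "cmod (w j) \<le> \<bar>x0\<bar> + inverse (real (Suc j))"
    proof -
      have "cmod (w j) \<le> cmod (of_real x0) + cmod (\<i> * of_real (inverse (real (Suc j))))"
        unfolding w_def by (rule norm_triangle_ineq)
      also have "\<dots> = \<bar>x0\<bar> + inverse (real (Suc j))"
        by (simp only: norm_mult norm_ii norm_of_real mult_1_left) simp
      finally show ?thesis .
    qed
    moreover have "\<bar>x0\<bar> \<le> 1" using subsetD[OF K(3) x0] by auto
    moreover have "inverse (real (Suc j)) \<le> 1" by (simp add: field_simps)
    ultimately have "cmod (w j) < 3" by linarith
    moreover have "Im (w j) \<noteq> 0" by (simp add: w_def)
    then have "w j \<notin> cset K" by auto
    ultimately show ?thesis by simp
  qed
  have wlim: "w \<longlonglongrightarrow> of_real x0"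
  proof -
    have "(\<lambda>j. of_real x0 + \<i> * complex_of_real (inverse (real (Suc j)))) \<longlonglongrightarrow> of_real x0 + \<i> * of_real 0"
      by (intro tendsto_intros LIMSEQ_inverse_real_of_nat)
    then show ?thesis by (simp add: w_def[abs_def])
  qed
  have ulim0: "(\<lambda>j. u (w j)) \<longlonglongrightarrow> 0"
    using continuous_on_tendsto_compose[OF u(1) wlim] u(3)[OF x0] by simp
  have pot: "ennreal (H - C * u (w j)) \<le> potential M x0" for j
  proof -
    have wj: "w j \<notin> cset K" using wK by blast
    obtain c where c: "c > 0" "\<And>t. t \<in> K \<Longrightarrow> c \<le> cmod (w j - of_real t)" using cset_dist[OF clK wj] by blast
    interpret prob_space M using M by (rule prob_on_prob_space)
    note int = logpot_bounds(1)[OF M clK K(3) c]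
    let ?g = "\<lambda>t. 4 - ln 2 - ln (cmod (w j - of_real t))"
    have "ennreal (H - C * u (w j)) \<le> ennreal (4 - ln 2 - logpot M (w j))"
      using bound[OF wK] by (intro ennreal_leI) (auto simp: algebra_simps)
    also have "4 - ln 2 - logpot M (w j) = integral\<^sup>L M ?g"
      unfolding logpot_def using int by (simp add: prob_space)
    also have "ennreal (integral\<^sup>L M ?g) \<le> (\<integral>\<^sup>+ t. ennreal (?g t) \<partial>M)"
    proof -
      have "ennreal (integral\<^sup>L M ?g) \<le> ennreal (\<integral>t. max 0 (?g t) \<partial>M)"
        using int by (intro ennreal_leI integral_mono) auto
      also have "\<dots> = (\<integral>\<^sup>+ t. ennreal (max 0 (?g t)) \<partial>M)"
        using int by (intro nn_integral_eq_integral[symmetric]) auto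
      finally show ?thesis by simp
    qed
    also have "\<dots> \<le> potential M x0" unfolding potential_def
    proof (rule nn_integral_mono)
      fix t
      show "ennreal (?g t) \<le> kernel x0 t"
      proof (cases "x0 = t")
        case False
        have "\<bar>x0 - t\<bar> = \<bar>Re (w j - of_real t)\<bar>" by (simp add: w_def)
        also have "\<dots> \<le> cmod (w j - of_real t)" by (rule abs_Re_le_cmod)
        finally have "ln \<bar>x0 - t\<bar> \<le> ln (cmod (w j - of_real t))" using False by (intro ln_mono) auto
        moreover have "ln (2 * \<bar>x0 - t\<bar>) = ln 2 + ln \<bar>x0 - t\<bar>" using False by (simp add: ln_mult)
        ultimately show ?thesis using False by (auto simp: kernel_def intro!: ennreal_leI)
      qed (simp add: kernel_def)
    qed
    finally show ?thesis .
  qed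
  show ?thesis
  proof (rule LIMSEQ_le_const2)
    have "(\<lambda>j. H - C * u (w j)) \<longlonglongrightarrow> H - C * 0" by (intro tendsto_intros ulim0)
    then show "(\<lambda>j. ennreal (H - C * u (w j))) \<longlonglongrightarrow> ennreal H" by (intro tendsto_ennrealI) simp
  qed (use pot in blast)
qed

end

section \<open>The equilibrium potential\<close>

text \<open>Tangent of ln at the mean X: ln s <= s - 1 at s = A/X and s = B/X, strictly at A/X
  because A differs from X.\<close>

lemma strict_concave_ln:
  fixes A B l :: real
  assumes "0 < A" "0 < B" "A \<noteq> B" "0 < l" "l < 1"
  shows "(1 - l) * ln A + l * ln B < ln ((1 - l) * A + l * B)"
proof -
  define X where "X = (1 - l) * A + l * B"
  have X: "0 < X" using assms by (auto simp: X_def intro!: add_pos_pos mult_pos_pos)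
  have ne: "A \<noteq> X"
  proof
    assume "A = X"
    then have "l * (B - A) = 0" by (auto simp: X_def algebra_simps)
    then show False using assms by auto
  qed
  have "ln (A / X) < A / X - 1"
    using ln_le_minus_one[of "A / X"] ln_eq_minus_one[of "A / X"] ne X assms by fastforce
  then have "(1 - l) * ln (A / X) < (1 - l) * (A / X - 1)" using assms by (intro mult_strict_left_mono) auto
  moreover have "l * ln (B / X) \<le> l * (B / X - 1)"
    using ln_le_minus_one[of "B / X"] X assms by (intro mult_left_mono) auto
  moreover have "(1 - l) * (A / X - 1) + l * (B / X - 1) = 0"
  proof -
    have "(1 - l) * (A / X - 1) + l * (B / X - 1) = ((1 - l) * A + l * B) / X - 1"
      by (simp add: add_divide_distrib diff_divide_distrib algebra_simps)
    then show ?thesis using X by (simp add: X_def[symmetric])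
  qed
  ultimately have "(1 - l) * ln (A / X) + l * ln (B / X) < 0" by linarith
  then have "(1 - l) * (ln A - ln X) + l * (ln B - ln X) < 0" using X assms by (simp add: ln_div)
  then show ?thesis unfolding X_def[symmetric] by (simp add: algebra_simps)
qed

lemma cmod_of_real_diff: "cmod (complex_of_real x - complex_of_real t) = \<bar>x - t\<bar>"
  by (simp flip: of_real_diff)

lemma logpot_of_real: "logpot M (of_real x) = (\<integral>t. ln \<bar>x - t\<bar> \<partial>M)"
  unfolding logpot_def cmod_of_real_diff ..

text \<open>On a bounded gap the potential is strictly concave, beyond the extreme points it is monotone.\<close>

lemma logpot_gt_off:
  fixes z :: complex
  assumes S: "compact S" "S \<noteq> {}" "S \<subseteq> {-1..1}" and M: "prob_on S M"
    and at: "\<And>x. x \<in> S \<Longrightarrow> AE t in M. t \<noteq> x"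
    and int: "\<And>x. x \<in> S \<Longrightarrow> integrable M (\<lambda>t. ln \<bar>x - t\<bar>)"
    and V: "\<And>x. x \<in> S \<Longrightarrow> logpot M (of_real x) = V"
  shows "integrable M (\<lambda>t. ln (cmod (z - of_real t)))"
    and "AE t in M. z \<noteq> of_real t"
    and "z \<notin> cset S \<Longrightarrow> V < logpot M z"
proof -
  have cl: "closed S" using S(1) by (rule compact_imp_closed)
  interpret prob_space M using M by (rule prob_on_prob_space)
  have space: "emeasure M (space M) \<noteq> 0" by (simp add: emeasure_space_1)
  have AES: "AE t in M. t \<in> S" by (rule prob_on_AE[OF M cl])
  have intall: "integrable M (\<lambda>t. ln (cmod (z - of_real t)))" for z :: complex
  proof (cases "z \<in> cset S")
    case True
    then show ?thesis using int by (auto simp: cmod_of_real_diff)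
  next
    case False
    obtain c where c: "c > 0" "\<And>t. t \<in> S \<Longrightarrow> c \<le> cmod (z - of_real t)" using cset_dist[OF cl False] by blast
    show ?thesis by (rule logpot_bounds(1)[OF M cl S(3) c])
  qed
  then show "integrable M (\<lambda>t. ln (cmod (z - of_real t)))" .
  have atall: "AE t in M. z \<noteq> of_real t" for z :: complex
  proof (cases "z \<in> cset S")
    case True
    then obtain x where x: "x \<in> S" "z = of_real x" by blast
    show ?thesis using at[OF x(1)] by eventually_elim (auto simp: x(2))
  qed (rule prob_on_AE_ne[OF M cl])
  then show "AE t in M. z \<noteq> of_real t" .
  have less: "logpot M y < logpot M y'" if "AE t in M. ln (cmod (y - of_real t)) < ln (cmod (y' - of_real t))" for y y'
    unfolding logpot_def by (rule integral_less_AE_space[OF intall intall that space])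
  have real: "V < logpot M (of_real x)" if x: "x \<notin> S" for x
  proof (cases "(\<exists>t\<in>S. t < x) \<and> (\<exists>t\<in>S. x < t)")
    case True
    have ca: "compact (S \<inter> {..x})" "compact (S \<inter> {x..})" using S(1) by (auto intro: compact_Int_closed)
    have ne: "S \<inter> {..x} \<noteq> {}" "S \<inter> {x..} \<noteq> {}" using True by auto
    obtain a where a: "a \<in> S" "a \<le> x" "\<And>t. t \<in> S \<Longrightarrow> t \<le> x \<Longrightarrow> t \<le> a"
      using compact_attains_sup[OF ca(1) ne(1)] by auto
    obtain b where b: "b \<in> S" "x \<le> b" "\<And>t. t \<in> S \<Longrightarrow> x \<le> t \<Longrightarrow> b \<le> t"
      using compact_attains_inf[OF ca(2) ne(2)] by auto
    have ax: "a < x" "x < b" using a(1,2) b(1,2) x by (metis order_le_less)+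
    define l where "l = (x - a) / (b - a)"
    have l: "0 < l" "l < 1" using ax by (auto simp: l_def)
    have xl: "x = (1 - l) * a + l * b"
    proof -
      have "l * (b - a) = x - a" using ax by (simp add: l_def)
      then show ?thesis by (simp add: algebra_simps)
    qed
    have ia: "integrable M (\<lambda>t. ln \<bar>a - t\<bar>)" "integrable M (\<lambda>t. ln \<bar>b - t\<bar>)" using int a(1) b(1) by auto
    \<comment> \<open>No point of S lies strictly between a and b. So for almost every t the
      distance to t is affine on [a,b] with distinct positive end values, and concavity applies
      pointwise.\<close>
    have "(\<integral>t. (1 - l) * ln \<bar>a - t\<bar> + l * ln \<bar>b - t\<bar> \<partial>M) < (\<integral>t. ln \<bar>x - t\<bar> \<partial>M)"
    proof (rule integral_less_AE_space)
      show "integrable M (\<lambda>t. (1 - l) * ln \<bar>a - t\<bar> + l * ln \<bar>b - t\<bar>)" using ia by auto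
      show "integrable M (\<lambda>t. ln \<bar>x - t\<bar>)" using intall[of "of_real x"] by (simp only: cmod_of_real_diff)
      show "AE t in M. (1 - l) * ln \<bar>a - t\<bar> + l * ln \<bar>b - t\<bar> < ln \<bar>x - t\<bar>"
        using AES at[OF a(1)] at[OF b(1)]
      proof eventually_elim
        fix t assume t: "t \<in> S" "t \<noteq> a" "t \<noteq> b"
        have "t < a \<or> b < t"
        proof (cases "t \<le> x")
          case True
          then show ?thesis using a(3)[OF t(1)] t(2) by auto
        next
          case False
          then show ?thesis using b(3)[OF t(1)] t(3) by auto
        qed
        then show "(1 - l) * ln \<bar>a - t\<bar> + l * ln \<bar>b - t\<bar> < ln \<bar>x - t\<bar>"
        proof
          assume t: "t < a"
          have "\<bar>x - t\<bar> = (1 - l) * \<bar>a - t\<bar> + l * \<bar>b - t\<bar>"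
            using t ax xl by (simp add: algebra_simps)
          then show ?thesis using strict_concave_ln[of "\<bar>a - t\<bar>" "\<bar>b - t\<bar>" l] t ax l by simp
        next
          assume t: "b < t"
          have "\<bar>x - t\<bar> = (1 - l) * \<bar>a - t\<bar> + l * \<bar>b - t\<bar>"
            using t ax xl by (simp add: algebra_simps)
          then show ?thesis using strict_concave_ln[of "\<bar>a - t\<bar>" "\<bar>b - t\<bar>" l] t ax l by simp
        qed
      qed
      show "emeasure M (space M) \<noteq> 0" by (rule space)
    qed
    moreover have "(\<integral>t. (1 - l) * ln \<bar>a - t\<bar> + l * ln \<bar>b - t\<bar> \<partial>M) = (1 - l) * V + l * V"
      using V[OF a(1)] V[OF b(1)] ia by (simp add: logpot_of_real)
    ultimately show ?thesis by (simp add: logpot_of_real algebra_simps)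
  next
    case False
    then consider "\<And>t. t \<in> S \<Longrightarrow> t < x" | "\<And>t. t \<in> S \<Longrightarrow> x < t" using x by (metis linorder_neqE)
    then show ?thesis
    proof cases
      case 1
      obtain m where m: "m \<in> S" "\<And>t. t \<in> S \<Longrightarrow> t \<le> m" using compact_attains_sup[OF S(1,2)] by blast
      have "logpot M (of_real m) < logpot M (of_real x)"
      proof (rule less)
        show "AE t in M. ln (cmod (of_real m - of_real t)) < ln (cmod (of_real x - of_real t))"
          using AES at[OF m(1)]
        proof eventually_elim
          fix t assume "t \<in> S" "t \<noteq> m"
          then have "t < m" "m < x" using m 1 by fastforce+
          then show "ln (cmod (of_real m - of_real t)) < ln (cmod (of_real x - of_real t))"
            unfolding cmod_of_real_diff by (intro ln_less_cancel_iff[THEN iffD2]) auto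
        qed
      qed
      then show ?thesis using V[OF m(1)] by simp
    next
      case 2
      obtain m where m: "m \<in> S" "\<And>t. t \<in> S \<Longrightarrow> m \<le> t" using compact_attains_inf[OF S(1,2)] by blast
      have "logpot M (of_real m) < logpot M (of_real x)"
      proof (rule less)
        show "AE t in M. ln (cmod (of_real m - of_real t)) < ln (cmod (of_real x - of_real t))"
          using AES at[OF m(1)]
        proof eventually_elim
          fix t assume "t \<in> S" "t \<noteq> m"
          then have "m < t" "x < m" using m 2 by fastforce+
          then show "ln (cmod (of_real m - of_real t)) < ln (cmod (of_real x - of_real t))"
            unfolding cmod_of_real_diff by (intro ln_less_cancel_iff[THEN iffD2]) auto
        qed
      qed
      then show ?thesis using V[OF m(1)] by simp
    qed
  qed
  assume z: "z \<notin> cset S"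
  show "V < logpot M z"
  proof (cases "Im z = 0")
    case True
    then have "z = of_real (Re z)" by (simp add: complex_eq_iff)
    then show ?thesis using real[of "Re z"] z by (metis imageI)
  next
    case False
    \<comment> \<open>Leaving the real axis vertically strictly increases the distance to every real
      t.\<close>
    have "logpot M (of_real (Re z)) < logpot M z"
    proof (rule less)
      show "AE t in M. ln (cmod (of_real (Re z) - of_real t)) < ln (cmod (z - of_real t))"
        using atall[of "of_real (Re z)"]
      proof eventually_elim
        fix t assume t: "complex_of_real (Re z) \<noteq> of_real t"
        have "(cmod (of_real (Re z) - of_real t))\<^sup>2 < (cmod (z - of_real t))\<^sup>2"
          using False unfolding cmod_power2 by simp
        then have "cmod (of_real (Re z) - of_real t) < cmod (z - of_real t)" by (rule power2_less_imp_less) simp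
        then show "ln (cmod (of_real (Re z) - of_real t)) < ln (cmod (z - of_real t))"
          using t by (intro ln_less_cancel_iff[THEN iffD2]) auto
      qed
    qed
    moreover have "V \<le> logpot M (of_real (Re z))" using real[of "Re z"] V[of "Re z"] by (cases "Re z \<in> S") auto
    ultimately show ?thesis by simp
  qed
qed

text \<open>A finite potential excludes an atom at x, as the kernel is infinite on the diagonal.
  This turns the nonnegative integral into a Bochner integral of ln|x-t|.\<close>

lemma potential_finite:
  assumes M: "prob_on {-1..1} M" and x: "x \<in> {-1..1}" and h: "potential M x = ennreal h" "0 \<le> h"
  shows "AE t in M. t \<noteq> x" "integrable M (\<lambda>t. ln \<bar>x - t\<bar>)" "logpot M (of_real x) = 4 - ln 2 - h"
proof -
  interpret prob_space M using M by (rule prob_on_prob_space)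
  have AE1: "AE t in M. t \<in> {-1..1}" by (rule prob_on_AE[OF M]) simp
  have "(\<integral>\<^sup>+ t. kernel x t \<partial>M) \<noteq> \<infinity>" using h by (simp add: potential_def)
  then have "AE t in M. kernel x t \<noteq> \<infinity>"
    by (intro nn_integral_PInf_AE prob_on_measurable[OF M]) (auto simp: less_top)
  then show ne: "AE t in M. t \<noteq> x" by eventually_elim (auto simp: kernel_def)
  let ?g = "\<lambda>t. 4 - ln (2 * \<bar>x - t\<bar>)"
  have meas: "?g \<in> borel_measurable M" by (rule prob_on_measurable[OF M]) measurable
  have nn: "AE t in M. 0 \<le> ?g t" using AE1 by eventually_elim (rule kernel_nonneg[OF x])
  have eq: "(\<integral>\<^sup>+ t. ennreal (?g t) \<partial>M) = ennreal h"
    unfolding h(1)[symmetric] potential_def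
    by (rule nn_integral_cong_AE, use ne in eventually_elim, auto simp: kernel_def)
  have int: "integrable M ?g" by (rule integrableI_nn_integral_finite[OF meas nn eq])
  have val: "(\<integral>t. ?g t \<partial>M) = h"
    using nn_integral_eq_integral[OF int nn] eq h(2) integral_nonneg_AE[OF nn] by simp
  have lnAE: "AE t in M. 4 - ln 2 - ?g t = ln \<bar>x - t\<bar>" using ne by eventually_elim (simp add: ln_mult)
  have meas2: "(\<lambda>t. ln \<bar>x - t\<bar>) \<in> borel_measurable M" by (rule prob_on_measurable[OF M]) measurable
  have int2: "integrable M (\<lambda>t. 4 - ln 2 - ?g t)"
    by (rule Bochner_Integration.integrable_diff[OF integrable_const int])
  show "integrable M (\<lambda>t. ln \<bar>x - t\<bar>)"
    by (rule integrable_cong_AE_imp[OF int2 meas2]) (use lnAE in \<open>auto elim: eventually_mono\<close>)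
  have "logpot M (of_real x) = (\<integral>t. 4 - ln 2 - ?g t \<partial>M)" unfolding logpot_of_real
    by (rule integral_cong_AE[OF meas2 borel_measurable_integrable[OF int2]]) (use lnAE in \<open>auto elim: eventually_mono\<close>)
  also have "\<dots> = (\<integral>t. 4 - ln 2 \<partial>M) - (\<integral>t. ?g t \<partial>M)" using int by (intro Bochner_Integration.integral_diff) auto
  finally show "logpot M (of_real x) = 4 - ln 2 - h" using val by (simp add: prob_space)
qed

text \<open>The closed support carries full mass: its complement within K is covered by the
  countably many null intervals with rational endpoints.\<close>

lemma prob_on_support:
  fixes M :: "real measure"
  assumes M: "prob_on K M" and K: "compact K"
  defines "S \<equiv> {x\<in>K. \<forall>d>0. emeasure M {x-d<..<x+d} \<noteq> 0}"
  shows "compact S" "S \<noteq> {}" "prob_on S M"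
proof -
  interpret prob_space M using M by (rule prob_on_prob_space)
  have cl: "closed K" using K by (rule compact_imp_closed)
  have sets: "sets M = sets borel" using M by (rule prob_on_sets)
  have "closed S" unfolding closed_sequential_limits
  proof (intro allI impI, elim conjE)
    fix f l assume f: "\<forall>n. f n \<in> S" and l: "f \<longlonglongrightarrow> l"
    have "l \<in> K" using closed_sequentially[OF cl _ l] f by (auto simp: S_def)
    moreover have "emeasure M {l-d<..<l+d} \<noteq> 0" if d: "d > 0" for d
    proof
      assume 0: "emeasure M {l-d<..<l+d} = 0"
      obtain n where n: "dist (f n) l < d / 2" using l d unfolding lim_sequentially by (meson half_gt_zero order_refl)
      have "emeasure M {f n - d/2<..<f n + d/2} \<le> emeasure M {l-d<..<l+d}"
      proof (rule emeasure_mono)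
        have "f n - l < d / 2" "l - f n < d / 2" using n unfolding dist_real_def abs_less_iff by linarith+
        then show "{f n - d/2<..<f n + d/2} \<subseteq> {l-d<..<l+d}"
          unfolding subset_iff greaterThanLessThan_iff by (intro allI impI conjI; elim conjE; linarith)
      qed (simp add: sets)
      then have "emeasure M {f n - d/2<..<f n + d/2} = 0" using 0 by simp
      moreover have "emeasure M {f n - d/2<..<f n + d/2} \<noteq> 0"
        using f d unfolding S_def by (auto dest: spec[of _ n])
      ultimately show False by simp
    qed
    ultimately show "l \<in> S" by (simp add: S_def)
  qed
  then have "compact (K \<inter> S)" using K by (rule compact_Int_closed[rotated])
  moreover have "K \<inter> S = S" by (auto simp: S_def)
  ultimately show comp: "compact S" by simp
  have null: "AE t in M. \<forall>p\<in>\<rat>. \<forall>q\<in>\<rat>. emeasure M {p<..<q} = 0 \<longrightarrow> t \<notin> {p<..<q}"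
  proof (intro AE_ball_countable[THEN iffD2] ballI countable_rat)
    fix p q :: real
    show "AE t in M. emeasure M {p<..<q} = 0 \<longrightarrow> t \<notin> {p<..<q}"
    proof (cases "emeasure M {p<..<q} = 0")
      case True
      then have "{p<..<q} \<in> null_sets M" by (simp add: null_sets_def sets)
      then show ?thesis using AE_not_in by fastforce
    qed simp
  qed
  have AES: "AE t in M. t \<in> S" using null prob_on_AE[OF M cl]
  proof eventually_elim
    fix t assume t: "\<forall>p\<in>\<rat>. \<forall>q\<in>\<rat>. emeasure M {p<..<q} = 0 \<longrightarrow> t \<notin> {p<..<q}" "t \<in> K"
    have "emeasure M {t-d<..<t+d} \<noteq> 0" if d: "d > 0" for d
    proof
      assume 0: "emeasure M {t-d<..<t+d} = 0"
      obtain p where p: "p \<in> \<rat>" "t - d < p" "p < t" using Rats_dense_in_real[of "t - d" t] d by auto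
      obtain q where q: "q \<in> \<rat>" "t < q" "q < t + d" using Rats_dense_in_real[of t "t + d"] d by auto
      have "emeasure M {p<..<q} \<le> emeasure M {t-d<..<t+d}"
        using p q by (intro emeasure_mono) (auto simp: sets)
      then show False using t(1) p q 0 by auto
    qed
    then show "t \<in> S" using t(2) by (simp add: S_def)
  qed
  have clS: "closed S" using comp by (rule compact_imp_closed)
  then have "emeasure M (UNIV - S) = 0"
    using AES prob_on_space[OF M] sets
    by (subst (asm) AE_iff_measurable[of "UNIV - S"]) (auto simp: borel_closed sets.Diff)
  then show "prob_on S M" using M by (simp add: prob_on_def)
  show "S \<noteq> {}"
  proof
    assume "S = {}"
    then have "emeasure M UNIV = 0" using \<open>emeasure M (UNIV - S) = 0\<close> by simp
    then show False using M by (simp add: prob_on_def)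
  qed
qed

text \<open>What the polynomial part uses of mu_K: \<open>on\<close> holds without an exceptional
  set, the strictness of \<open>off\<close> detects a zero outside K, and \<open>supp\<close> turns
  almost-everywhere statements about continuous functions into statements on all of K.\<close>

locale log_equilibrium =
  fixes K :: "real set" and M :: "real measure" and V :: real
  assumes compact: "compact K" and sub: "K \<subseteq> {-1..1}" and prob: "prob_on K M"
    and int_ln: "\<And>z. integrable M (\<lambda>t. ln (cmod (z - of_real t)))"
    and ne: "\<And>z. AE t in M. z \<noteq> complex_of_real t"
    and on: "\<And>x. x \<in> K \<Longrightarrow> logpot M (of_real x) = V"
    and off: "\<And>z. z \<notin> cset K \<Longrightarrow> V < logpot M z"
    and supp: "\<And>x d. x \<in> K \<Longrightarrow> d > 0 \<Longrightarrow> emeasure M {x-d<..<x+d} \<noteq> 0"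

text \<open>The lower bound H for the potential on K equals its mean under M, so the bound is
  attained almost everywhere; lower semicontinuity extends equality to the support, where the gap
  argument starts.\<close>

theorem regular_log_equilibrium:
  assumes reg: "dirichlet_regular (cset K)" and sub: "K \<subseteq> {-1..1}" and ab: "a \<in> K" "b \<in> K" "a \<noteq> b"
  obtains V where "log_equilibrium K (equilibrium_measure K) V" "log_capacity K = exp V"
proof -
  have "compact (cset K)" using reg by (simp add: dirichlet_regular_def)
  then have "compact (Re ` cset K)" by (rule compact_continuous_image[rotated]) (intro continuous_intros)
  then have comp: "compact K" by (simp add: image_image)
  have cl: "closed K" using comp by (rule compact_imp_closed)
  have K: "compact K" "K \<noteq> {}" "K \<subseteq> {-1..1}" using comp ab(1) sub by auto
  obtain B where B: "\<And>n. reg_val K n \<le> B" using reg_val_bounded[OF K reg ab] by blast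
  obtain s M H where s: "strict_mono (s :: nat \<Rightarrow> nat)" and M: "prob_on K M"
    and lim: "weak_lim (\<lambda>j. reg_min K (s j)) M" and H0: "0 \<le> H" and H: "reg_val K \<longlonglongrightarrow> H" "\<And>n. reg_val K n \<le> H"
    and E: "energy M M = ennreal H" and min: "\<And>N. prob_on K N \<Longrightarrow> ennreal H \<le> energy N N"
    using energy_minimizer_exists[OF K B] by blast
  have \<mu>: "equilibrium_measure K = M" "log_capacity K = exp (4 - ln 2 - H)"
    using equilibrium_facts[OF K(1,3) M E H0 min] by auto
  define V where "V = 4 - ln 2 - H"
  have ge: "ennreal H \<le> potential M x" if "x \<in> K" for x
    by (rule equilibrium_potential_ge[OF K reg ab M s lim H H0 that])
  interpret prob_space M using M by (rule prob_on_prob_space)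
  have M1: "prob_on {-1..1} M" by (rule prob_on_sub_interval[OF M K(1,3)])
  have AEK: "AE t in M. t \<in> K" by (rule prob_on_AE[OF M cl])
  \<comment> \<open>The energy H is the M-mean of the potential, which is >= H on K; a nonnegative
    function with integral 0 vanishes almost everywhere.\<close>
  have eqAE: "AE x in M. potential M x = ennreal H"
  proof -
    have mp: "potential M \<in> borel_measurable M"
    proof -
      note [measurable_cong] = prob_on_sets[OF M]
      show ?thesis unfolding potential_def by measurable
    qed
    have geAE: "AE x in M. ennreal H \<le> potential M x" using AEK by eventually_elim (rule ge)
    have "(\<integral>\<^sup>+ x. potential M x - ennreal H \<partial>M) = (\<integral>\<^sup>+ x. potential M x \<partial>M) - (\<integral>\<^sup>+ x. ennreal H \<partial>M)"
      using mp geAE by (intro nn_integral_diff) (auto simp: emeasure_space_1)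
    also have "\<dots> = 0" using E by (simp add: energy_def emeasure_space_1)
    finally have "AE x in M. potential M x - ennreal H = 0"
      using mp by (subst (asm) nn_integral_0_iff_AE) auto
    then show ?thesis using geAE
      by eventually_elim (auto simp: diff_eq_0_iff_ennreal intro: antisym)
  qed
  define S where "S = {x\<in>K. \<forall>d>0. emeasure M {x-d<..<x+d} \<noteq> 0}"
  note supp = prob_on_support[OF M comp, folded S_def]
  have SK: "S \<subseteq> K" by (auto simp: S_def)
  have potS: "potential M x = ennreal H" if x: "x \<in> S" for x
  proof (rule ccontr)
    assume "potential M x \<noteq> ennreal H"
    then have lt: "ennreal H < potential M x" using ge[of x] x SK by (simp add: subset_iff)
    have x1: "x \<in> {-1..1}" using x SK K(3) by blast
    from potential_lsc[OF M cl K(3) x1 lt H0] obtain d where d: "d > 0"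
      "\<And>y. y \<in> {-1..1} \<Longrightarrow> \<bar>y - x\<bar> < d \<Longrightarrow> ennreal H < potential M y" by blast
    have "AE t in M. t \<notin> {x-d<..<x+d}" using eqAE AEK
    proof eventually_elim
      fix t assume t: "potential M t = ennreal H" "t \<in> K"
      show "t \<notin> {x-d<..<x+d}" using d(2)[of t] t K(3) by (auto simp: abs_less_iff subset_iff)
    qed
    then have "emeasure M {x-d<..<x+d} = 0"
      using prob_on_space[OF M] prob_on_sets[OF M]
      by (subst (asm) AE_iff_measurable[of "{x-d<..<x+d}"]) auto
    then show False using x d(1) by (auto simp: S_def)
  qed
  have S1: "S \<subseteq> {-1..1}" using SK K(3) by blast
  note fin = potential_finite[OF M1 _ potS H0]
  have f1: "AE t in M. t \<noteq> x" "integrable M (\<lambda>t. ln \<bar>x - t\<bar>)" "logpot M (of_real x) = V" if "x \<in> S" for x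
    using fin[OF subsetD[OF S1 that] that] by (auto simp: V_def)
  note off = logpot_gt_off[OF supp(1,2) S1 supp(3) f1]
  \<comment> \<open>A point of K off the support would have U > V by concavity or monotonicity,
    while the barrier bound gives U <= V on all of K.\<close>
  have "K \<subseteq> S"
  proof
    fix x assume x: "x \<in> K"
    show "x \<in> S"
    proof (rule ccontr)
      assume "x \<notin> S"
      then have gt: "V < logpot M (of_real x)" by (intro off) auto
      have x1: "x \<in> {-1..1}" using x K(3) by blast
      have ne: "AE t in M. complex_of_real x \<noteq> of_real t" by (rule off)
      have int: "integrable M (\<lambda>t. ln \<bar>x - t\<bar>)" using off(1)[of "of_real x"] by (simp only: cmod_of_real_diff)
      have nn: "AE t in M. 0 \<le> 4 - ln 2 - ln \<bar>x - t\<bar>" using AEK ne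
      proof eventually_elim
        fix t assume "t \<in> K" "complex_of_real x \<noteq> of_real t"
        then show "0 \<le> 4 - ln 2 - ln \<bar>x - t\<bar>"
          using kernel_nonneg[OF x1, of t] subsetD[OF K(3), of t] by (simp add: ln_mult)
      qed
      have "potential M x = (\<integral>\<^sup>+ t. ennreal (4 - ln 2 - ln \<bar>x - t\<bar>) \<partial>M)" unfolding potential_def
        by (rule nn_integral_cong_AE, use ne in eventually_elim, auto simp: kernel_def ln_mult algebra_simps)
      also have "\<dots> = ennreal (\<integral>t. 4 - ln 2 - ln \<bar>x - t\<bar> \<partial>M)"
        using int by (intro nn_integral_eq_integral nn) simp
      also have val: "(\<integral>t. 4 - ln 2 - ln \<bar>x - t\<bar> \<partial>M) = 4 - ln 2 - logpot M (of_real x)"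
        using int by (simp add: logpot_of_real prob_space)
      finally have "ennreal H \<le> ennreal (4 - ln 2 - logpot M (of_real x))" using ge[OF x] by simp
      moreover have "0 \<le> 4 - ln 2 - logpot M (of_real x)" using integral_nonneg_AE[OF nn] unfolding val .
      ultimately have "H \<le> 4 - ln 2 - logpot M (of_real x)" by (simp add: ennreal_le_iff)
      then show False using gt by (simp add: V_def)
    qed
  qed
  then have KS: "K = S" using SK by blast
  have "log_equilibrium K M V"
  proof
    show "compact K" "K \<subseteq> {-1..1}" "prob_on K M" by fact+
    show "integrable M (\<lambda>t. ln (cmod (z - of_real t)))" for z by (rule off)
    show "AE t in M. z \<noteq> of_real t" for z :: complex by (rule off)
    show "logpot M (of_real x) = V" if "x \<in> K" for x using f1(3) that KS by simp
    show "V < logpot M z" if "z \<notin> cset K" for z using off(3) that KS by simp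
    show "emeasure M {x-d<..<x+d} \<noteq> 0" if "x \<in> K" "d > 0" for x d
      using subsetD[OF \<open>K \<subseteq> S\<close> that(1)] that(2) unfolding S_def by blast
  qed
  moreover have "log_capacity K = exp V" using \<mu>(2) by (simp add: V_def)
  ultimately show thesis using that[of V] \<mu>(1) by simp
qed

section \<open>The arcsine and Marchenko-Pastur laws\<close>

definition arcsine :: "real measure" where
  "arcsine = distr (density lborel (\<lambda>t. ennreal (indicator {0..pi} t / pi))) borel cos"

text \<open>Its Lebesgue density is sqrt((1-y)/(1+y))/pi on (-1,1); the substitution t = 2c(1+y)
  gives the Marchenko-Pastur law of ratio 1 on [0,4c].\<close>

definition marchenko_pastur :: "real measure" where
  "marchenko_pastur = density arcsine (\<lambda>y. ennreal (1 - y))"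

lemma integral_cos_0_pi:
  "has_bochner_integral lborel (\<lambda>t. cos (real k * t) * indicator {0..pi} t) (if k = 0 then pi else 0)"
proof (cases "k = 0")
  case True
  have "has_bochner_integral lborel (\<lambda>t. 1 * indicator {0..pi} t :: real) (pi - 0)"
    by (rule has_bochner_integral_FTC_Icc_real) (auto intro!: derivative_eq_intros)
  then show ?thesis using True by simp
next
  case False
  have "has_bochner_integral lborel (\<lambda>t. cos (real k * t) * indicator {0..pi} t :: real)
     (sin (real k * pi) / real k - sin (real k * 0) / real k)"
    by (rule has_bochner_integral_FTC_Icc_real) (use False in \<open>auto intro!: derivative_eq_intros continuous_intros\<close>)
  then show ?thesis using False by simp
qed

lemma nn_integral_arcsine:
  "f \<in> borel_measurable borel \<Longrightarrow>
    (\<integral>\<^sup>+ y. f y \<partial>arcsine) = (\<integral>\<^sup>+ t. ennreal (indicator {0..pi} t / pi) * f (cos t) \<partial>lborel)"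
  unfolding arcsine_def by (subst nn_integral_distr) (auto simp: nn_integral_density)

lemma AE_arcsine:
  assumes "Measurable.pred borel P"
  shows "(AE y in arcsine. P y) \<longleftrightarrow> (AE t in lborel. t \<in> {0..pi} \<longrightarrow> P (cos t))"
proof -
  have "(AE y in arcsine. P y) \<longleftrightarrow> (AE t in density lborel (\<lambda>t. ennreal (indicator {0..pi} t / pi)). P (cos t))"
    unfolding arcsine_def using assms by (subst AE_distr_iff) auto
  also have "\<dots> \<longleftrightarrow> (AE t in lborel. 0 < ennreal (indicator {0..pi} t / pi) \<longrightarrow> P (cos t))"
    by (subst AE_density) auto
  also have "(\<lambda>t. 0 < ennreal (indicator {0..pi} t / pi) \<longrightarrow> P (cos t)) = (\<lambda>t. t \<in> {0..pi} \<longrightarrow> P (cos t))"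
    by (rule ext) (auto simp: indicator_def)
  finally show ?thesis .
qed

lemma cheb_moment_arcsine: "cheb_moment arcsine k = (if k = 0 then 1 else 0)"
proof -
  have "cheb_moment arcsine k = (\<integral>t. (indicator {0..pi} t / pi) * cheb k (cos t) \<partial>lborel)"
    unfolding arcsine_def by (subst integral_distr) (auto simp: integral_real_density)
  also have "\<dots> = (\<integral>t. (cos (real k * t) * indicator {0..pi} t) / pi \<partial>lborel)"
    by (intro Bochner_Integration.integral_cong refl) (auto simp: indicator_def cheb_cos)
  also have "\<dots> = (if k = 0 then pi else 0) / pi"
    using has_bochner_integral_integral_eq[OF integral_cos_0_pi[of k]] by simp
  finally show ?thesis by simp
qed

lemma prob_on_arcsine: "prob_on {-1..1} arcsine"
proof -
  have sets: "sets arcsine = sets borel" by (simp add: arcsine_def)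
  have "emeasure arcsine UNIV = (\<integral>\<^sup>+ y. 1 \<partial>arcsine)" using sets_eq_imp_space_eq[OF sets] by simp
  also have "\<dots> = (\<integral>\<^sup>+ t. ennreal (indicator {0..pi} t / pi) \<partial>lborel)"
    by (subst nn_integral_arcsine) auto
  also have "\<dots> = ennreal (\<integral>t. indicator {0..pi} t / pi \<partial>lborel)"
    using integrable.intros[OF integral_cos_0_pi[of 0]]
    by (intro nn_integral_eq_integral) auto
  also have "(\<integral>t. indicator {0..pi} t / pi \<partial>lborel) = 1"
    using has_bochner_integral_integral_eq[OF integral_cos_0_pi[of 0]] by simp
  finally have 1: "emeasure arcsine UNIV = 1" by simp
  have "AE y in arcsine. y \<in> {-1..1}" by (subst AE_arcsine) auto
  then have "emeasure arcsine (UNIV - {-1..1}) = 0"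
    using sets_eq_imp_space_eq[OF sets] sets by (subst (asm) AE_iff_measurable[of "UNIV - {-1..1}"]) auto
  then show ?thesis using sets 1 by (simp add: prob_on_def)
qed

lemma marchenko_pastur_facts:
  shows "prob_on {-1..1} marchenko_pastur"
    and "cheb_moment marchenko_pastur k = (if k = 0 then 1 else if k = 1 then - 1/2 else 0)"
proof -
  note A = prob_on_arcsine
  note [measurable_cong] = prob_on_sets[OF A]
  interpret A: prob_space arcsine using A by (rule prob_on_prob_space)
  have AE: "AE y in arcsine. y \<in> {-1..1}" by (rule prob_on_AE[OF A]) simp
  have int: "integrable arcsine (cheb k)" for k
    using abs_cheb_le by (intro prob_on_integrable[OF A, where B=1]) auto
  have mom: "cheb_moment marchenko_pastur k = (if k = 0 then 1 else if k = 1 then - 1/2 else 0)" for k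
  proof -
    let ?j = "if k = 0 then 1 else k - 1"
    have "cheb_moment marchenko_pastur k = (\<integral>y. (1 - y) * cheb k y \<partial>arcsine)"
      unfolding marchenko_pastur_def using AE by (subst integral_real_density) (auto elim: eventually_mono)
    also have "\<dots> = (\<integral>y. cheb k y - (cheb (k + 1) y + cheb ?j y) / 2 \<partial>arcsine)"
    proof (rule integral_cong_AE)
      show "AE y in arcsine. (1 - y) * cheb k y = cheb k y - (cheb (k + 1) y + cheb ?j y) / 2"
        using AE
      proof eventually_elim
        fix y :: real assume "y \<in> {-1..1}"
        from cheb_times[OF this, of k] show "(1 - y) * cheb k y = cheb k y - (cheb (k + 1) y + cheb ?j y) / 2"
          by (simp add: left_diff_distrib)
      qed
    qed measurable
    also have "\<dots> = cheb_moment arcsine k - (cheb_moment arcsine (k + 1) + cheb_moment arcsine ?j) / 2"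
      using int by simp
    finally show ?thesis by (auto simp: cheb_moment_arcsine)
  qed
  then show "cheb_moment marchenko_pastur k = (if k = 0 then 1 else if k = 1 then - 1/2 else 0)" .
  have sets: "sets marchenko_pastur = sets borel" by (simp add: marchenko_pastur_def prob_on_sets[OF A])
  have nn: "AE y in arcsine. 0 \<le> 1 - y" using AE by eventually_elim auto
  have "integrable arcsine (\<lambda>y. 1 - y)"
    by (rule prob_on_integrable[OF A, where B=2]) auto
  then have "emeasure marchenko_pastur UNIV = ennreal (\<integral>y. 1 - y \<partial>arcsine)"
    unfolding marchenko_pastur_def using nn prob_on_space[OF A] prob_on_sets[OF A]
    by (subst emeasure_density) (auto simp: nn_integral_eq_integral)
  also have "(\<integral>y. 1 - y \<partial>arcsine) = cheb_moment marchenko_pastur 0"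
    unfolding marchenko_pastur_def using nn by (subst integral_real_density) auto
  finally have 1: "emeasure marchenko_pastur UNIV = 1" by (simp add: mom)
  have "AE y in marchenko_pastur. y \<in> {-1..1}"
    unfolding marchenko_pastur_def using AE by (subst AE_density) (auto elim: eventually_mono)
  then have "emeasure marchenko_pastur (UNIV - {-1..1}) = 0"
    using sets_eq_imp_space_eq[OF sets] sets by (subst (asm) AE_iff_measurable[of "UNIV - {-1..1}"]) auto
  then show "prob_on {-1..1} marchenko_pastur" using sets 1 by (simp add: prob_on_def)
qed

text \<open>All moments with k > 0 vanish, so only the offset of the kernel remains: the arcsine law
  is the equilibrium measure of [-1,1].\<close>

lemma potential_arcsine: "x \<in> {-1..1} \<Longrightarrow> potential arcsine x = ennreal 4"
proof -
  assume x: "x \<in> {-1..1}"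
  have "(\<lambda>k. rad n ^ k * (cheb k x * cheb_moment arcsine k) / real k) = (\<lambda>k. 0)" for n
    by (rule ext) (simp add: cheb_moment_arcsine)
  then have e: "reg_potential n arcsine x = 4 + ln (rad n)" for n by (simp add: reg_potential_def)
  show ?thesis
  proof (rule LIMSEQ_unique)
    show "(\<lambda>n. ennreal (reg_potential n arcsine x)) \<longlonglongrightarrow> potential arcsine x"
      unfolding potential_SUP(1)[OF prob_on_arcsine x] by (rule LIMSEQ_SUP[OF potential_SUP(2)[OF prob_on_arcsine x]])
    have "(\<lambda>n. 4 + ln (rad n)) \<longlonglongrightarrow> 4 + 0" by (intro tendsto_intros ln_rad_LIMSEQ)
    then show "(\<lambda>n. ennreal (reg_potential n arcsine x)) \<longlonglongrightarrow> ennreal 4"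
      unfolding e by (intro tendsto_ennrealI) simp
  qed
qed

text \<open>Only the moment k = 1 survives, and T_1(x) = x. Linearity of this potential is what
  converts logarithmic means into the mean of X itself.\<close>

lemma potential_marchenko_pastur: "x \<in> {-1..1} \<Longrightarrow> potential marchenko_pastur x = ennreal (4 - x)"
proof -
  assume x: "x \<in> {-1..1}"
  note MP = marchenko_pastur_facts(1)
  have "(\<Sum>k. rad n ^ k * (cheb k x * cheb_moment marchenko_pastur k) / real k)
      = (\<Sum>k\<in>{1}. rad n ^ k * (cheb k x * cheb_moment marchenko_pastur k) / real k)" for n
    by (rule suminf_finite) (auto simp: marchenko_pastur_facts(2))
  then have e: "reg_potential n marchenko_pastur x = 4 + ln (rad n) - rad n * x" for n
    using cheb_1[OF x] by (simp add: reg_potential_def marchenko_pastur_facts(2))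
  show ?thesis
  proof (rule LIMSEQ_unique)
    show "(\<lambda>n. ennreal (reg_potential n marchenko_pastur x)) \<longlonglongrightarrow> potential marchenko_pastur x"
      unfolding potential_SUP(1)[OF MP x] by (rule LIMSEQ_SUP[OF potential_SUP(2)[OF MP x]])
    have "(\<lambda>n. 4 + ln (rad n) - rad n * x) \<longlonglongrightarrow> 4 + 0 - 1 * x"
      by (intro tendsto_intros ln_rad_LIMSEQ rad_LIMSEQ)
    then show "(\<lambda>n. ennreal (reg_potential n marchenko_pastur x)) \<longlonglongrightarrow> ennreal (4 - x)"
      unfolding e by (intro tendsto_ennrealI) simp
  qed
qed

text \<open>The law has full support: seen through cos it has a positive density with respect to
  Lebesgue measure on (0,pi), so an exceptional null set contains no interval.\<close>

lemma marchenko_pastur_dense: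
  assumes P: "Measurable.pred borel P" and AE: "AE y in marchenko_pastur. P y"
    and U: "open U" "y0 \<in> U" "y0 \<in> {-1..1}"
  obtains y where "y \<in> U" "y \<in> {-1..1}" "P y"
proof -
  have "AE y in arcsine. 0 < ennreal (1 - y) \<longrightarrow> P y"
    using AE unfolding marchenko_pastur_def by (subst (asm) AE_density) (auto simp: prob_on_sets[OF prob_on_arcsine] cong: measurable_cong_sets)
  then have ae: "AE t in lborel. t \<in> {0..pi} \<longrightarrow> 0 < ennreal (1 - cos t) \<longrightarrow> P (cos t)"
    using P by (subst (asm) AE_arcsine) auto
  define t0 where "t0 = arccos y0"
  have t0: "0 \<le> t0" "t0 \<le> pi" "cos t0 = y0" using U(3) by (auto simp: t0_def arccos_lbound arccos_ubound)
  have "isCont cos t0" by simp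
  then have "\<forall>\<^sub>F t in nhds t0. cos t \<in> U"
    using U(1,2) t0(3) by (metis (no_types) isCont_def tendsto_def topological_tendstoD tendsto_nhds_iff)
  then obtain d where d: "d > 0" "\<And>t. dist t t0 < d \<Longrightarrow> cos t \<in> U" unfolding eventually_nhds_metric by blast
  define a where "a = max 0 (t0 - d)"
  define b where "b = min pi (t0 + d)"
  have ab: "a < b" using t0 d(1) pi_gt_zero unfolding a_def b_def by linarith
  have "\<exists>t\<in>{a<..<b}. t \<in> {0..pi} \<longrightarrow> 0 < ennreal (1 - cos t) \<longrightarrow> P (cos t)"
  proof (rule ccontr)
    assume none: "\<not> (\<exists>t\<in>{a<..<b}. t \<in> {0..pi} \<longrightarrow> 0 < ennreal (1 - cos t) \<longrightarrow> P (cos t))"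
    have "AE t in lborel. t \<notin> {a<..<b}" using ae by (rule eventually_mono) (use none in blast)
    then have "emeasure lborel {a<..<b} = 0" by (subst (asm) AE_iff_measurable[of "{a<..<b}"]) auto
    then show False using ab by simp
  qed
  then obtain t where "t \<in> {a<..<b}" and tP: "t \<in> {0..pi} \<longrightarrow> 0 < ennreal (1 - cos t) \<longrightarrow> P (cos t)" by (rule bexE)
  then have t: "a < t" "t < b" by auto
  have tt: "0 < t" "t < pi" "dist t t0 < d" using t(1,2) unfolding a_def b_def dist_real_def by linarith+
  have "cos t < cos 0" using tt by (intro cos_monotone_0_pi) auto
  then have "P (cos t)" using tP tt by simp
  with d(2)[OF tt(3)] show thesis by (intro that[of "cos t"]) auto
qed

section \<open>From logarithmic means at all levels to the mean\<close>

lemma nn_integral_kernel_swap: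
  assumes M: "prob_on K M" and N: "prob_on L N" and X: "X \<in> borel_measurable borel"
  shows "(\<integral>\<^sup>+ y. (\<integral>\<^sup>+ u. kernel (X u) y \<partial>M) \<partial>N) = (\<integral>\<^sup>+ u. potential N (X u) \<partial>M)"
    and "(\<lambda>y. \<integral>\<^sup>+ u. kernel (X u) y \<partial>M) \<in> borel_measurable borel"
proof -
  interpret M: prob_space M using M by (rule prob_on_prob_space)
  interpret N: prob_space N using N by (rule prob_on_prob_space)
  interpret pair_sigma_finite M N ..
  note [measurable_cong] = prob_on_sets[OF M] prob_on_sets[OF N]
  note [measurable] = X
  have "(\<lambda>(u, y). kernel (X u) y) \<in> borel_measurable (M \<Otimes>\<^sub>M N)" unfolding kernel_def by measurable
  from Fubini'[OF this] show "(\<integral>\<^sup>+ y. (\<integral>\<^sup>+ u. kernel (X u) y \<partial>M) \<partial>N) = (\<integral>\<^sup>+ u. potential N (X u) \<partial>M)"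
    unfolding potential_def .
  have "(\<lambda>(y, u). kernel (X u) y) \<in> borel_measurable (borel \<Otimes>\<^sub>M M)" unfolding kernel_def by measurable
  then show "(\<lambda>y. \<integral>\<^sup>+ u. kernel (X u) y \<partial>M) \<in> borel_measurable borel"
    by (rule M.borel_measurable_nn_integral)
qed

lemma nn_integral_kernel_comp:
  assumes M: "prob_on K M" "closed K" and Y: "\<And>u. u \<in> K \<Longrightarrow> Y u \<in> {-1..1}" and y: "y \<in> {-1..1}"
    and int: "integrable M (\<lambda>u. ln (2 * \<bar>Y u - y\<bar>))" and ne: "AE u in M. Y u \<noteq> y"
  shows "(\<integral>\<^sup>+ u. kernel (Y u) y \<partial>M) = ennreal (4 - (\<integral>u. ln (2 * \<bar>Y u - y\<bar>) \<partial>M))"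
    and "0 \<le> 4 - (\<integral>u. ln (2 * \<bar>Y u - y\<bar>) \<partial>M)"
proof -
  interpret prob_space M using M(1) by (rule prob_on_prob_space)
  have val: "(\<integral>u. 4 - ln (2 * \<bar>Y u - y\<bar>) \<partial>M) = 4 - (\<integral>u. ln (2 * \<bar>Y u - y\<bar>) \<partial>M)"
    using int by (simp add: prob_space)
  have nn: "AE u in M. 0 \<le> 4 - ln (2 * \<bar>Y u - y\<bar>)"
    using prob_on_AE[OF M] by eventually_elim (rule kernel_nonneg[OF Y y])
  have "(\<integral>\<^sup>+ u. kernel (Y u) y \<partial>M) = (\<integral>\<^sup>+ u. ennreal (4 - ln (2 * \<bar>Y u - y\<bar>)) \<partial>M)"
    by (rule nn_integral_cong_AE, use ne in eventually_elim, simp add: kernel_def)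
  also have "\<dots> = ennreal (\<integral>u. 4 - ln (2 * \<bar>Y u - y\<bar>) \<partial>M)"
    using int by (intro nn_integral_eq_integral nn) simp
  finally show "(\<integral>\<^sup>+ u. kernel (Y u) y \<partial>M) = ennreal (4 - (\<integral>u. ln (2 * \<bar>Y u - y\<bar>) \<partial>M))"
    by (simp only: val)
  show "0 \<le> 4 - (\<integral>u. ln (2 * \<bar>Y u - y\<bar>) \<partial>M)" using integral_nonneg_AE[OF nn] unfolding val .
qed

lemma AE_marchenko_pastur: "(AE y in arcsine. P y) \<Longrightarrow> AE y in marchenko_pastur. P y"
  unfolding marchenko_pastur_def
  by (subst AE_density) (auto simp: prob_on_sets[OF prob_on_arcsine] cong: measurable_cong_sets elim: eventually_mono)

lemma AE_marchenko_pastur_less: "AE y in marchenko_pastur. y < 1"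
  unfolding marchenko_pastur_def
  by (subst AE_density) (auto simp: prob_on_sets[OF prob_on_arcsine] cong: measurable_cong_sets)

lemma nn_integral_4_minus:
  fixes X :: "real \<Rightarrow> real"
  assumes M: "prob_on K M" "closed K" and X: "X \<in> borel_measurable borel"
    and bd: "\<And>u. u \<in> K \<Longrightarrow> X u \<in> {-1..1}"
  shows "(\<integral>\<^sup>+ u. potential marchenko_pastur (X u) \<partial>M) = ennreal (4 - (\<integral>u. X u \<partial>M))"
    and "(\<integral>u. X u \<partial>M) \<le> 1"
proof -
  interpret prob_space M using M(1) by (rule prob_on_prob_space)
  have AE: "AE u in M. X u \<in> {-1..1}" using prob_on_AE[OF M] by eventually_elim (rule bd)
  have b: "norm (X u) \<le> 1" if "u \<in> K" for u using bd[OF that] by auto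
  have int: "integrable M X" by (rule prob_on_integrable[OF M X b])
  have "(\<integral>\<^sup>+ u. potential marchenko_pastur (X u) \<partial>M) = (\<integral>\<^sup>+ u. ennreal (4 - X u) \<partial>M)"
    by (rule nn_integral_cong_AE, use AE in eventually_elim, rule potential_marchenko_pastur)
  also have "\<dots> = ennreal (\<integral>u. 4 - X u \<partial>M)"
  proof (rule nn_integral_eq_integral)
    show "AE u in M. 0 \<le> 4 - X u" using AE by eventually_elim auto
  qed (use int in simp)
  finally show "(\<integral>\<^sup>+ u. potential marchenko_pastur (X u) \<partial>M) = ennreal (4 - (\<integral>u. X u \<partial>M))"
    using int by (simp add: prob_space)
  show "(\<integral>u. X u \<partial>M) \<le> 1" using prob_on_norm_integral_le[OF M X b] by simp
qed

text \<open>Let G(y) be the mean of ln(2|X-y|). Its arcsine average is 0 because the arcsine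
  potential is constant; with G >= 0 it vanishes almost everywhere, also for the second law, whose
  density is relative to the first. But the second average of G is the mean of X.\<close>

lemma mean_eq_0:
  fixes X :: "real \<Rightarrow> real"
  assumes M: "prob_on K M" "closed K" and X: "X \<in> borel_measurable borel"
    and bd: "\<And>u. u \<in> K \<Longrightarrow> X u \<in> {-1..1}"
    and int: "\<And>y. y \<in> {-1..1} \<Longrightarrow> integrable M (\<lambda>u. ln (2 * \<bar>X u - y\<bar>))"
    and ne: "\<And>y. y \<in> {-1..1} \<Longrightarrow> AE u in M. X u \<noteq> y"
    and G: "\<And>y. y \<in> {-1..1} \<Longrightarrow> 0 \<le> (\<integral>u. ln (2 * \<bar>X u - y\<bar>) \<partial>M)"
  shows "(\<integral>u. X u \<partial>M) = 0"
proof -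
  interpret prob_space M using M(1) by (rule prob_on_prob_space)
  interpret A: prob_space arcsine using prob_on_arcsine by (rule prob_on_prob_space)
  interpret MP: prob_space marchenko_pastur using marchenko_pastur_facts(1) by (rule prob_on_prob_space)
  have AE: "AE u in M. X u \<in> {-1..1}" using prob_on_AE[OF M] by eventually_elim (rule bd)
  have AEA: "AE y in arcsine. y \<in> {-1..1}" by (rule prob_on_AE[OF prob_on_arcsine]) simp
  let ?I = "\<lambda>y. \<integral>\<^sup>+ u. kernel (X u) y \<partial>M"
  have inner: "(\<integral>\<^sup>+ u. kernel (X u) y \<partial>M) = ennreal (4 - (\<integral>u. ln (2 * \<bar>X u - y\<bar>) \<partial>M))"
      "0 \<le> 4 - (\<integral>u. ln (2 * \<bar>X u - y\<bar>) \<partial>M)" if "y \<in> {-1..1}" for y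
    using nn_integral_kernel_comp[OF M bd that int[OF that] ne[OF that]] by auto
  have I4: "?I y \<le> ennreal 4" if "y \<in> {-1..1}" for y
    unfolding inner(1)[OF that] using G[OF that] by (intro ennreal_leI) simp
  note swap = nn_integral_kernel_swap[OF M(1) _ X]
  have "(\<integral>\<^sup>+ y. ?I y \<partial>arcsine) = (\<integral>\<^sup>+ u. potential arcsine (X u) \<partial>M)" by (rule swap(1)[OF prob_on_arcsine])
  also have "\<dots> = (\<integral>\<^sup>+ u. ennreal 4 \<partial>M)"
    by (rule nn_integral_cong_AE, use AE in eventually_elim, rule potential_arcsine)
  finally have tot: "(\<integral>\<^sup>+ y. ?I y \<partial>arcsine) = ennreal 4" by (simp add: emeasure_space_1)
  have mI: "?I \<in> borel_measurable arcsine"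
    by (rule prob_on_measurable[OF prob_on_arcsine swap(2)[OF prob_on_arcsine]])
  have "(\<integral>\<^sup>+ y. ennreal 4 - ?I y \<partial>arcsine) = (\<integral>\<^sup>+ y. ennreal 4 \<partial>arcsine) - (\<integral>\<^sup>+ y. ?I y \<partial>arcsine)"
  proof (rule nn_integral_diff)
    show "(\<integral>\<^sup>+ y. ?I y \<partial>arcsine) \<noteq> \<infinity>" using tot by simp
    show "AE y in arcsine. ?I y \<le> ennreal 4" using AEA by eventually_elim (rule I4)
  qed (use mI in auto)
  also have "\<dots> = 0" using tot by (simp add: A.emeasure_space_1)
  finally have "AE y in arcsine. ennreal 4 - ?I y = 0" using mI by (subst (asm) nn_integral_0_iff_AE) auto
  then have "AE y in arcsine. ?I y = ennreal 4" using AEA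
  proof eventually_elim
    fix y assume y: "ennreal 4 - ?I y = 0" "y \<in> {-1..1}"
    then have "ennreal 4 \<le> ?I y" using ennreal_minus_eq_0 by blast
    then show "?I y = ennreal 4" using I4[OF y(2)] by (rule antisym[rotated])
  qed
  then have "AE y in marchenko_pastur. ?I y = ennreal 4" by (rule AE_marchenko_pastur)
  then have "(\<integral>\<^sup>+ y. ?I y \<partial>marchenko_pastur) = (\<integral>\<^sup>+ y. ennreal 4 \<partial>marchenko_pastur)" by (rule nn_integral_cong_AE)
  also have "\<dots> = ennreal 4" by (simp add: MP.emeasure_space_1)
  finally have "ennreal 4 = ennreal (4 - (\<integral>u. X u \<partial>M))"
    using swap(1)[OF marchenko_pastur_facts(1)] nn_integral_4_minus(1)[OF M X bd] by simp
  then show ?thesis using nn_integral_4_minus(2)[OF M X bd] by (subst (asm) ennreal_inj) auto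
qed

text \<open>Again the arcsine average of the logarithmic means is 0, which determines a
  constant.\<close>

lemma log_mean_const_eq_0:
  fixes X :: "real \<Rightarrow> real"
  assumes M: "prob_on K M" "closed K" and X: "X \<in> borel_measurable borel"
    and bd: "\<And>u. u \<in> K \<Longrightarrow> X u \<in> {-1..1}"
    and int: "\<And>y. y \<in> {-1..1} \<Longrightarrow> integrable M (\<lambda>u. ln (2 * \<bar>X u - y\<bar>))"
    and ne: "\<And>y. y \<in> {-1..1} \<Longrightarrow> AE u in M. X u \<noteq> y"
    and G: "\<And>y. y \<in> {-1..1} \<Longrightarrow> (\<integral>u. ln (2 * \<bar>X u - y\<bar>) \<partial>M) = g"
  shows "g = 0"
proof -
  interpret prob_space M using M(1) by (rule prob_on_prob_space)
  interpret A: prob_space arcsine using prob_on_arcsine by (rule prob_on_prob_space)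
  have AE: "AE u in M. X u \<in> {-1..1}" using prob_on_AE[OF M] by eventually_elim (rule bd)
  have AEA: "AE y in arcsine. y \<in> {-1..1}" by (rule prob_on_AE[OF prob_on_arcsine]) simp
  have inner: "(\<integral>\<^sup>+ u. kernel (X u) y \<partial>M) = ennreal (4 - (\<integral>u. ln (2 * \<bar>X u - y\<bar>) \<partial>M))"
      "0 \<le> 4 - (\<integral>u. ln (2 * \<bar>X u - y\<bar>) \<partial>M)" if "y \<in> {-1..1}" for y
    using nn_integral_kernel_comp[OF M bd that int[OF that] ne[OF that]] by auto
  have "(\<integral>\<^sup>+ y. (\<integral>\<^sup>+ u. kernel (X u) y \<partial>M) \<partial>arcsine) = (\<integral>\<^sup>+ u. potential arcsine (X u) \<partial>M)"
    by (rule nn_integral_kernel_swap(1)[OF M(1) prob_on_arcsine X])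
  also have "\<dots> = (\<integral>\<^sup>+ u. ennreal 4 \<partial>M)"
    by (rule nn_integral_cong_AE, use AE in eventually_elim, rule potential_arcsine)
  also have "(\<integral>\<^sup>+ y. (\<integral>\<^sup>+ u. kernel (X u) y \<partial>M) \<partial>arcsine) = (\<integral>\<^sup>+ y. ennreal (4 - g) \<partial>arcsine)"
  proof (rule nn_integral_cong_AE, use AEA in eventually_elim)
    fix y :: real assume y: "y \<in> {-1..1}"
    show "(\<integral>\<^sup>+ u. kernel (X u) y \<partial>M) = ennreal (4 - g)" using inner(1)[OF y] G[OF y] by simp
  qed
  finally have "ennreal (4 - g) = ennreal 4" by (simp add: emeasure_space_1 A.emeasure_space_1)
  moreover have "0 \<le> 4 - g" using inner(2)[of 0] G[of 0] by simp
  ultimately show ?thesis by (subst (asm) ennreal_inj) auto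
qed

text \<open>For X in [-1,1] the Marchenko-Pastur average of the logarithmic means is the mean of X.
  Values of X above 1 only help, by concavity of ln; mean 0 then forces equality, first in the
  tangent inequality and then in the average.\<close>

lemma mean_nonneg:
  fixes X :: "real \<Rightarrow> real"
  assumes M: "prob_on K M" "closed K" and X: "X \<in> borel_measurable borel"
    and bd: "\<And>u. u \<in> K \<Longrightarrow> -1 \<le> X u" "\<And>u. u \<in> K \<Longrightarrow> \<bar>X u\<bar> \<le> B"
    and int: "\<And>y. y \<in> {-1..1} \<Longrightarrow> integrable M (\<lambda>u. ln (2 * \<bar>X u - y\<bar>))"
    and ne: "\<And>y. y \<in> {-1..1} \<Longrightarrow> AE u in M. X u \<noteq> y"
    and G: "\<And>y. y \<in> {-1..1} \<Longrightarrow> 0 \<le> (\<integral>u. ln (2 * \<bar>X u - y\<bar>) \<partial>M)"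
  shows "0 \<le> (\<integral>u. X u \<partial>M)"
    and "(\<integral>u. X u \<partial>M) = 0 \<Longrightarrow> AE u in M. X u \<le> 1"
    and "(\<integral>u. X u \<partial>M) = 0 \<Longrightarrow> open U \<Longrightarrow> y0 \<in> U \<Longrightarrow> y0 \<in> {-1..1} \<Longrightarrow>
      \<exists>y\<in>U \<inter> {-1..1}. (\<integral>u. ln (2 * \<bar>X u - y\<bar>) \<partial>M) \<le> 0"
proof -
  interpret prob_space M using M(1) by (rule prob_on_prob_space)
  interpret MP: prob_space marchenko_pastur using marchenko_pastur_facts(1) by (rule prob_on_prob_space)
  interpret A: prob_space arcsine using prob_on_arcsine by (rule prob_on_prob_space)
  note mpr = marchenko_pastur_facts(1)
  have AEA: "AE y in arcsine. y \<in> {-1..1}" by (rule prob_on_AE[OF prob_on_arcsine]) simp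
  \<comment> \<open>The potential of the law is evaluated on [-1,1] only. Values above 1 are capped,
    and their mean excess m is carried separately.\<close>
  define Xh where "Xh u = min (X u) 1" for u
  have Xh: "Xh \<in> borel_measurable borel" unfolding Xh_def[abs_def] using X by measurable
  have Xhb: "Xh u \<in> {-1..1}" if "u \<in> K" for u using bd(1)[OF that] by (auto simp: Xh_def)
  have iX: "integrable M X" using bd(2) by (intro prob_on_integrable[OF M X, where B=B]) auto
  have iXh: "integrable M Xh"
  proof (rule prob_on_integrable[OF M Xh, where B=1])
    show "norm (Xh u) \<le> 1" if "u \<in> K" for u using Xhb[OF that] by auto
  qed
  define m where "m = (\<integral>u. X u - Xh u \<partial>M)"
  have m: "m = (\<integral>u. X u \<partial>M) - (\<integral>u. Xh u \<partial>M)" unfolding m_def using iX iXh by simp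
  have m0: "0 \<le> m" unfolding m_def by (intro integral_nonneg_AE) (auto simp: Xh_def)
  define I where "I y = (\<integral>\<^sup>+ u. kernel (Xh u) y \<partial>M)" for y
  \<comment> \<open>For y in [-1,1) this majorises the logarithmic mean at y. Writing it through I
    makes it measurable by Tonelli.\<close>
  define Q where "Q y = 4 - enn2real (I y) + m / (1 - y)" for y
  note swap = nn_integral_kernel_swap[OF M(1) mpr Xh]
  have mI: "I \<in> borel_measurable borel" unfolding I_def[abs_def] by (rule swap(2))
  have mQ: "Q \<in> borel_measurable borel" unfolding Q_def[abs_def] using mI by measurable
  let ?h = "\<lambda>y u. ln (2 * \<bar>Xh u - y\<bar>) + (X u - Xh u) / (1 - y)"
  \<comment> \<open>The tangent of ln(. - y) at the point 1, with slope 1/(1-y), strict where X >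
    1.\<close>
  have pt: "ln (2 * \<bar>X u - y\<bar>) \<le> ?h y u" "1 < X u \<Longrightarrow> ln (2 * \<bar>X u - y\<bar>) < ?h y u" if y: "y < 1" for y u
  proof -
    show lt: "ln (2 * \<bar>X u - y\<bar>) < ?h y u" if X1: "1 < X u"
    proof -
      have pos: "0 < 1 - y" "0 < X u - y" using y X1 by auto
      have eq: "(X u - y) / (1 - y) - 1 = (X u - 1) / (1 - y)" using pos by (simp add: field_simps)
      have "ln ((X u - y) / (1 - y)) \<noteq> (X u - y) / (1 - y) - 1"
        using ln_eq_minus_one[of "(X u - y) / (1 - y)"] pos X1 by auto
      moreover have "ln ((X u - y) / (1 - y)) \<le> (X u - y) / (1 - y) - 1" using pos by (intro ln_le_minus_one) simp
      ultimately have "ln (X u - y) - ln (1 - y) < (X u - 1) / (1 - y)" using pos eq by (simp add: ln_div)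
      moreover have "ln (2 * \<bar>X u - y\<bar>) = ln 2 + ln (X u - y)" "ln (2 * \<bar>Xh u - y\<bar>) = ln 2 + ln (1 - y)" "Xh u = 1"
        using X1 pos ln_mult[of 2 "X u - y"] ln_mult[of 2 "1 - y"] by (auto simp: Xh_def)
      ultimately show ?thesis by simp
    qed
    show "ln (2 * \<bar>X u - y\<bar>) \<le> ?h y u"
      using lt by (cases "1 < X u") (auto simp: Xh_def)
  qed
  have main: "I y + ennreal (Q y) = ennreal (4 + m / (1 - y))" "0 \<le> Q y"
      "(\<integral>u. ln (2 * \<bar>X u - y\<bar>) \<partial>M) \<le> Q y" "integrable M (?h y)" "(\<integral>u. ?h y u \<partial>M) = Q y"
    if y: "y \<in> {-1..1}" "y < 1" for y
  proof -
    have mh: "(\<lambda>u. ln (2 * \<bar>Xh u - y\<bar>)) \<in> borel_measurable M"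
      by (rule prob_on_measurable[OF M(1)]) (use Xh in measurable)
    have ih: "integrable M (\<lambda>u. ln (2 * \<bar>Xh u - y\<bar>))"
    proof (rule Bochner_Integration.integrable_bound)
      show "integrable M (\<lambda>u. \<bar>ln (2 * \<bar>X u - y\<bar>)\<bar> + \<bar>ln (2 * (1 - y))\<bar>)"
        using int[OF y(1)] by simp
      show "AE u in M. norm (ln (2 * \<bar>Xh u - y\<bar>)) \<le> norm (\<bar>ln (2 * \<bar>X u - y\<bar>)\<bar> + \<bar>ln (2 * (1 - y))\<bar>)"
        using y(2) by (intro AE_I2) (auto simp: Xh_def min_def)
    qed (rule mh)
    have neh: "AE u in M. Xh u \<noteq> y" using ne[OF y(1)] by eventually_elim (use y(2) in \<open>auto simp: Xh_def min_def\<close>)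
    note inner = nn_integral_kernel_comp[OF M Xhb y(1) ih neh]
    have Iy: "I y = ennreal (4 - (\<integral>u. ln (2 * \<bar>Xh u - y\<bar>) \<partial>M))" unfolding I_def by (rule inner)
    have Qy: "Q y = (\<integral>u. ln (2 * \<bar>Xh u - y\<bar>) \<partial>M) + m / (1 - y)"
      unfolding Q_def Iy using inner(2) by simp
    show i4: "integrable M (?h y)" using ih iX iXh by simp
    show e5: "(\<integral>u. ?h y u \<partial>M) = Q y" unfolding Qy m_def using ih iX iXh by simp
    show le: "(\<integral>u. ln (2 * \<bar>X u - y\<bar>) \<partial>M) \<le> Q y"
      unfolding e5[symmetric] by (rule integral_mono[OF int[OF y(1)] i4 pt(1)[OF y(2)]])
    show Q0: "0 \<le> Q y" using G[OF y(1)] le by linarith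
    show "I y + ennreal (Q y) = ennreal (4 + m / (1 - y))"
      unfolding Iy using inner(2) Q0 by (subst ennreal_plus[symmetric]) (auto simp: Qy)
  qed
  have AE1: "AE y in marchenko_pastur. y \<in> {-1..1} \<and> y < 1"
    using prob_on_AE[OF mpr] AE_marchenko_pastur_less by (auto simp: AE_conj_iff)
  have Ival: "(\<integral>\<^sup>+ y. I y \<partial>marchenko_pastur) = ennreal (4 - (\<integral>u. Xh u \<partial>M))"
    unfolding I_def using swap(1) nn_integral_4_minus(1)[OF M Xh Xhb] by (rule trans)
  have mIP: "I \<in> borel_measurable marchenko_pastur" "(\<lambda>y. ennreal (Q y)) \<in> borel_measurable marchenko_pastur"
    by (rule prob_on_measurable[OF mpr], use mI mQ in measurable)+
  have "(\<integral>\<^sup>+ y. I y \<partial>marchenko_pastur) + (\<integral>\<^sup>+ y. ennreal (Q y) \<partial>marchenko_pastur)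
      = (\<integral>\<^sup>+ y. I y + ennreal (Q y) \<partial>marchenko_pastur)" by (rule nn_integral_add[symmetric]; fact)
  also have "\<dots> = (\<integral>\<^sup>+ y. ennreal (4 + m / (1 - y)) \<partial>marchenko_pastur)"
    by (rule nn_integral_cong_AE, use AE1 in eventually_elim, rule main(1)) auto
  also have "\<dots> = (\<integral>\<^sup>+ y. ennreal (1 - y) * ennreal (4 + m / (1 - y)) \<partial>arcsine)"
    unfolding marchenko_pastur_def
    by (intro nn_integral_density prob_on_measurable[OF prob_on_arcsine]) measurable
  \<comment> \<open>The density 1 - y cancels the pole of m/(1-y), which would not be integrable
    against the arcsine law. Only an inequality, since at y = 1 the left integrand is 0.\<close>
  also have "\<dots> \<le> (\<integral>\<^sup>+ y. ennreal (4 * (1 - y) + m) \<partial>arcsine)"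
  proof (rule nn_integral_mono)
    fix y :: real
    show "ennreal (1 - y) * ennreal (4 + m / (1 - y)) \<le> ennreal (4 * (1 - y) + m)"
    proof (cases "y < 1")
      case True
      then have "(1 - y) * (4 + m / (1 - y)) = 4 * (1 - y) + m" by (simp add: field_simps)
      moreover have "ennreal (1 - y) * ennreal (4 + m / (1 - y)) = ennreal ((1 - y) * (4 + m / (1 - y)))"
        using True m0 by (intro ennreal_mult[symmetric]) auto
      ultimately show ?thesis by (simp only: order_refl)
    qed (simp add: ennreal_neg)
  qed
  also have "\<dots> = ennreal (\<integral>y. 4 * (1 - y) + m \<partial>arcsine)"
  proof (rule nn_integral_eq_integral)
    show "integrable arcsine (\<lambda>y. 4 * (1 - y) + m)"
    proof (rule prob_on_integrable[OF prob_on_arcsine])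
      show "norm (4 * (1 - y) + m) \<le> 8 + m" if "y \<in> {-1..1}" for y :: real using that m0 by auto
    qed auto
    show "AE y in arcsine. 0 \<le> 4 * (1 - y) + m"
      using AEA by eventually_elim (use m0 in auto)
  qed
  also have "(\<integral>y. 4 * (1 - y) + m \<partial>arcsine) = 4 + m"
  proof -
    have iy: "integrable arcsine (\<lambda>y. y)" by (rule prob_on_integrable[OF prob_on_arcsine, where B=1]) auto
    have "(\<integral>y. y \<partial>arcsine) = cheb_moment arcsine 1"
    proof (rule integral_cong_AE)
      show "AE y in arcsine. y = cheb 1 y" using AEA by eventually_elim (simp only: cheb_1)
    qed (rule prob_on_measurable[OF prob_on_arcsine], measurable)+
    then show ?thesis using iy by (simp add: cheb_moment_arcsine A.prob_space)
  qed
  finally have le: "ennreal (4 - (\<integral>u. Xh u \<partial>M)) + (\<integral>\<^sup>+ y. ennreal (Q y) \<partial>marchenko_pastur) \<le> ennreal (4 + m)"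
    unfolding Ival .
  have "ennreal (4 - (\<integral>u. Xh u \<partial>M)) \<le> ennreal (4 + m)"
    by (rule order_trans[OF _ le]) simp
  then have "4 - (\<integral>u. Xh u \<partial>M) \<le> 4 + m" using m0 by (subst (asm) ennreal_le_iff) auto
  then show "0 \<le> (\<integral>u. X u \<partial>M)" using m by simp
  have AEQ: "AE y in marchenko_pastur. Q y \<le> 0 \<and> y < 1" if zero: "(\<integral>u. X u \<partial>M) = 0"
  proof -
    have "4 - (\<integral>u. Xh u \<partial>M) = 4 + m" using m zero by simp
    then have "ennreal (4 + m) + (\<integral>\<^sup>+ y. ennreal (Q y) \<partial>marchenko_pastur) \<le> ennreal (4 + m) + 0"
      using le by (simp only: add_0_right)
    then have "(\<integral>\<^sup>+ y. ennreal (Q y) \<partial>marchenko_pastur) = 0"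
      by (simp only: ennreal_add_left_cancel_le) simp
    then have "AE y in marchenko_pastur. ennreal (Q y) = 0" using mIP(2) by (subst (asm) nn_integral_0_iff_AE)
    then show ?thesis using AE_marchenko_pastur_less by eventually_elim (simp add: ennreal_eq_0_iff)
  qed
  have dense: "\<exists>y\<in>U. y \<in> {-1..1} \<and> Q y \<le> 0 \<and> y < 1" if "(\<integral>u. X u \<partial>M) = 0" "open U" "y0 \<in> U" "y0 \<in> {-1..1}" for U y0
  proof -
    have "Measurable.pred borel (\<lambda>y. Q y \<le> 0 \<and> y < 1)" using mQ by measurable
    from marchenko_pastur_dense[OF this AEQ[OF that(1)] that(2-4)] show ?thesis by blast
  qed
  show "\<exists>y\<in>U \<inter> {-1..1}. (\<integral>u. ln (2 * \<bar>X u - y\<bar>) \<partial>M) \<le> 0"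
    if z: "(\<integral>u. X u \<partial>M) = 0" "open U" "y0 \<in> U" "y0 \<in> {-1..1}"
  proof -
    obtain y where y: "y \<in> U" "y \<in> {-1..1}" "Q y \<le> 0" "y < 1" using dense[OF z] by blast
    then show ?thesis using main(3)[OF y(2,4)] by (intro bexI[of _ y]) auto
  qed
  assume zero: "(\<integral>u. X u \<partial>M) = 0"
  \<comment> \<open>One level with Q y <= 0 suffices: there the tangent inequality integrates to an
    equality, which excludes X > 1 on a set of positive measure.\<close>
  obtain y where y: "y \<in> {-1..1}" "Q y \<le> 0" "y < 1" using dense[OF zero open_UNIV, of 0] by auto
  note my = main[OF y(1,3)]
  have "(\<integral>u. ?h y u - ln (2 * \<bar>X u - y\<bar>) \<partial>M) = Q y - (\<integral>u. ln (2 * \<bar>X u - y\<bar>) \<partial>M)"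
    using Bochner_Integration.integral_diff[OF my(4) int[OF y(1)]] my(5) by simp
  also have "\<dots> = 0" using my(2,3) y(2) G[OF y(1)] by linarith
  finally have "AE u in M. ?h y u - ln (2 * \<bar>X u - y\<bar>) = 0"
    using integral_nonneg_eq_0_iff_AE[OF Bochner_Integration.integrable_diff[OF my(4) int[OF y(1)]]] pt(1)[OF y(3)]
    by simp
  then show "AE u in M. X u \<le> 1"
  proof eventually_elim
    fix u assume "?h y u - ln (2 * \<bar>X u - y\<bar>) = 0"
    then show "X u \<le> 1" using pt(2)[OF y(3), of u] by (cases "X u \<le> 1") auto
  qed
qed

section \<open>Polynomials\<close>

context log_equilibrium
begin

lemma cl: "closed K" using compact by (rule compact_imp_closed)

sublocale prob_space M using prob by (rule prob_on_prob_space)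

lemma AE_K: "AE t in M. t \<in> K" by (rule prob_on_AE[OF prob cl])

lemma logpot_ge: "V \<le> logpot M z"
  using on off[of z] by (cases "z \<in> cset K") auto

text \<open>Peeling off linear factors gives ln|lead| plus the sum of U over the zeros, and U >= V
  everywhere. The last claim keeps the excess of one chosen zero, so a zero off K makes the
  inequality strict.\<close>

lemma poly_log:
  fixes f :: "complex poly"
  assumes "f \<noteq> 0"
  shows "integrable M (\<lambda>u. ln (cmod (poly f (of_real u))))"
    and "AE u in M. poly f (of_real u) \<noteq> 0"
    and "ln (cmod (lead_coeff f)) + real (degree f) * V \<le> (\<integral>u. ln (cmod (poly f (of_real u))) \<partial>M)"
    and "(\<And>z. poly f z = 0 \<Longrightarrow> z \<in> cset K) \<Longrightarrow>
      (\<integral>u. ln (cmod (poly f (of_real u))) \<partial>M) = ln (cmod (lead_coeff f)) + real (degree f) * V"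
    and "poly f z = 0 \<Longrightarrow> ln (cmod (lead_coeff f)) + real (degree f) * V + (logpot M z - V)
      \<le> (\<integral>u. ln (cmod (poly f (of_real u))) \<partial>M)"
proof -
  have step: "integrable M (\<lambda>u. ln (cmod (poly f (of_real u))))" "AE u in M. poly f (of_real u) \<noteq> 0"
      "(\<integral>u. ln (cmod (poly f (of_real u))) \<partial>M) = logpot M a + (\<integral>u. ln (cmod (poly g (of_real u))) \<partial>M)"
    if f: "f = [:- a, 1:] * g" and g: "integrable M (\<lambda>u. ln (cmod (poly g (of_real u))))" "AE u in M. poly g (of_real u) \<noteq> 0"
    for f g :: "complex poly" and a
  proof -
    have pf: "poly f (of_real u) = (of_real u - a) * poly g (of_real u)" for u by (simp add: f algebra_simps)
    show nz: "AE u in M. poly f (of_real u) \<noteq> 0" using ne[of a] g(2) by eventually_elim (auto simp: pf)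
    have eq: "AE u in M. ln (cmod (a - of_real u)) + ln (cmod (poly g (of_real u))) = ln (cmod (poly f (of_real u)))"
      using ne[of a] g(2) by eventually_elim (simp add: pf norm_mult ln_mult norm_minus_commute)
    have m: "(\<lambda>u. ln (cmod (poly f (of_real u)))) \<in> borel_measurable M"
      by (intro prob_on_measurable[OF prob] borel_measurable_ln borel_measurable_norm borel_measurable_continuous_onI continuous_intros)
    have i: "integrable M (\<lambda>u. ln (cmod (a - of_real u)) + ln (cmod (poly g (of_real u))))"
      by (rule Bochner_Integration.integrable_add[OF int_ln g(1)])
    show "integrable M (\<lambda>u. ln (cmod (poly f (of_real u))))" by (rule integrable_cong_AE_imp[OF i m eq])
    have "(\<integral>u. ln (cmod (poly f (of_real u))) \<partial>M) = (\<integral>u. ln (cmod (a - of_real u)) + ln (cmod (poly g (of_real u))) \<partial>M)"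
      by (rule integral_cong_AE[OF m borel_measurable_integrable[OF i] eq[THEN AE_symmetric]])
    then show "(\<integral>u. ln (cmod (poly f (of_real u))) \<partial>M) = logpot M a + (\<integral>u. ln (cmod (poly g (of_real u))) \<partial>M)"
      unfolding logpot_def using Bochner_Integration.integral_add[OF int_ln g(1)] by simp
  qed
  have fac: "\<exists>g. f = [:- a, 1:] * g \<and> g \<noteq> 0 \<and> lead_coeff f = lead_coeff g \<and> degree f = Suc (degree g)"
    if root: "poly f a = 0" and f0: "f \<noteq> 0" for f :: "complex poly" and a
  proof -
    obtain g where g: "f = [:- a, 1:] * g" using root by (auto simp: poly_eq_0_iff_dvd elim: dvdE)
    have g0: "g \<noteq> 0" using g f0 by auto
    have "lead_coeff f = lead_coeff g" unfolding g lead_coeff_mult by simp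
    moreover have "degree f = Suc (degree g)" unfolding g using g0 by (subst degree_mult_eq) auto
    ultimately show ?thesis using g g0 by blast
  qed
  have all: "integrable M (\<lambda>u. ln (cmod (poly f (of_real u)))) \<and> (AE u in M. poly f (of_real u) \<noteq> 0) \<and>
    ln (cmod (lead_coeff f)) + real (degree f) * V \<le> (\<integral>u. ln (cmod (poly f (of_real u))) \<partial>M) \<and>
    ((\<forall>z. poly f z = 0 \<longrightarrow> z \<in> cset K) \<longrightarrow>
      (\<integral>u. ln (cmod (poly f (of_real u))) \<partial>M) = ln (cmod (lead_coeff f)) + real (degree f) * V)"
    if "f \<noteq> 0" for f :: "complex poly"
    using that
  proof (induction "degree f" arbitrary: f)
    case 0
    then obtain c where c: "f = [:c:]" using degree_eq_zeroE by metis
    then show ?case using 0 by (simp add: prob_space)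
  next
    case (Suc n)
    have "\<not> constant (poly f)" using Suc(2) constant_degree[of f] by simp
    then obtain a where a: "poly f a = 0" using fundamental_theorem_of_algebra by blast
    obtain g where g: "f = [:- a, 1:] * g" "g \<noteq> 0" "lead_coeff f = lead_coeff g" "degree f = Suc (degree g)"
      using fac[OF a Suc.prems] by blast
    have dg: "n = degree g" using Suc(2) g(4) by simp
    note IH = Suc(1)[OF dg g(2)]
    note st = step[OF g(1) conjunct1[OF IH] conjunct1[OF conjunct2[OF IH]]]
    have L: "cmod (lead_coeff f) = cmod (lead_coeff g)" by (rule arg_cong[OF g(3)])
    have eqn: "ln (cmod (lead_coeff f)) + real (degree f) * V = ln (cmod (lead_coeff g)) + real (degree g) * V + V"
      unfolding L unfolding g(4) by (simp add: algebra_simps)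
    have le: "ln (cmod (lead_coeff f)) + real (degree f) * V \<le> (\<integral>u. ln (cmod (poly f (of_real u))) \<partial>M)"
      unfolding st(3) eqn using IH logpot_ge[of a] by linarith
    have eq: "(\<integral>u. ln (cmod (poly f (of_real u))) \<partial>M) = ln (cmod (lead_coeff f)) + real (degree f) * V"
      if roots: "\<forall>z. poly f z = 0 \<longrightarrow> z \<in> cset K"
    proof -
      have "\<forall>z. poly g z = 0 \<longrightarrow> z \<in> cset K" using roots by (simp add: g(1))
      moreover have "logpot M a = V" using roots a on by auto
      ultimately show ?thesis unfolding st(3) eqn using IH by simp
    qed
    show ?case using st(1,2) le eq by blast
  qed
  from all[OF assms]
  show "integrable M (\<lambda>u. ln (cmod (poly f (of_real u))))" "AE u in M. poly f (of_real u) \<noteq> 0"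
    "ln (cmod (lead_coeff f)) + real (degree f) * V \<le> (\<integral>u. ln (cmod (poly f (of_real u))) \<partial>M)"
    "(\<And>z. poly f z = 0 \<Longrightarrow> z \<in> cset K) \<Longrightarrow>
      (\<integral>u. ln (cmod (poly f (of_real u))) \<partial>M) = ln (cmod (lead_coeff f)) + real (degree f) * V"
    by auto
  assume z: "poly f z = 0"
  obtain g where g: "f = [:- z, 1:] * g" "g \<noteq> 0" "lead_coeff f = lead_coeff g" "degree f = Suc (degree g)"
    using fac[OF z assms] by blast
  note IH = all[OF g(2)]
  note st = step[OF g(1) conjunct1[OF IH] conjunct1[OF conjunct2[OF IH]]]
  show "ln (cmod (lead_coeff f)) + real (degree f) * V + (logpot M z - V) \<le> (\<integral>u. ln (cmod (poly f (of_real u))) \<partial>M)"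
    unfolding st(3) arg_cong[OF g(3), of cmod] unfolding g(4) using IH by (simp add: algebra_simps)
qed

end

section \<open>Real polynomials and their level sets\<close>

abbreviation cpoly :: "real poly \<Rightarrow> complex poly" where
  "cpoly p \<equiv> map_poly complex_of_real p"

lemma poly_cpoly: "poly (cpoly p) (of_real x) = of_real (poly p x)"
  by (induction p) (simp_all add: map_poly_pCons)

lemma cpoly_mult: "cpoly (p * q) = cpoly p * cpoly q"
  by (rule poly_eqI) (simp add: coeff_map_poly coeff_mult)

lemma degree_cpoly: "degree (cpoly p) = degree p"
  by (rule degree_map_poly) simp

lemma lead_coeff_cpoly: "lead_coeff (cpoly p) = of_real (lead_coeff p)"
  by (simp add: degree_cpoly coeff_map_poly)

context log_equilibrium
begin

lemma integrable_poly: "integrable M (poly p)"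
proof -
  have "compact (poly p ` K)" by (intro compact_continuous_image continuous_intros compact)
  then obtain B where "\<And>x. x \<in> K \<Longrightarrow> norm (poly p x) \<le> B"
    using compact_imp_bounded[of "poly p ` K"] unfolding bounded_iff by auto
  then show ?thesis
    by (intro prob_on_integrable[OF prob cl]) (auto intro!: borel_measurable_continuous_onI continuous_intros)
qed

lemma shift_poly:
  assumes "degree r > 0"
  shows "cpoly r - [:of_real t:] \<noteq> 0" "degree (cpoly r - [:of_real t:]) = degree r"
    "cmod (lead_coeff (cpoly r - [:of_real t:])) = \<bar>lead_coeff r\<bar>"
    "cmod (poly (cpoly r - [:of_real t:]) (of_real u)) = \<bar>poly r u - t\<bar>"
proof -
  have d: "degree (cpoly r - [:of_real t:]) = degree r"
  proof -
    have "degree (cpoly r - [:of_real t:]) = degree (cpoly r + - [:of_real t:])"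
      by (simp only: diff_conv_add_uminus)
    also have "\<dots> = degree (cpoly r)" by (rule degree_add_eq_left) (use assms in \<open>simp add: degree_cpoly\<close>)
    finally show ?thesis by (simp add: degree_cpoly)
  qed
  then show "degree (cpoly r - [:of_real t:]) = degree r" .
  show "cpoly r - [:of_real t:] \<noteq> 0" using d assms by auto
  obtain k where k: "degree r = Suc k" using assms gr0_conv_Suc by blast
  show "cmod (lead_coeff (cpoly r - [:of_real t:])) = \<bar>lead_coeff r\<bar>"
    unfolding d by (simp add: coeff_map_poly k)
  show "cmod (poly (cpoly r - [:of_real t:]) (of_real u)) = \<bar>poly r u - t\<bar>"
    by (simp add: poly_cpoly flip: of_real_diff)
qed

lemma real_poly_log:
  assumes r: "degree r > 0"
  shows "integrable M (\<lambda>u. ln \<bar>poly r u - t\<bar>)"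
    and "AE u in M. poly r u \<noteq> t"
    and "ln \<bar>lead_coeff r\<bar> + real (degree r) * V \<le> (\<integral>u. ln \<bar>poly r u - t\<bar> \<partial>M)"
    and "(\<And>z. poly (cpoly r) z = of_real t \<Longrightarrow> z \<in> cset K) \<Longrightarrow>
      (\<integral>u. ln \<bar>poly r u - t\<bar> \<partial>M) = ln \<bar>lead_coeff r\<bar> + real (degree r) * V"
    and "poly (cpoly r) z = of_real t \<Longrightarrow> z \<notin> cset K \<Longrightarrow>
      ln \<bar>lead_coeff r\<bar> + real (degree r) * V < (\<integral>u. ln \<bar>poly r u - t\<bar> \<partial>M)"
proof -
  note s = shift_poly[OF r, where t=t]
  note p = poly_log[OF s(1), unfolded s(3), unfolded s(2) s(4)]
  show "integrable M (\<lambda>u. ln \<bar>poly r u - t\<bar>)" by (rule p)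
  show "AE u in M. poly r u \<noteq> t" using p(2)
    by eventually_elim (auto simp: poly_cpoly)
  show "ln \<bar>lead_coeff r\<bar> + real (degree r) * V \<le> (\<integral>u. ln \<bar>poly r u - t\<bar> \<partial>M)" by (rule p)
  show "(\<integral>u. ln \<bar>poly r u - t\<bar> \<partial>M) = ln \<bar>lead_coeff r\<bar> + real (degree r) * V"
    if "\<And>z. poly (cpoly r) z = of_real t \<Longrightarrow> z \<in> cset K" by (rule p(4)) (use that in simp)
  show "ln \<bar>lead_coeff r\<bar> + real (degree r) * V < (\<integral>u. ln \<bar>poly r u - t\<bar> \<partial>M)"
    if "poly (cpoly r) z = of_real t" "z \<notin> cset K" using p(5)[of z] that off[of z] by simp
qed

text \<open>The substitution X = r/(2c) - 1, t = 2c(1+y) maps [0,4c] to [-1,1]. The half-length 2c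
  and the factor 2 of the kernel combine to ln c, so the means become nonnegative exactly when c is
  the lower bound from \<open>real_poly_log\<close>.\<close>

lemma affine_log:
  assumes r: "degree r > 0" and c: "c > 0"
  shows "integrable M (\<lambda>u. ln (2 * \<bar>(poly r u / (2 * c) - 1) - y\<bar>))"
    and "AE u in M. poly r u / (2 * c) - 1 \<noteq> y"
    and "(\<integral>u. ln (2 * \<bar>(poly r u / (2 * c) - 1) - y\<bar>) \<partial>M) = (\<integral>u. ln \<bar>poly r u - 2 * c * (1 + y)\<bar> \<partial>M) - ln c"
proof -
  let ?t = "2 * c * (1 + y)"
  note p = real_poly_log[OF r, where t="?t"]
  have X: "2 * \<bar>(poly r u / (2 * c) - 1) - y\<bar> = \<bar>poly r u - ?t\<bar> / c" for u
  proof -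
    have "2 * ((poly r u / (2 * c) - 1) - y) = (poly r u - ?t) / c" using c by (simp add: field_simps)
    then have "\<bar>2 * ((poly r u / (2 * c) - 1) - y)\<bar> = \<bar>(poly r u - ?t) / c\<bar>" by (rule arg_cong)
    then show ?thesis using c by (simp only: abs_mult abs_divide abs_of_pos abs_numeral)
  qed
  show "AE u in M. poly r u / (2 * c) - 1 \<noteq> y" using p(2)
    by eventually_elim (use c in \<open>auto simp: field_simps\<close>)
  have eq: "AE u in M. ln \<bar>poly r u - ?t\<bar> - ln c = ln (2 * \<bar>(poly r u / (2 * c) - 1) - y\<bar>)"
    using p(2) by eventually_elim (use c in \<open>simp add: X ln_div\<close>)
  have m: "(\<lambda>u. ln (2 * \<bar>(poly r u / (2 * c) - 1) - y\<bar>)) \<in> borel_measurable M"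
    using c by (intro prob_on_measurable[OF prob] borel_measurable_ln borel_measurable_continuous_onI continuous_intros) auto
  have i: "integrable M (\<lambda>u. ln \<bar>poly r u - ?t\<bar> - ln c)" using p(1) by simp
  show "integrable M (\<lambda>u. ln (2 * \<bar>(poly r u / (2 * c) - 1) - y\<bar>))"
    by (rule integrable_cong_AE_imp[OF i m eq])
  have "(\<integral>u. ln (2 * \<bar>(poly r u / (2 * c) - 1) - y\<bar>) \<partial>M) = (\<integral>u. ln \<bar>poly r u - ?t\<bar> - ln c \<partial>M)"
    by (rule integral_cong_AE[OF m borel_measurable_integrable[OF i] eq[THEN AE_symmetric]])
  then show "(\<integral>u. ln (2 * \<bar>(poly r u / (2 * c) - 1) - y\<bar>) \<partial>M) = (\<integral>u. ln \<bar>poly r u - ?t\<bar> \<partial>M) - ln c"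
    using p(1) by (simp add: prob_space)
qed

lemma borel_affine:
  fixes r :: "real poly"
  shows "(\<lambda>u. poly r u / (2 * c) - 1) \<in> borel_measurable borel"
proof -
  have "poly r \<in> borel_measurable borel" by (intro borel_measurable_continuous_onI continuous_intros)
  then show ?thesis by measurable
qed

lemma integral_affine: "(\<integral>u. poly r u / (2 * c) - 1 \<partial>M) = (\<integral>u. poly r u \<partial>M) / (2 * c) - 1"
  using integrable_poly[of r] by (simp add: prob_space)

context
  fixes r :: "real poly" and c :: real
  assumes r: "degree r > 0" and nonneg: "\<And>x. x \<in> K \<Longrightarrow> 0 \<le> poly r x"
    and c: "c = \<bar>lead_coeff r\<bar> * exp (real (degree r) * V)"
begin

lemma c_pos: "c > 0" using r unfolding c by (auto intro!: mult_pos_pos)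

lemma ln_c: "ln c = ln \<bar>lead_coeff r\<bar> + real (degree r) * V"
proof -
  have "lead_coeff r \<noteq> 0" using r by auto
  then show ?thesis unfolding c by (subst ln_mult) auto
qed

lemma log_mean_nonneg: "0 \<le> (\<integral>u. ln (2 * \<bar>(poly r u / (2 * c) - 1) - y\<bar>) \<partial>M)"
  unfolding affine_log(3)[OF r c_pos] ln_c using real_poly_log(3)[OF r, of "2 * c * (1 + y)"] by simp

text \<open>Everything rests on \<open>mean_nonneg\<close>; the work is to pass from almost every
  point to every point of K, and from a dense set of levels to every level.\<close>

lemma integral_poly_ge:
  shows "2 * c \<le> (\<integral>u. poly r u \<partial>M)"
    and "(\<integral>u. poly r u \<partial>M) = 2 * c \<Longrightarrow> x \<in> K \<Longrightarrow> poly r x \<le> 4 * c"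
    and "(\<integral>u. poly r u \<partial>M) = 2 * c \<Longrightarrow> poly (cpoly r) z = of_real t \<Longrightarrow> 0 \<le> t \<Longrightarrow> t \<le> 4 * c \<Longrightarrow> z \<in> cset K"
proof -
  let ?X = "\<lambda>u. poly r u / (2 * c) - 1"
  have "compact (?X ` K)" using c_pos by (intro compact_continuous_image continuous_intros compact) auto
  then obtain B where B: "\<And>u. u \<in> K \<Longrightarrow> \<bar>?X u\<bar> \<le> B"
    using compact_imp_bounded[of "?X ` K"] unfolding bounded_iff by auto
  have lo: "-1 \<le> ?X u" if "u \<in> K" for u using nonneg[OF that] c_pos by simp
  have "0 \<le> (\<integral>u. ?X u \<partial>M)"
    by (rule mean_nonneg(1)[OF prob cl borel_affine lo B affine_log(1)[OF r c_pos] affine_log(2)[OF r c_pos] log_mean_nonneg])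
  then have "0 \<le> (\<integral>u. poly r u \<partial>M) / (2 * c) - 1" unfolding integral_affine .
  then show "2 * c \<le> (\<integral>u. poly r u \<partial>M)" using c_pos by (simp add: field_simps)
  assume "(\<integral>u. poly r u \<partial>M) = 2 * c"
  then have zero: "(\<integral>u. ?X u \<partial>M) = 0" unfolding integral_affine using c_pos by simp
  have AE1: "AE u in M. ?X u \<le> 1"
    by (rule mean_nonneg(2)[OF prob cl borel_affine lo B affine_log(1)[OF r c_pos] affine_log(2)[OF r c_pos] log_mean_nonneg zero])
  have dense: "\<exists>y\<in>U \<inter> {-1..1}. (\<integral>u. ln (2 * \<bar>?X u - y\<bar>) \<partial>M) \<le> 0"
    if "open U" "y0 \<in> U" "y0 \<in> {-1..1}" for U y0
    by (rule mean_nonneg(3)[OF prob cl borel_affine lo B affine_log(1)[OF r c_pos] affine_log(2)[OF r c_pos] log_mean_nonneg zero that])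
  show "poly r x \<le> 4 * c" if x: "x \<in> K"
  proof (rule ccontr)
    assume "\<not> poly r x \<le> 4 * c"
    then have "4 * c < poly r x" by simp
    moreover have "isCont (poly r) x" by simp
    ultimately obtain d where d: "d > 0" "\<And>u. dist u x < d \<Longrightarrow> dist (poly r u) (poly r x) < poly r x - 4 * c"
      unfolding continuous_at_eps_delta by (metis diff_gt_0_iff_gt)
    \<comment> \<open>If r exceeded 4c at x, it would do so on an interval around x, which would be
      null, against \<open>supp\<close>.\<close>
    have "AE u in M. u \<notin> {x-d<..<x+d}" using AE1
    proof eventually_elim
      fix u assume "?X u \<le> 1"
      then have "poly r u \<le> 4 * c" using c_pos by (simp add: field_simps)
      then have "\<not> dist u x < d" using d(2)[of u] unfolding dist_real_def by linarith
      then show "u \<notin> {x-d<..<x+d}" unfolding dist_real_def by auto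
    qed
    then have "emeasure M {x-d<..<x+d} = 0"
      using prob_on_space[OF prob] prob_on_sets[OF prob]
      by (subst (asm) AE_iff_measurable[of "{x-d<..<x+d}"]) auto
    then show False using supp[OF x d(1)] by simp
  qed
  assume z: "poly (cpoly r) z = of_real t" "0 \<le> t" "t \<le> 4 * c"
  show "z \<in> cset K"
  proof (rule ccontr)
    assume zK: "z \<notin> cset K"
    have "open (- cset K)" using closed_cset[OF cl] by auto
    then obtain d where d: "d > 0" "ball z d \<subseteq> - cset K" using zK openE by blast
    \<comment> \<open>The level t itself need not be among the good levels. The image of a small
      disc about z is open, so some good level near t is also attained off K, where the logarithmic
      mean is strictly positive.\<close>
    let ?W = "poly (cpoly r) ` ball z d"
    have "open ?W"
    proof (rule open_mapping_thm[of "poly (cpoly r)" UNIV])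
      show "poly (cpoly r) holomorphic_on UNIV" by (intro holomorphic_intros)
      show "\<not> poly (cpoly r) constant_on UNIV"
      proof
        assume "poly (cpoly r) constant_on UNIV"
        then have "constant (poly (cpoly r))" by (auto simp: constant_on_def constant_def)
        then show False using r by (simp add: constant_degree degree_cpoly)
      qed
    qed auto
    let ?U = "(\<lambda>y. complex_of_real (2 * c * (1 + y))) -` ?W"
    have "open ?U" by (intro open_vimage \<open>open ?W\<close> continuous_intros)
    moreover have "t / (2 * c) - 1 \<in> ?U"
    proof -
      have "2 * c * (1 + (t / (2 * c) - 1)) = t" using c_pos by simp
      then show ?thesis using z(1) d(1) by (auto intro!: image_eqI[of _ _ z])
    qed
    moreover have "t / (2 * c) - 1 \<in> {-1..1}" using z(2,3) c_pos by (auto simp: field_simps)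
    ultimately obtain y where y: "y \<in> ?U" "y \<in> {-1..1}" "(\<integral>u. ln (2 * \<bar>?X u - y\<bar>) \<partial>M) \<le> 0"
      using dense[of ?U] by blast
    from y(1) obtain z' where z': "z' \<in> ball z d" "poly (cpoly r) z' = of_real (2 * c * (1 + y))" by auto
    have "z' \<notin> cset K" using z'(1) d(2) by blast
    from real_poly_log(5)[OF r z'(2) this] y(3) show False unfolding affine_log(3)[OF r c_pos] ln_c by simp
  qed
qed

lemma integral_poly_eq:
  assumes le: "\<And>x. x \<in> K \<Longrightarrow> poly r x \<le> 4 * c"
  shows "(\<integral>u. poly r u \<partial>M) = 2 * c"
proof -
  let ?X = "\<lambda>u. poly r u / (2 * c) - 1"
  have bd: "?X u \<in> {-1..1}" if "u \<in> K" for u using nonneg[OF that] le[OF that] c_pos by (auto simp: field_simps)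
  have "(\<integral>u. ?X u \<partial>M) = 0"
    by (rule mean_eq_0[OF prob cl borel_affine bd affine_log(1)[OF r c_pos] affine_log(2)[OF r c_pos] log_mean_nonneg])
  then show ?thesis unfolding integral_affine using c_pos by (simp add: field_simps)
qed

text \<open>Capacity of a polynomial preimage: if K is the preimage of [0,b], all zeros of r - t lie
  in K for every t in [0,b]. So the normalised logarithmic means are all ln c - ln(b/4), and the
  arcsine average makes this 0.\<close>

lemma preimage_bound_eq:
  assumes b: "b > 0" and le: "\<And>x. x \<in> K \<Longrightarrow> poly r x \<le> b"
    and pre: "\<And>z t. poly (cpoly r) z = of_real t \<Longrightarrow> 0 \<le> t \<Longrightarrow> t \<le> b \<Longrightarrow> z \<in> cset K"
  shows "b = 4 * c"
proof -
  have b4: "b / 4 > 0" using b by simp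
  let ?X = "\<lambda>u. poly r u / (2 * (b / 4)) - 1"
  have bd: "?X u \<in> {-1..1}" if "u \<in> K" for u using nonneg[OF that] le[OF that] b by (auto simp: field_simps)
  have G: "(\<integral>u. ln (2 * \<bar>?X u - y\<bar>) \<partial>M) = ln c - ln (b / 4)" if y: "y \<in> {-1..1}" for y
  proof -
    have t: "0 \<le> 2 * (b / 4) * (1 + y)" "2 * (b / 4) * (1 + y) \<le> b"
    proof -
      show "0 \<le> 2 * (b / 4) * (1 + y)" using y b by (intro mult_nonneg_nonneg) auto
      have "2 * (b / 4) * (1 + y) \<le> 2 * (b / 4) * 2" using y b by (intro mult_left_mono) auto
      then show "2 * (b / 4) * (1 + y) \<le> b" by simp
    qed
    show ?thesis
      unfolding affine_log(3)[OF r b4] ln_c using real_poly_log(4)[OF r pre[OF _ t]] by simp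
  qed
  have "ln c - ln (b / 4) = 0"
    by (rule log_mean_const_eq_0[OF prob cl borel_affine bd affine_log(1)[OF r b4] affine_log(2)[OF r b4] G])
  then have "c = b / 4" using c_pos b4 by simp
  then show ?thesis by simp
qed

end

end

section \<open>Weighted extremal polynomials\<close>

lemma monic_diff_coeff:
  assumes "p \<in> monic_polys n" "q \<in> monic_polys n" "i \<ge> n" shows "coeff (q - p) i = 0"
  using assms by (cases "i = n") (auto simp: monic_polys_def coeff_eq_0)

text \<open>Common frame for the three weights 1 - x^2, 1 + x, 1 - x; \<open>Q_lead\<close> admits
  both signs, and \<open>Q_roots\<close> is where the endpoints in K enter.\<close>

locale weighted_equilibrium = log_equilibrium +
  fixes Q :: "real poly"
  assumes Q_deg: "degree Q > 0" and Q_lead: "\<bar>lead_coeff Q\<bar> = 1"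
    and Q_nonneg: "\<And>x. x \<in> K \<Longrightarrow> 0 \<le> poly Q x"
    and Q_roots: "\<And>z. poly (cpoly Q) z = 0 \<Longrightarrow> z \<in> cset K"
    and cap: "log_capacity K = exp V"
begin

lemma Q_ne: "Q \<noteq> 0" using Q_deg by auto

definition ip :: "real poly \<Rightarrow> real poly \<Rightarrow> real" where
  "ip f g = (\<integral>x. poly (Q * (f * g)) x \<partial>M)"

lemma ip_sym: "ip f g = ip g f"
  unfolding ip_def by (simp add: mult.commute)

lemma ip_add: "ip (f + g) h = ip f h + ip g h"
proof -
  have eq: "poly (Q * ((f + g) * h)) = (\<lambda>x. poly (Q * (f * h)) x + poly (Q * (g * h)) x)"
    by (rule ext) (simp add: algebra_simps)
  show ?thesis
    unfolding ip_def eq by (rule Bochner_Integration.integral_add[OF integrable_poly integrable_poly])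
qed

lemma ip_smult: "ip (smult a f) h = a * ip f h"
proof -
  have eq: "poly (Q * (smult a f * h)) = (\<lambda>x. a * poly (Q * (f * h)) x)" by (rule ext) simp
  show ?thesis unfolding ip_def eq by (rule integral_mult_right_zero)
qed

lemma ip_diff: "ip (f - g) h = ip f h - ip g h"
  using ip_add[of "f - g" g h] by simp

lemma ip_nonneg: "0 \<le> ip f f"
  unfolding ip_def
proof (rule integral_nonneg_AE)
  show "AE x in M. 0 \<le> poly (Q * (f * f)) x"
    using AE_K by eventually_elim (simp add: Q_nonneg)
qed

lemma ip_eq_0: assumes "ip f f = 0" shows "f = 0"
proof (rule ccontr)
  assume f: "f \<noteq> 0"
  have nn: "AE x in M. 0 \<le> poly (Q * (f * f)) x"
    using AE_K by eventually_elim (simp add: Q_nonneg)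
  have 0: "AE x in M. poly (Q * (f * f)) x = 0"
    using assms unfolding ip_def by (subst (asm) integral_nonneg_eq_0_iff_AE[OF integrable_poly nn])
  have "degree (Q * (f * f)) > 0" using Q_deg f Q_ne by (simp add: degree_mult_eq)
  from real_poly_log(2)[OF this, of 0] 0 have "AE x in M. False" by eventually_elim simp
  then show False by simp
qed

text \<open>Gram-Schmidt. Degree less than m is expressed by vanishing coefficients, so that m = 0
  means the zero polynomial.\<close>

lemma ip_projection:
  "\<exists>r. (\<forall>i\<ge>m. coeff r i = 0) \<and> (\<forall>s. (\<forall>i\<ge>m. coeff s i = 0) \<longrightarrow> ip (f - r) s = 0)"
proof (induction m arbitrary: f)
  case 0
  have "ip f s = 0" if "\<forall>i\<ge>0. coeff s i = 0" for s
  proof -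
    have "s = 0" using that by (intro poly_eqI) auto
    then show ?thesis by (simp add: ip_def)
  qed
  then show ?case by (intro exI[of _ 0]) simp
next
  case (Suc m)
  \<comment> \<open>The induction hypothesis is used twice: for the monomial, giving the monic
    orthogonal polynomial e of degree m, and below for f.\<close>
  obtain e0 where e0: "\<forall>i\<ge>m. coeff e0 i = 0" "\<forall>s. (\<forall>i\<ge>m. coeff s i = 0) \<longrightarrow> ip (monom 1 m - e0) s = 0"
    using Suc by blast
  define e where "e = monom 1 m - e0"
  have em: "coeff e m = 1" and ei: "\<And>i. i > m \<Longrightarrow> coeff e i = 0" using e0(1) by (auto simp: e_def)
  have eo: "ip e s = 0" if "\<forall>i\<ge>m. coeff s i = 0" for s using e0(2) that by (simp add: e_def)
  have ee: "ip e e \<noteq> 0" using ip_eq_0[of e] em by auto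
  obtain r where r: "\<forall>i\<ge>m. coeff r i = 0" "\<forall>s. (\<forall>i\<ge>m. coeff s i = 0) \<longrightarrow> ip (f - r) s = 0"
    using Suc by blast
  define k where "k = ip f e / ip e e"
  define r' where "r' = r + smult k e"
  have dec: "ip (f - r') s = ip f s - ip r s - k * ip e s" for s
    unfolding r'_def ip_diff ip_add ip_smult by simp
  have re: "ip r e = 0" using eo[of r] r(1) ip_sym[of r e] by simp
  have 1: "ip (f - r') e = 0" unfolding dec re using ee by (simp add: k_def)
  have 2: "ip (f - r') s = 0" if s: "\<forall>i\<ge>m. coeff s i = 0" for s
  proof -
    have "ip f s - ip r s = 0" using r(2) s ip_diff[of f r s] by simp
    then show ?thesis unfolding dec using eo[OF s] by simp
  qed
  have "ip (f - r') s = 0" if s: "\<forall>i\<ge>Suc m. coeff s i = 0" for s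
  proof -
    define s' where "s' = s - smult (coeff s m) e"
    have s': "\<forall>i\<ge>m. coeff s' i = 0"
    proof (intro allI impI)
      fix i assume "m \<le> i"
      then show "coeff s' i = 0" using s em ei[of i] by (cases "i = m") (auto simp: s'_def)
    qed
    have "s = s' + smult (coeff s m) e" by (simp add: s'_def)
    then have "ip (f - r') s = ip s' (f - r') + coeff s m * ip e (f - r')"
      using ip_sym[of "f - r'" s] ip_add[of s' "smult (coeff s m) e" "f - r'"] ip_smult by simp
    also have "\<dots> = 0" using 1 2[OF s'] by (simp add: ip_sym)
    finally show ?thesis .
  qed
  moreover have "\<forall>i\<ge>Suc m. coeff r' i = 0" using r(1) ei by (auto simp: r'_def)
  ultimately show ?case by blast
qed

abbreviation wmeasure :: "real measure" where
  "wmeasure \<equiv> density M (\<lambda>x. ennreal (poly Q x))"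

lemma L2_norm_eq: "L2_norm wmeasure p = sqrt (ip p p)"
proof -
  have mQ: "(\<lambda>x. ennreal (poly Q x)) \<in> borel_measurable M"
    by (intro prob_on_measurable[OF prob] measurable_compose[OF _ measurable_ennreal] borel_measurable_continuous_onI continuous_intros)
  have mp: "(\<lambda>x. ennreal ((poly p x)\<^sup>2)) \<in> borel_measurable M"
    by (intro prob_on_measurable[OF prob] measurable_compose[OF _ measurable_ennreal] borel_measurable_continuous_onI continuous_intros)
  have "(\<integral>\<^sup>+ x. ennreal ((poly p x)\<^sup>2) \<partial>wmeasure) = (\<integral>\<^sup>+ x. ennreal (poly Q x) * ennreal ((poly p x)\<^sup>2) \<partial>M)"
    by (rule nn_integral_density[OF mQ mp])
  also have "\<dots> = (\<integral>\<^sup>+ x. ennreal (poly (Q * (p * p)) x) \<partial>M)"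
    by (rule nn_integral_cong_AE, use AE_K in eventually_elim)
       (simp add: ennreal_mult[symmetric] Q_nonneg power2_eq_square)
  also have "\<dots> = ennreal (ip p p)" unfolding ip_def
    by (rule nn_integral_eq_integral[OF integrable_poly], use AE_K in eventually_elim) (simp add: Q_nonneg)
  finally show ?thesis unfolding L2_norm_def using ip_nonneg[of p] by simp
qed

text \<open>Subtracting from x^n its projection onto lower degrees gives P, and Pythagoras yields
  \<open>ip q q = ip P P + ip (q - P) (q - P)\<close> for monic q; minimality and uniqueness come
  together.\<close>

lemma orth_monic:
  shows "orth_monic wmeasure n \<in> monic_polys n"
    and "q \<in> monic_polys n \<Longrightarrow> ip (orth_monic wmeasure n) (orth_monic wmeasure n) \<le> ip q q"
    and "q \<in> monic_polys n \<Longrightarrow> ip q q \<le> ip (orth_monic wmeasure n) (orth_monic wmeasure n) \<Longrightarrow> orth_monic wmeasure n = q"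
proof -
  obtain r where r: "\<forall>i\<ge>n. coeff r i = 0" "\<forall>s. (\<forall>i\<ge>n. coeff s i = 0) \<longrightarrow> ip (monom 1 n - r) s = 0"
    using ip_projection by blast
  define P where "P = monom 1 n - r"
  have Pn: "coeff P n = 1" "\<And>i. i > n \<Longrightarrow> coeff P i = 0" using r(1) by (auto simp: P_def)
  then have "degree P = n" using le_degree[of P n] degree_le[of n P] by (intro antisym) auto
  then have P: "P \<in> monic_polys n" using Pn by (simp add: monic_polys_def)
  have exp: "ip q q = ip P P + ip (q - P) (q - P)" if q: "q \<in> monic_polys n" for q
  proof -
    have "\<forall>i\<ge>n. coeff (q - P) i = 0" using monic_diff_coeff[OF P q] by blast
    then have 0: "ip P (q - P) = 0" using r(2) unfolding P_def by blast
    have "ip q q = ip (P + (q - P)) q" by simp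
    also have "\<dots> = ip P (P + (q - P)) + ip (q - P) (P + (q - P))" unfolding ip_add by simp
    also have "\<dots> = ip (P + (q - P)) P + ip (P + (q - P)) (q - P)" using ip_sym by simp
    also have "\<dots> = ip P P + 2 * ip P (q - P) + ip (q - P) (q - P)"
      unfolding ip_add using ip_sym[of P "q - P"] by simp
    finally show ?thesis using 0 by simp
  qed
  have less: "L2_norm wmeasure p \<le> L2_norm wmeasure q \<longleftrightarrow> ip p p \<le> ip q q" for p q
    unfolding L2_norm_eq by simp
  have uniq: "q = P" if q: "q \<in> monic_polys n" "ip q q \<le> ip P P" for q
  proof -
    have "ip (q - P) (q - P) = 0" using exp[OF q(1)] q(2) ip_nonneg[of "q - P"] by linarith
    then show ?thesis using ip_eq_0[of "q - P"] by simp
  qed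
  have min: "ip P P \<le> ip q q" if "q \<in> monic_polys n" for q using exp[OF that] ip_nonneg[of "q - P"] by simp
  have eq: "orth_monic wmeasure n = P" unfolding orth_monic_def less
  proof (rule the_equality)
    show "P \<in> monic_polys n \<and> (\<forall>q\<in>monic_polys n. ip P P \<le> ip q q)" using P min by blast
    show "p = P" if "p \<in> monic_polys n \<and> (\<forall>q\<in>monic_polys n. ip p p \<le> ip q q)" for p
      using uniq[of p] that P by blast
  qed
  show "orth_monic wmeasure n \<in> monic_polys n" using P eq by simp
  show "q \<in> monic_polys n \<Longrightarrow> ip (orth_monic wmeasure n) (orth_monic wmeasure n) \<le> ip q q" using min eq by simp
  show "q \<in> monic_polys n \<Longrightarrow> ip q q \<le> ip (orth_monic wmeasure n) (orth_monic wmeasure n) \<Longrightarrow> orth_monic wmeasure n = q"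
    using uniq[of q] eq by simp
qed

text \<open>All zeros of Q lie in K, so the integral of ln Q is exactly deg(Q) V. Positive and
  negative parts are treated separately as in the definition; both are finite.\<close>

lemma szego_eq: "szego M (poly Q) = exp (real (degree Q) * V)"
proof -
  note p = real_poly_log[OF Q_deg, where t=0, simplified]
  have val: "(\<integral>x. ln \<bar>poly Q x\<bar> \<partial>M) = real (degree Q) * V"
    using p(4) Q_roots Q_lead by simp
  have pos: "AE x in M. 0 < poly Q x"
    using AE_K p(2) by eventually_elim (use Q_nonneg in \<open>force simp: less_le\<close>)
  define g where "g x = ln \<bar>poly Q x\<bar>" for x
  have g: "integrable M g" using p(1) by (simp add: g_def[abs_def])
  have P: "(\<integral>\<^sup>+ x. (if poly Q x \<le> 0 then 0 else ennreal (max 0 (ln (poly Q x)))) \<partial>M) = ennreal (\<integral>x. max 0 (g x) \<partial>M)"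
  proof -
    have "(\<integral>\<^sup>+ x. (if poly Q x \<le> 0 then 0 else ennreal (max 0 (ln (poly Q x)))) \<partial>M) = (\<integral>\<^sup>+ x. ennreal (max 0 (g x)) \<partial>M)"
      by (rule nn_integral_cong_AE, use pos in eventually_elim) (simp add: g_def)
    also have "\<dots> = ennreal (\<integral>x. max 0 (g x) \<partial>M)" using g by (intro nn_integral_eq_integral) auto
    finally show ?thesis .
  qed
  have N: "(\<integral>\<^sup>+ x. (if poly Q x \<le> 0 then \<infinity> else ennreal (max 0 (- ln (poly Q x)))) \<partial>M) = ennreal (\<integral>x. max 0 (- g x) \<partial>M)"
  proof -
    have "(\<integral>\<^sup>+ x. (if poly Q x \<le> 0 then \<infinity> else ennreal (max 0 (- ln (poly Q x)))) \<partial>M) = (\<integral>\<^sup>+ x. ennreal (max 0 (- g x)) \<partial>M)"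
      by (rule nn_integral_cong_AE, use pos in eventually_elim) (simp add: g_def)
    also have "\<dots> = ennreal (\<integral>x. max 0 (- g x) \<partial>M)" using g by (intro nn_integral_eq_integral) auto
    finally show ?thesis .
  qed
  have nn: "0 \<le> (\<integral>x. max 0 (g x) \<partial>M)" "0 \<le> (\<integral>x. max 0 (- g x) \<partial>M)" by (auto intro!: integral_nonneg_AE)
  have "(\<integral>x. max 0 (g x) \<partial>M) - (\<integral>x. max 0 (- g x) \<partial>M) = (\<integral>x. max 0 (g x) - max 0 (- g x) \<partial>M)"
    using g by (intro Bochner_Integration.integral_diff[symmetric]) auto
  also have "\<dots> = (\<integral>x. g x \<partial>M)" by (intro Bochner_Integration.integral_cong) auto
  also have "\<dots> = real (degree Q) * V" using val by (simp add: g_def)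
  finally show ?thesis unfolding szego_def P N Let_def using nn by (simp add: enn2ereal_ennreal)
qed

lemma K_infinite: "infinite K"
proof
  assume "finite K"
  then have "AE t in M. \<forall>x\<in>K. complex_of_real x \<noteq> of_real t"
    by (intro AE_finite_allI ne)
  then have "AE t in M. False" using AE_K by eventually_elim auto
  then show False by simp
qed

section \<open>Extremal polynomials of a fixed degree\<close>

context
  fixes n :: nat
begin

definition c_n :: real where "c_n = exp (real (degree Q + 2 * n) * V)"

lemma c_n_pos: "c_n > 0" by (simp add: c_n_def)

lemma weighted_square:
  assumes "p \<noteq> 0" "degree p = n"
  shows "degree (Q * (p * p)) = degree Q + 2 * n" "degree (Q * (p * p)) > 0"
    "\<bar>lead_coeff (Q * (p * p))\<bar> * exp (real (degree (Q * (p * p))) * V) = (lead_coeff p)\<^sup>2 * c_n"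
    "x \<in> K \<Longrightarrow> 0 \<le> poly (Q * (p * p)) x"
proof -
  show d: "degree (Q * (p * p)) = degree Q + 2 * n" using assms Q_ne by (simp add: degree_mult_eq)
  then show "degree (Q * (p * p)) > 0" using Q_deg by simp
  have "\<bar>lead_coeff (Q * (p * p))\<bar> = (lead_coeff p)\<^sup>2"
    unfolding lead_coeff_mult abs_mult using Q_lead by (simp add: power2_eq_square)
  then show "\<bar>lead_coeff (Q * (p * p))\<bar> * exp (real (degree (Q * (p * p))) * V) = (lead_coeff p)\<^sup>2 * c_n"
    unfolding c_n_def d by simp
  show "x \<in> K \<Longrightarrow> 0 \<le> poly (Q * (p * p)) x" using Q_nonneg by simp
qed

lemma monic_square:
  assumes "p \<in> monic_polys n"
  shows "degree (Q * (p * p)) > 0"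
    "c_n = \<bar>lead_coeff (Q * (p * p))\<bar> * exp (real (degree (Q * (p * p))) * V)"
proof -
  have p: "p \<noteq> 0" "degree p = n" "lead_coeff p = 1" using assms by (auto simp: monic_polys_def)
  show "degree (Q * (p * p)) > 0" by (rule weighted_square(2)[OF p(1,2)])
  show "c_n = \<bar>lead_coeff (Q * (p * p))\<bar> * exp (real (degree (Q * (p * p))) * V)"
    using weighted_square(3)[OF p(1,2)] p(3) by simp
qed

text \<open>W^2 carries the factor Cap^(-2n) and S(mu) = Cap^(deg Q); their quotient collects into
  \<open>c_n\<close>.\<close>

lemma widom_iff:
  "(widom_factor2 K wmeasure n)\<^sup>2 = 2 * szego M (poly Q) \<longleftrightarrow>
    ip (orth_monic wmeasure n) (orth_monic wmeasure n) = 2 * c_n"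
proof -
  have "(widom_factor2 K wmeasure n)\<^sup>2 = ip (orth_monic wmeasure n) (orth_monic wmeasure n) / (exp V ^ n)\<^sup>2"
    unfolding widom_factor2_def L2_norm_eq cap power_divide using ip_nonneg by simp
  also have "(exp V ^ n)\<^sup>2 = exp (real (2 * n) * V)"
    by (simp add: exp_of_nat_mult[symmetric] power_mult[symmetric] mult.commute flip: exp_of_nat_mult)
  finally have e: "(widom_factor2 K wmeasure n)\<^sup>2 = ip (orth_monic wmeasure n) (orth_monic wmeasure n) / exp (real (2 * n) * V)" .
  have "c_n = exp (real (degree Q) * V) * exp (real (2 * n) * V)"
    unfolding c_n_def by (simp add: exp_add[symmetric] algebra_simps)
  then show ?thesis unfolding e szego_eq by (simp add: field_simps)
qed

lemma ip_ge: "p \<in> monic_polys n \<Longrightarrow> 2 * c_n \<le> ip p p"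
  unfolding ip_def by (rule integral_poly_ge(1)[OF monic_square(1) _ monic_square(2)]) (simp_all add: Q_nonneg)

lemma ip_eqI: "p \<in> monic_polys n \<Longrightarrow> (\<And>x. x \<in> K \<Longrightarrow> poly (Q * (p * p)) x \<le> 4 * c_n) \<Longrightarrow> ip p p = 2 * c_n"
  unfolding ip_def by (rule integral_poly_eq[OF monic_square(1) _ monic_square(2)]) (simp_all add: Q_nonneg)

text \<open>2 \<open>c_n\<close> is a lower bound for all monic polynomials of degree n, so
  attaining it identifies the minimiser.\<close>

lemma minimal_unique:
  assumes "p \<in> monic_polys n" "ip p p = 2 * c_n" shows "orth_monic wmeasure n = p"
  using orth_monic(3)[OF assms(1)] ip_ge[OF orth_monic(1)] assms(2) by simp

lemma extremal_imp_preimage: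
  assumes eq: "ip (orth_monic wmeasure n) (orth_monic wmeasure n) = 2 * c_n"
  shows "\<exists>S. degree S = n \<and> cset K = {z. poly (cpoly Q * S\<^sup>2) z \<in> complex_of_real ` {0..1}}"
proof -
  let ?P = "orth_monic wmeasure n"
  note P = orth_monic(1)[of n]
  have p: "?P \<noteq> 0" "degree ?P = n" using P by (auto simp: monic_polys_def)
  note ge = integral_poly_ge[OF monic_square(1)[OF P] _ monic_square(2)[OF P]]
  have le: "poly (Q * (?P * ?P)) x \<le> 4 * c_n" if "x \<in> K" for x
    by (rule ge(2)) (use that eq in \<open>simp_all add: Q_nonneg ip_def\<close>)
  have pre: "z \<in> cset K" if "poly (cpoly (Q * (?P * ?P))) z = of_real t" "0 \<le> t" "t \<le> 4 * c_n" for z t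
    by (rule ge(3)[OF _ _ that]) (use eq in \<open>simp_all add: Q_nonneg ip_def\<close>)
  \<comment> \<open>The scaling a^2 maps [0, 4 \<open>c_n\<close>] onto [0,1].\<close>
  define a where "a = 1 / sqrt (4 * c_n)"
  have a: "a \<noteq> 0" "a * a * (4 * c_n) = 1" using c_n_pos by (auto simp: a_def field_simps)
  define S where "S = smult (of_real a) (cpoly ?P)"
  have polyS: "poly (cpoly Q * S\<^sup>2) z = of_real (a * a) * poly (cpoly (Q * (?P * ?P))) z" for z
    by (simp add: S_def cpoly_mult power2_eq_square)
  have "degree S = n" using a(1) p(2) by (simp add: S_def degree_cpoly)
  moreover have "cset K = {z. poly (cpoly Q * S\<^sup>2) z \<in> complex_of_real ` {0..1}}"
  proof (intro equalityI subsetI CollectI)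
    fix z assume "z \<in> cset K"
    then obtain x where x: "x \<in> K" "z = of_real x" by blast
    have v: "poly (cpoly Q * S\<^sup>2) z = of_real (a * a * poly (Q * (?P * ?P)) x)"
      unfolding polyS x(2) poly_cpoly by simp
    have "a * a * poly (Q * (?P * ?P)) x \<le> a * a * (4 * c_n)" using le[OF x(1)] by (intro mult_left_mono) auto
    moreover have "0 \<le> a * a * poly (Q * (?P * ?P)) x" using Q_nonneg[OF x(1)] by simp
    ultimately show "poly (cpoly Q * S\<^sup>2) z \<in> complex_of_real ` {0..1}" unfolding v a(2) by (intro imageI) simp
  next
    fix z assume "z \<in> {z. poly (cpoly Q * S\<^sup>2) z \<in> complex_of_real ` {0..1}}"
    then obtain t where t: "0 \<le> t" "t \<le> 1" "poly (cpoly Q * S\<^sup>2) z = of_real t" by auto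
    show "z \<in> cset K"
    proof (rule pre)
      have "of_real (4 * c_n) * (of_real (a * a) * poly (cpoly (Q * (?P * ?P))) z) = complex_of_real (4 * c_n) * of_real t"
        using t(3) unfolding polyS by simp
      moreover have "complex_of_real (4 * c_n) * of_real (a * a) = 1"
        using a(2) by (metis mult.commute of_real_1 of_real_mult)
      ultimately show "poly (cpoly (Q * (?P * ?P))) z = of_real (4 * c_n * t)"
        by (simp only: mult.assoc[symmetric] mult_1_left of_real_mult)
      show "0 \<le> 4 * c_n * t" using t c_n_pos by simp
      show "4 * c_n * t \<le> 4 * c_n" using t c_n_pos by simp
    qed
  qed
  ultimately show ?thesis by blast
qed

text \<open>S is a priori complex. At points of K that are not zeros of Q, S^2 is a nonnegative
  real, so S is real there; K is infinite, hence the polynomial of imaginary parts is zero.\<close>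

lemma preimage_poly_real:
  assumes S: "cset K = {z. poly (cpoly Q * S\<^sup>2) z \<in> complex_of_real ` {0..1}}"
  obtains R where "S = cpoly R"
proof -
  have Im: "poly (map_poly Im p) x = Im (poly p (of_real x))" for p x
    by (induction p) (simp_all add: map_poly_pCons)
  have "Im (poly S (of_real x)) = 0" if x: "x \<in> K" "poly Q x \<noteq> 0" for x
  proof -
    have "of_real x \<in> cset K" using x by blast
    then obtain t where t: "0 \<le> t" "poly (cpoly Q * S\<^sup>2) (of_real x) = of_real t" unfolding S by auto
    have Qx: "0 < poly Q x" using Q_nonneg[OF x(1)] x(2) by simp
    have "of_real (poly Q x) * (poly S (of_real x))\<^sup>2 = of_real t"
      using t(2) by (simp add: poly_cpoly)
    then have "(poly S (of_real x))\<^sup>2 = of_real t / of_real (poly Q x)" using Qx by (simp add: field_simps)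
    then have sq: "(poly S (of_real x))\<^sup>2 = of_real (t / poly Q x)" by simp
    have "poly S (of_real x) = of_real (sqrt (t / poly Q x)) \<or> poly S (of_real x) = - of_real (sqrt (t / poly Q x))"
      unfolding power2_eq_iff[symmetric] sq using t(1) Qx by (simp flip: of_real_power)
    then show ?thesis by auto
  qed
  then have "K - {x. poly Q x = 0} \<subseteq> {x. poly (map_poly Im S) x = 0}" by (auto simp: Im)
  moreover have "infinite (K - {x. poly Q x = 0})"
    using K_infinite poly_roots_finite[OF Q_ne] by (rule Diff_infinite_finite[rotated])
  ultimately have "infinite {x. poly (map_poly Im S) x = 0}" by (rule infinite_super)
  then have Im0: "map_poly Im S = 0" using poly_roots_finite by blast
  have "S = cpoly (map_poly Re S)"
  proof (rule poly_eqI)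
    fix i
    have "Im (coeff S i) = coeff (map_poly Im S) i" by (simp add: coeff_map_poly)
    then show "coeff S i = coeff (cpoly (map_poly Re S)) i" by (simp add: coeff_map_poly Im0 complex_eq_iff)
  qed
  then show thesis by (rule that)
qed

text \<open>\<open>preimage_bound_eq\<close> with b = 1 fixes the leading coefficient of S: four
  times its square times \<open>c_n\<close> is 1. After division the monic polynomial satisfies the
  bound 4 \<open>c_n\<close> on K, which forces the minimal integral.\<close>

lemma preimage_imp_extremal:
  assumes dS: "degree S = n" and S: "cset K = {z. poly (cpoly Q * S\<^sup>2) z \<in> complex_of_real ` {0..1}}" and n: "n \<ge> 1"
  shows "ip (orth_monic wmeasure n) (orth_monic wmeasure n) = 2 * c_n"
    and "cpoly (orth_monic wmeasure n) = smult (1 / lead_coeff S) S"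
    and "x \<in> K \<Longrightarrow> poly (Q * (orth_monic wmeasure n * orth_monic wmeasure n)) x \<le> 4 * c_n"
proof -
  obtain R where R: "S = cpoly R" using preimage_poly_real[OF S] by blast
  have dR: "degree R = n" using dS by (simp add: R degree_cpoly)
  have R0: "R \<noteq> 0" using dR n by auto
  have lR: "lead_coeff R \<noteq> 0" using R0 by simp
  have cQ: "poly (cpoly Q * S\<^sup>2) z = poly (cpoly (Q * (R * R))) z" for z
    by (simp add: R cpoly_mult power2_eq_square)
  note ws = weighted_square[OF R0 dR]
  have "1 = 4 * ((lead_coeff R)\<^sup>2 * c_n)"
  proof (rule preimage_bound_eq[OF ws(2) _ ws(3)[symmetric]])
    show "0 \<le> poly (Q * (R * R)) x" if "x \<in> K" for x by (rule ws(4)[OF that])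
    show "(0::real) < 1" by simp
    show "poly (Q * (R * R)) x \<le> 1" if "x \<in> K" for x
    proof -
      have "of_real x \<in> cset K" using that by blast
      then obtain t where t: "t \<le> 1" "poly (cpoly Q * S\<^sup>2) (of_real x) = of_real t" unfolding S by auto
      then show ?thesis unfolding cQ poly_cpoly of_real_eq_iff by simp
    qed
    show "z \<in> cset K" if "poly (cpoly (Q * (R * R))) z = of_real t" "0 \<le> t" "t \<le> 1" for z t
      unfolding S cQ using that by auto
  qed
  then have c: "4 * c_n = (1 / lead_coeff R)\<^sup>2" using lR by (simp add: field_simps)
  define q where "q = smult (1 / lead_coeff R) R"
  have q: "q \<in> monic_polys n" using lR dR by (simp add: q_def monic_polys_def)
  have le: "poly (Q * (q * q)) x \<le> 4 * c_n" if "x \<in> K" for x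
  proof -
    have "of_real x \<in> cset K" using that by blast
    then obtain t where t: "t \<le> 1" "poly (cpoly Q * S\<^sup>2) (of_real x) = of_real t" unfolding S by auto
    then have "poly (Q * (R * R)) x \<le> 1" unfolding cQ poly_cpoly of_real_eq_iff by simp
    then have "(1 / lead_coeff R)\<^sup>2 * poly (Q * (R * R)) x \<le> (1 / lead_coeff R)\<^sup>2 * 1" by (intro mult_left_mono) auto
    moreover have "poly (Q * (q * q)) x = (1 / lead_coeff R)\<^sup>2 * poly (Q * (R * R)) x"
    proof -
      have "Q * (q * q) = smult ((1 / lead_coeff R)\<^sup>2) (Q * (R * R))"
        unfolding q_def power2_eq_square by (simp only: mult_smult_left mult_smult_right smult_smult)
      then show ?thesis by (simp only: poly_smult)
    qed
    ultimately show ?thesis unfolding c by (simp only: mult_1_right)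
  qed
  have ipq: "ip q q = 2 * c_n" by (rule ip_eqI[OF q le])
  have P: "orth_monic wmeasure n = q" by (rule minimal_unique[OF q ipq])
  show "ip (orth_monic wmeasure n) (orth_monic wmeasure n) = 2 * c_n" using ipq P by simp
  show "x \<in> K \<Longrightarrow> poly (Q * (orth_monic wmeasure n * orth_monic wmeasure n)) x \<le> 4 * c_n" using le P by simp
  have "lead_coeff S = of_real (lead_coeff R)" unfolding R by (rule lead_coeff_cpoly)
  then show "cpoly (orth_monic wmeasure n) = smult (1 / lead_coeff S) S"
    unfolding P q_def by (intro poly_eqI) (simp add: R coeff_map_poly degree_cpoly)
qed

text \<open>The sup-norm bound alone forces the minimal L2 norm by \<open>ip_eqI\<close>. So a
  competitor whose weighted sup-norm is no larger is again L2-minimal and equals P.\<close>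

lemma extremal_eq_chebyshev:
  assumes le: "\<And>x. x \<in> K \<Longrightarrow> poly (Q * (orth_monic wmeasure n * orth_monic wmeasure n)) x \<le> 4 * c_n"
  shows "orth_monic wmeasure n = weighted_chebyshev K (\<lambda>x. sqrt (poly Q x)) n"
proof -
  let ?P = "orth_monic wmeasure n" and ?w = "\<lambda>x. sqrt (poly Q x)"
  have sq: "\<bar>?w x * poly p x\<bar> = sqrt (poly (Q * (p * p)) x)" if "x \<in> K" for x p
    using Q_nonneg[OF that] by (simp add: abs_mult real_sqrt_mult)
  have bdd: "bdd_above ((\<lambda>x. \<bar>?w x * poly p x\<bar>) ` K)" for p
    by (intro bounded_imp_bdd_above compact_imp_bounded compact_continuous_image continuous_intros compact)
  have up: "\<bar>?w x * poly p x\<bar> \<le> wsup_norm K ?w p" if "x \<in> K" for x p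
    unfolding wsup_norm_def by (rule cSUP_upper[OF that bdd])
  have Kne: "K \<noteq> {}" using K_infinite by auto
  have P4: "wsup_norm K ?w ?P \<le> sqrt (4 * c_n)"
    unfolding wsup_norm_def by (rule cSUP_least[OF Kne]) (simp only: sq, intro real_sqrt_le_mono le)
  have uniq: "q = ?P" if q: "q \<in> monic_polys n" "wsup_norm K ?w q \<le> wsup_norm K ?w ?P" for q
  proof -
    have "poly (Q * (q * q)) x \<le> 4 * c_n" if x: "x \<in> K" for x
    proof -
      have "sqrt (poly (Q * (q * q)) x) \<le> sqrt (4 * c_n)"
        using up[OF x, of q] q(2) P4 unfolding sq[OF x] by linarith
      then show ?thesis by simp
    qed
    from minimal_unique[OF q(1) ip_eqI[OF q(1) this]] show ?thesis by simp
  qed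
  show ?thesis unfolding weighted_chebyshev_def
  proof (rule the_equality[symmetric])
    \<comment> \<open>Minimality follows from uniqueness: a q with norm at most that of P is P
      itself.\<close>
    have "wsup_norm K ?w ?P \<le> wsup_norm K ?w q" if "q \<in> monic_polys n" for q
      using uniq[OF that] by (cases "wsup_norm K ?w q \<le> wsup_norm K ?w ?P") auto
    then show "?P \<in> monic_polys n \<and> (\<forall>q\<in>monic_polys n. wsup_norm K ?w ?P \<le> wsup_norm K ?w q)"
      using orth_monic(1) by blast
    show "p = ?P" if "p \<in> monic_polys n \<and> (\<forall>q\<in>monic_polys n. wsup_norm K ?w p \<le> wsup_norm K ?w q)" for p
      using uniq[of p] that orth_monic(1)[of n] by blast
  qed
qed

theorem widom_extremal:
  assumes "n \<ge> 1"
  shows "((widom_factor2 K wmeasure n)\<^sup>2 = 2 * szego M (poly Q) \<longleftrightarrow>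
           (\<exists>S. degree S = n \<and> cset K = {z. poly (cpoly Q * S\<^sup>2) z \<in> complex_of_real ` {0..1}}))
      \<and> ((widom_factor2 K wmeasure n)\<^sup>2 = 2 * szego M (poly Q) \<longrightarrow>
           (\<forall>S. degree S = n \<and> cset K = {z. poly (cpoly Q * S\<^sup>2) z \<in> complex_of_real ` {0..1}} \<longrightarrow>
              cpoly (orth_monic wmeasure n) = smult (1 / lead_coeff S) S \<and>
              orth_monic wmeasure n = weighted_chebyshev K (\<lambda>x. sqrt (poly Q x)) n))"
  unfolding widom_iff
  using extremal_imp_preimage preimage_imp_extremal[OF _ _ assms] extremal_eq_chebyshev by blast

end

end

theorem theorem4:
  fixes K :: "real set" and n :: nat
  assumes reg: "dirichlet_regular (complex_of_real ` K)"
    and sub: "K \<subseteq> {-1..1}" and m1: "-1 \<in> K" and p1: "1 \<in> K"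
    and n: "n \<ge> 1"
  shows
   "(let \<mu> = density (equilibrium_measure K) (\<lambda>x. ennreal (1 - x\<^sup>2));
         w = (\<lambda>x. sqrt (1 - x\<^sup>2));
         Q = [:1, 0, -1:] :: complex poly;
         f = (\<lambda>x::real. 1 - x\<^sup>2)
     in ((widom_factor2 K \<mu> n)\<^sup>2 = 2 * szego (equilibrium_measure K) f \<longleftrightarrow>
           (\<exists>S::complex poly. degree S = n \<and>
              complex_of_real ` K = {z. poly (Q * S\<^sup>2) z \<in> complex_of_real ` {0..1}}))
      \<and> ((widom_factor2 K \<mu> n)\<^sup>2 = 2 * szego (equilibrium_measure K) f \<longrightarrow>
           (\<forall>S::complex poly. degree S = n \<and>
              complex_of_real ` K = {z. poly (Q * S\<^sup>2) z \<in> complex_of_real ` {0..1}} \<longrightarrow>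
              map_poly complex_of_real (orth_monic \<mu> n) = smult (1 / lead_coeff S) S \<and>
              orth_monic \<mu> n = weighted_chebyshev K w n)))
  \<and> (let \<mu> = density (equilibrium_measure K) (\<lambda>x. ennreal (1 + x));
         w = (\<lambda>x. sqrt (1 + x));
         Q = [:1, 1:] :: complex poly;
         f = (\<lambda>x::real. 1 + x)
     in ((widom_factor2 K \<mu> n)\<^sup>2 = 2 * szego (equilibrium_measure K) f \<longleftrightarrow>
           (\<exists>S::complex poly. degree S = n \<and>
              complex_of_real ` K = {z. poly (Q * S\<^sup>2) z \<in> complex_of_real ` {0..1}}))
      \<and> ((widom_factor2 K \<mu> n)\<^sup>2 = 2 * szego (equilibrium_measure K) f \<longrightarrow>
           (\<forall>S::complex poly. degree S = n \<and>
              complex_of_real ` K = {z. poly (Q * S\<^sup>2) z \<in> complex_of_real ` {0..1}} \<longrightarrow>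
              map_poly complex_of_real (orth_monic \<mu> n) = smult (1 / lead_coeff S) S \<and>
              orth_monic \<mu> n = weighted_chebyshev K w n)))
  \<and> (let \<mu> = density (equilibrium_measure K) (\<lambda>x. ennreal (1 - x));
         w = (\<lambda>x. sqrt (1 - x));
         Q = [:1, -1:] :: complex poly;
         f = (\<lambda>x::real. 1 - x)
     in ((widom_factor2 K \<mu> n)\<^sup>2 = 2 * szego (equilibrium_measure K) f \<longleftrightarrow>
           (\<exists>S::complex poly. degree S = n \<and>
              complex_of_real ` K = {z. poly (Q * S\<^sup>2) z \<in> complex_of_real ` {0..1}}))
      \<and> ((widom_factor2 K \<mu> n)\<^sup>2 = 2 * szego (equilibrium_measure K) f \<longrightarrow>
           (\<forall>S::complex poly. degree S = n \<and>
              complex_of_real ` K = {z. poly (Q * S\<^sup>2) z \<in> complex_of_real ` {0..1}} \<longrightarrow>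
              map_poly complex_of_real (orth_monic \<mu> n) = smult (1 / lead_coeff S) S \<and>
              orth_monic \<mu> n = weighted_chebyshev K w n)))"
proof -
  \<comment> \<open>The endpoints serve twice: as two distinct points of K, which gives positive
    capacity, and as the zeros of the three weights.\<close>
  have "(-1::real) \<noteq> 1" by simp
  from regular_log_equilibrium[OF reg sub m1 p1 this] obtain V
    where E: "log_equilibrium K (equilibrium_measure K) V" and cap: "log_capacity K = exp V" by blast
  interpret log_equilibrium K "equilibrium_measure K" V by (rule E)
  have roots: "-1 \<in> cset K" "1 \<in> cset K" using imageI[OF m1, of complex_of_real] imageI[OF p1, of complex_of_real] by simp_all
  have K1: "-1 \<le> x" "x \<le> 1" if "x \<in> K" for x using subsetD[OF sub that] by auto
  have W1: "weighted_equilibrium K (equilibrium_measure K) V [:1, 0, -1:]"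
  proof unfold_locales
    show "0 \<le> poly [:1, 0, -1:] x" if "x \<in> K" for x :: real
      using K1[OF that] abs_square_le_1[of x] by (simp add: power2_eq_square abs_le_iff)
    show "z \<in> cset K" if "poly (cpoly [:1, 0, -1:]) z = 0" for z
    proof -
      have "z\<^sup>2 = 1" using that by (simp add: map_poly_pCons power2_eq_square algebra_simps)
      then show ?thesis using roots by (auto simp: power2_eq_1_iff)
    qed
  qed (simp_all add: cap)
  have W2: "weighted_equilibrium K (equilibrium_measure K) V [:1, 1:]"
  proof unfold_locales
    show "0 \<le> poly [:1, 1:] x" if "x \<in> K" for x :: real using K1[OF that] by simp
    show "z \<in> cset K" if "poly (cpoly [:1, 1:]) z = 0" for z
    proof -
      have "z = -1" using that by (simp add: map_poly_pCons add_eq_0_iff)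
      then show ?thesis using roots by simp
    qed
  qed (simp_all add: cap)
  have W3: "weighted_equilibrium K (equilibrium_measure K) V [:1, -1:]"
  proof unfold_locales
    show "0 \<le> poly [:1, -1:] x" if "x \<in> K" for x :: real using K1[OF that] by simp
    show "z \<in> cset K" if "poly (cpoly [:1, -1:]) z = 0" for z
    proof -
      have "z = 1" using that by (simp add: map_poly_pCons)
      then show ?thesis using roots by simp
    qed
  qed (simp_all add: cap)
  have f: "poly [:1, 0, -1:] = (\<lambda>x::real. 1 - x\<^sup>2)" "poly [:1, 1:] = (\<lambda>x::real. 1 + x)" "poly [:1, -1:] = (\<lambda>x::real. 1 - x)"
    by (auto simp: fun_eq_iff power2_eq_square)
  have q: "cpoly [:1, 0, -1:] = [:1, 0, -1:]" "cpoly [:1, 1:] = [:1, 1:]" "cpoly [:1, -1:] = [:1, -1:]"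
    by (simp_all add: map_poly_pCons)
  show ?thesis
    unfolding Let_def
    by (rule conjI[OF weighted_equilibrium.widom_extremal[OF W1 n, unfolded f q]
          conjI[OF weighted_equilibrium.widom_extremal[OF W2 n, unfolded f q]
            weighted_equilibrium.widom_extremal[OF W3 n, unfolded f q]]])
qed

end
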